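(* Let $M$ be a transitive class that is definable in $V$ (by a first-order formula without parameters). Then there is no nontrivial elementary embedding $j:M\to V$.
   Context: Work in NGBC; the result is a scheme over defining formulas of $M$, and $j$ ranges over arbitrary classes. An elementary embedding between transitive proper class models of ZF means a $\Delta_0$-elementary cofinal map: every set lies in $j(x)$ for some $x\in M$. Nontrivial means not the identity of a model onto itself. *)

theory Defs
  imports Main
begin

text \<open>
  A model of second-order set theory is given in the usual form \<open>(V, E, \<C>)\<close>: the sets are the
  elements of the type \<open>'s\<close>, \<open>E x y\<close> says that \<open>x\<close> is an element of \<open>y\<close>, and the classes are the
  members of \<open>\<C>\<close>, a family of subsets of \<open>'s\<close>. Extensionality for classes is thus automatic,
  and the universe \<open>V\<close> is \<open>UNIV\<close>.

  Formulas have no class quantifiers. \<open>ClassMem i k\<close> says that the set variable \<open>i\<close>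
  belongs to the class variable \<open>k\<close>; class variables serve only as parameters in comprehension.
\<close>

datatype fm =
    Mem nat nat
  | Eq nat nat
  | ClassMem nat nat
  | Neg fm
  | Conj fm fm
  | Exists nat fm

primrec sat ::
  "('s \<Rightarrow> 's \<Rightarrow> bool) \<Rightarrow> 's set \<Rightarrow> (nat \<Rightarrow> 's set) \<Rightarrow> (nat \<Rightarrow> 's) \<Rightarrow> fm \<Rightarrow> bool" where
  "sat E D C e (Mem i k) \<longleftrightarrow> E (e i) (e k)"
| "sat E D C e (Eq i k) \<longleftrightarrow> e i = e k"
| "sat E D C e (ClassMem i k) \<longleftrightarrow> e i \<in> C k"
| "sat E D C e (Neg \<phi>) \<longleftrightarrow> \<not> sat E D C e \<phi>"
| "sat E D C e (Conj \<phi> \<psi>) \<longleftrightarrow> sat E D C e \<phi> \<and> sat E D C e \<psi>"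
| "sat E D C e (Exists i \<phi>) \<longleftrightarrow> (\<exists>x\<in>D. sat E D C (e(i := x)) \<phi>)"

primrec free_vars :: "fm \<Rightarrow> nat set" where
  "free_vars (Mem i k) = {i, k}"
| "free_vars (Eq i k) = {i, k}"
| "free_vars (ClassMem i k) = {i}"
| "free_vars (Neg \<phi>) = free_vars \<phi>"
| "free_vars (Conj \<phi> \<psi>) = free_vars \<phi> \<union> free_vars \<psi>"
| "free_vars (Exists i \<phi>) = free_vars \<phi> - {i}"

primrec class_vars :: "fm \<Rightarrow> nat set" where
  "class_vars (Mem i k) = {}"
| "class_vars (Eq i k) = {}"
| "class_vars (ClassMem i k) = {k}"
| "class_vars (Neg \<phi>) = class_vars \<phi>"
| "class_vars (Conj \<phi> \<psi>) = class_vars \<phi> \<union> class_vars \<psi>"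
| "class_vars (Exists i \<phi>) = class_vars \<phi>"

inductive delta0 :: "fm \<Rightarrow> bool" where
  "delta0 (Mem i k)"
| "delta0 (Eq i k)"
| "delta0 \<phi> \<Longrightarrow> delta0 (Neg \<phi>)"
| "delta0 \<phi> \<Longrightarrow> delta0 \<psi> \<Longrightarrow> delta0 (Conj \<phi> \<psi>)"
| "i \<noteq> k \<Longrightarrow> delta0 \<phi> \<Longrightarrow> delta0 (Exists i (Conj (Mem i k) \<phi>))"

definition is_upair :: "('s \<Rightarrow> 's \<Rightarrow> bool) \<Rightarrow> 's \<Rightarrow> 's \<Rightarrow> 's \<Rightarrow> bool" where
  "is_upair E p x y \<longleftrightarrow> (\<forall>z. E z p \<longleftrightarrow> z = x \<or> z = y)"

text \<open>Kuratowski pairs.\<close>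

definition is_opair :: "('s \<Rightarrow> 's \<Rightarrow> bool) \<Rightarrow> 's \<Rightarrow> 's \<Rightarrow> 's \<Rightarrow> bool" where
  "is_opair E p x y \<longleftrightarrow> (\<exists>s t. is_upair E s x x \<and> is_upair E t x y \<and> is_upair E p s t)"

definition maps_to :: "('s \<Rightarrow> 's \<Rightarrow> bool) \<Rightarrow> 's set \<Rightarrow> 's \<Rightarrow> 's \<Rightarrow> bool" where
  "maps_to E F x y \<longleftrightarrow> (\<exists>p\<in>F. is_opair E p x y)"

definition functional :: "('s \<Rightarrow> 's \<Rightarrow> bool) \<Rightarrow> 's set \<Rightarrow> bool" where
  "functional E F \<longleftrightarrow> (\<forall>x y z. maps_to E F x y \<longrightarrow> maps_to E F x z \<longrightarrow> y = z)"

definition class_fun :: "('s \<Rightarrow> 's \<Rightarrow> bool) \<Rightarrow> 's set \<Rightarrow> 's set \<Rightarrow> 's set \<Rightarrow> bool" where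
  "class_fun E F A B \<longleftrightarrow>
     (\<forall>p\<in>F. \<exists>x\<in>A. \<exists>y\<in>B. is_opair E p x y) \<and> (\<forall>x\<in>A. \<exists>!y. maps_to E F x y)"

text \<open>
  Replacement is stated for partial class functions, so it includes separation. The choice
  axiom is global choice.
\<close>

locale NGBC =
  fixes E :: "'s \<Rightarrow> 's \<Rightarrow> bool" and \<C> :: "'s set set"
  assumes extensionality: "(\<forall>z. E z x \<longleftrightarrow> E z y) \<Longrightarrow> x = y"
    and sets_are_classes: "{y. E y x} \<in> \<C>"
    and pairing: "\<exists>p. is_upair E p x y"
    and union: "\<exists>u. \<forall>z. E z u \<longleftrightarrow> (\<exists>y. E y x \<and> E z y)"
    and power_set: "\<exists>p. \<forall>z. E z p \<longleftrightarrow> (\<forall>w. E w z \<longrightarrow> E w x)"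
    and infinity:
      "\<exists>w. (\<exists>z. (\<forall>y. \<not> E y z) \<and> E z w) \<and>
           (\<forall>x. E x w \<longrightarrow> (\<exists>s. (\<forall>y. E y s \<longleftrightarrow> E y x \<or> y = x) \<and> E s w))"
    and foundation: "A \<in> \<C> \<Longrightarrow> A \<noteq> {} \<Longrightarrow> \<exists>x\<in>A. \<forall>y\<in>A. \<not> E y x"
    and comprehension:
      "(\<forall>k. C k \<in> \<C>) \<Longrightarrow> {x. sat E UNIV C (e(0 := x)) \<phi>} \<in> \<C>"
    and replacement:
      "F \<in> \<C> \<Longrightarrow> functional E F \<Longrightarrow> \<exists>b. \<forall>y. E y b \<longleftrightarrow> (\<exists>x. E x a \<and> maps_to E F x y)"
    and global_choice:
      "\<exists>F\<in>\<C>. functional E F \<and> (\<forall>x. (\<exists>y. E y x) \<longrightarrow> (\<exists>y. E y x \<and> maps_to E F x y))"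

definition transitive_class :: "('s \<Rightarrow> 's \<Rightarrow> bool) \<Rightarrow> 's set \<Rightarrow> bool" where
  "transitive_class E M \<longleftrightarrow> (\<forall>x\<in>M. \<forall>y. E y x \<longrightarrow> y \<in> M)"

text \<open>
  The formula quantifies over sets only and mentions no classes. Variable 0 is its only free
  variable, so the values of the assignment elsewhere are irrelevant, as is the class assignment.
\<close>

definition definable_without_params :: "('s \<Rightarrow> 's \<Rightarrow> bool) \<Rightarrow> 's set \<Rightarrow> bool" where
  "definable_without_params E M \<longleftrightarrow>
     (\<exists>\<phi>. class_vars \<phi> = {} \<and> free_vars \<phi> \<subseteq> {0} \<and> M = {x. sat E UNIV (\<lambda>_. {}) (\<lambda>_. x) \<phi>})"

definition delta0_elementary :: "('s \<Rightarrow> 's \<Rightarrow> bool) \<Rightarrow> 's set \<Rightarrow> 's set \<Rightarrow> 's set \<Rightarrow> bool" where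
  "delta0_elementary E j M N \<longleftrightarrow>
     (\<forall>\<phi> e e'. delta0 \<phi> \<longrightarrow> (\<forall>n. e n \<in> M \<and> maps_to E j (e n) (e' n)) \<longrightarrow>
        (sat E M (\<lambda>_. {}) e \<phi> \<longleftrightarrow> sat E N (\<lambda>_. {}) e' \<phi>))"

definition cofinal_map :: "('s \<Rightarrow> 's \<Rightarrow> bool) \<Rightarrow> 's set \<Rightarrow> 's set \<Rightarrow> 's set \<Rightarrow> bool" where
  "cofinal_map E j M N \<longleftrightarrow> (\<forall>y\<in>N. \<exists>x\<in>M. \<exists>z. maps_to E j x z \<and> E y z)"

definition elementary_embedding ::
  "('s \<Rightarrow> 's \<Rightarrow> bool) \<Rightarrow> 's set \<Rightarrow> 's set \<Rightarrow> 's set \<Rightarrow> bool" where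
  "elementary_embedding E j M N \<longleftrightarrow>
     class_fun E j M N \<and> delta0_elementary E j M N \<and> cofinal_map E j M N"

text \<open>The inclusion of a proper subclass \<open>M\<close> of \<open>N\<close> into \<open>N\<close> counts as nontrivial.\<close>

definition nontrivial :: "('s \<Rightarrow> 's \<Rightarrow> bool) \<Rightarrow> 's set \<Rightarrow> 's set \<Rightarrow> 's set \<Rightarrow> bool" where
  "nontrivial E j M N \<longleftrightarrow> \<not> (M = N \<and> (\<forall>x\<in>M. maps_to E j x x))"

end

theory Submission
  imports Defs
begin

text \<open>
  Write \<open>J\<close> for the embedding. A set \<open>X \<subseteq> M\<close> is covered by an element of \<open>M\<close>, since the set
  \<open>J ` X\<close> belongs to some \<open>J c\<close>; this gives collection in \<open>M\<close>, and Gaifman's argument shows that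
  \<open>J\<close> is fully elementary, also for classes that \<open>J\<close> respects piecewise. If \<open>J\<close> fixed all ordinals,
  it would be onto and hence the identity, so there is a least moved ordinal \<open>\<kappa>\<close>.

  Let \<open>M\<^sub>n\<close> be the domain of the \<open>n\<close>-fold iterate of \<open>J\<close>. The formula that defines \<open>M\<close> in \<open>V\<close> defines
  \<open>M\<^sub>n\<^sub>+\<^sub>1\<close> in \<open>M\<^sub>n\<close>. Were \<open>M\<close> and \<open>V\<close> to disagree on a \<open>\<Sigma>\<^sub>1\<close> property of ordinals, the least
  disagreements between \<open>M\<^sub>n\<close> and \<open>M\<^sub>n\<^sub>+\<^sub>1\<close> would form a descending sequence of ordinals. So \<open>M\<close> and \<open>V\<close>
  agree about cofinality \<open>\<omega>\<close> and about regularity. Hence \<open>J\<close> fixes the supremum \<open>\<lambda>\<close> of the iterates of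
  \<open>\<kappa>\<close> and the least regular \<open>\<delta> > \<lambda>\<close>, and \<open>J ` \<delta>\<close> is unbounded in \<open>\<delta>\<close> and closed under limits of
  cofinality \<open>\<omega>\<close>. As in Woodin's proof of the Kunen inconsistency, some \<open>h \<in> M\<close> splits \<open>\<delta>\<close> into \<open>\<delta>\<close>
  pieces of which each meets every such set. In particular \<open>J h\<close> takes the value \<open>\<kappa>\<close> at some \<open>J \<beta>\<close>, so
  \<open>\<kappa> = J (h \<beta>)\<close> is in the range of \<open>J\<close>, which is impossible.
\<close>

section \<open>Definability\<close>

text \<open>The obstacle is that \<open>J\<close> restricted to an ordinal need not belong to
  \<open>M\<close>, and that \<open>M\<close> might compute cofinalities differently from
  \<open>V\<close>. \<open>J\<close> is continuous at an ordinal to which \<open>M\<close>, not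
  merely \<open>V\<close>, gives cofinality omega, yet the pointwise image of \<delta> must be
  closed at limits seen in \<open>V\<close>. Definability of \<open>M\<close> enters to close this
  gap. Closure is available only at such limits, so the splitting of \<delta> has to be done on
  points of cofinality omega.

  No axiom of ZF is assumed to hold in \<open>M\<close>; those that are used are pulled back from
  \<open>V\<close> along \<open>J\<close>.

  The model may be ill-founded seen from outside, with nonstandard natural numbers. The iterates are
  therefore indexed inside the model, and a claim about all \<open>M\<^sub>n\<close> has to be one
  definable predicate of \<open>n\<close>, proved by internal induction. Elementarity, being a
  scheme over formulas of the metatheory, becomes a relation \<open>elem\<close> between predicates
  on \<open>M\<close> and on \<open>V\<close>, generated along the construction of formulas.\<close>

definition scons :: "'a \<Rightarrow> (nat \<Rightarrow> 'a) \<Rightarrow> nat \<Rightarrow> 'a" (infixr "##" 65) where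
  "x ## e = case_nat x e"

lemma scons_simps [simp]: "(x ## e) 0 = x" "(x ## e) (Suc n) = e n"
  by (simp_all add: scons_def)

lemma scons_comp: "(\<lambda>n. (x ## e) (case n of 0 \<Rightarrow> 0 | Suc k \<Rightarrow> Suc (f k))) = x ## (\<lambda>n. e (f n))"
  by (rule ext) (simp add: scons_def split: nat.split)

primrec all_vars :: "fm \<Rightarrow> nat set" where
  "all_vars (Mem i k) = {i, k}"
| "all_vars (Eq i k) = {i, k}"
| "all_vars (ClassMem i k) = {i}"
| "all_vars (Neg \<phi>) = all_vars \<phi>"
| "all_vars (Conj \<phi> \<psi>) = all_vars \<phi> \<union> all_vars \<psi>"
| "all_vars (Exists i \<phi>) = insert i (all_vars \<phi>)"

lemma finite_all_vars [simp]: "finite (all_vars \<phi>)"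
  by (induction \<phi>) auto

primrec rename :: "(nat \<Rightarrow> nat) \<Rightarrow> (nat \<Rightarrow> nat) \<Rightarrow> fm \<Rightarrow> fm" where
  "rename f g (Mem i k) = Mem (f i) (f k)"
| "rename f g (Eq i k) = Eq (f i) (f k)"
| "rename f g (ClassMem i k) = ClassMem (f i) (g k)"
| "rename f g (Neg \<phi>) = Neg (rename f g \<phi>)"
| "rename f g (Conj \<phi> \<psi>) = Conj (rename f g \<phi>) (rename f g \<psi>)"
| "rename f g (Exists i \<phi>) = Exists (f i) (rename f g \<phi>)"

text \<open>Injectivity on all variables, bound ones included, rules out capture: updating
  \<open>e\<close> at \<open>i\<close> then matches updating \<open>e'\<close> at
  \<open>f i\<close>. Class variables are never bound, so \<open>g\<close> need not be
  injective.\<close>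

lemma sat_rename:
  assumes "inj_on f (all_vars \<phi>)"
    and "\<And>i. i \<in> all_vars \<phi> \<Longrightarrow> e i = e' (f i)" and "\<And>k. C k = C' (g k)"
  shows "sat E D C e \<phi> \<longleftrightarrow> sat E D C' e' (rename f g \<phi>)"
proof -
  have "sat E D C e \<psi> \<longleftrightarrow> sat E D C' e' (rename f g \<psi>)"
    if "all_vars \<psi> \<subseteq> all_vars \<phi>" "\<forall>i\<in>all_vars \<phi>. e i = e' (f i)" for \<psi> e e'
    using that
  proof (induction \<psi> arbitrary: e e')
    case (Exists i \<psi>)
    have "sat E D C (e(i := x)) \<psi> \<longleftrightarrow> sat E D C' (e'(f i := x)) (rename f g \<psi>)" for x
      using Exists.prems assms(1) by (intro Exists.IH) (auto dest: inj_onD)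
    then show ?case by simp
  qed (auto simp: assms(3))
  with assms(2) show ?thesis by blast
qed

lemma fresh_var: "\<exists>m. (\<forall>i \<in> all_vars \<phi>. i < m) \<and> k < m"
proof -
  have "finite (insert k (all_vars \<phi>))" by simp
  then obtain m where "\<forall>i\<in>insert k (all_vars \<phi>). i < m"
    using finite_nat_set_iff_bounded by meson
  then show ?thesis by auto
qed

context NGBC
begin

notation E (infix "eps" 50)

lemma class_nonempty: "\<exists>C :: nat \<Rightarrow> 's set. \<forall>k. C k \<in> \<C>"
  using sets_are_classes by (intro exI[of _ "\<lambda>_. {y. y eps undefined}"]) simp

text \<open>
  The predicates on assignments that are definable with class parameters; \<open>\<lambda>e. e i\<close> plays the
  role of a variable, in de Bruijn style.
\<close>

inductive definable :: "((nat \<Rightarrow> 's) \<Rightarrow> bool) \<Rightarrow> bool" where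
  definable_mem0: "definable (\<lambda>e. e i eps e k)"
| definable_eq0: "definable (\<lambda>e. e i = e k)"
| definable_class0: "X \<in> \<C> \<Longrightarrow> definable (\<lambda>e. e i \<in> X)"
| definable_not: "definable P \<Longrightarrow> definable (\<lambda>e. \<not> P e)"
| definable_conj: "definable P \<Longrightarrow> definable Q \<Longrightarrow> definable (\<lambda>e. P e \<and> Q e)"
| definable_ex0: "definable P \<Longrightarrow> definable (\<lambda>e. \<exists>x. P (x ## e))"

named_theorems def_rules

lemma definable_rename: "definable P \<Longrightarrow> definable (\<lambda>e. P (\<lambda>n. e (f n)))"
proof (induction arbitrary: f rule: definable.induct)
  case (definable_ex0 P)
  from definable.definable_ex0[OF definable_ex0.IH[of "\<lambda>n. case n of 0 \<Rightarrow> 0 | Suc k \<Rightarrow> Suc (f k)"]]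
  show ?case by (simp add: scons_comp)
qed (auto intro: definable.intros)

text \<open>Turns a de Bruijn predicate into a formula with named variables, the form in which
  comprehension is assumed.\<close>

lemma definable_sat_ex: "definable P \<Longrightarrow> \<exists>\<phi> C. (\<forall>k. C k \<in> \<C>) \<and> (\<forall>e. P e = sat E UNIV C e \<phi>)"
proof (induction rule: definable.induct)
  case (definable_mem0 i k)
  show ?case using class_nonempty by (intro exI[of _ "Mem i k"]) auto
next
  case (definable_eq0 i k)
  show ?case using class_nonempty by (intro exI[of _ "Eq i k"]) auto
next
  case (definable_class0 X i)
  then show ?case by (intro exI[of _ "ClassMem i 0"] exI[of _ "\<lambda>_. X"]) auto
next
  case (definable_not P)
  then obtain \<phi> C where "\<forall>k. C k \<in> \<C>" "\<forall>e. P e = sat E UNIV C e \<phi>" by blast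
  then show ?case by (intro exI[of _ "Neg \<phi>"] exI[of _ C]) auto
next
  case (definable_conj P Q)
  then obtain \<phi> C \<psi> D where 1: "\<forall>k. C k \<in> \<C>" "\<forall>e. P e = sat E UNIV C e \<phi>"
    "\<forall>k. D k \<in> \<C>" "\<forall>e. Q e = sat E UNIV D e \<psi>" by blast
  \<comment> \<open>Interleaving the parameters, even indices for \<open>C\<close> and odd ones for
    \<open>D\<close>, serves both conjuncts with one class assignment.\<close>
  define B where "B k = (if even k then C (k div 2) else D (k div 2))" for k :: nat
  have "sat E UNIV C e \<phi> \<longleftrightarrow> sat E UNIV B e (rename id (\<lambda>k. 2 * k) \<phi>)" for e
    by (rule sat_rename) (auto simp: B_def)
  moreover have "sat E UNIV D e \<psi> \<longleftrightarrow> sat E UNIV B e (rename id (\<lambda>k. Suc (2 * k)) \<psi>)" for e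
    by (rule sat_rename) (auto simp: B_def)
  moreover have "B k \<in> \<C>" for k using 1 by (simp add: B_def)
  ultimately show ?case using 1
    by (intro exI[of _ "Conj (rename id (\<lambda>k. 2 * k) \<phi>) (rename id (\<lambda>k. Suc (2 * k)) \<psi>)"]
        exI[of _ B]) auto
next
  case (definable_ex0 P)
  then obtain \<phi> C where 1: "\<forall>k. C k \<in> \<C>" "\<forall>e. P e = sat E UNIV C e \<phi>" by blast
  obtain m where m: "\<forall>i \<in> all_vars \<phi>. i < m" using fresh_var by blast
  \<comment> \<open>The quantified variable has index 0; it becomes the fresh name \<open>m\<close>,
    and the others shift down by one.\<close>
  define f where "f n = (case n of 0 \<Rightarrow> m | Suc k \<Rightarrow> k)" for n
  have "sat E UNIV C (x ## e) \<phi> \<longleftrightarrow> sat E UNIV C (e(m := x)) (rename f id \<phi>)" for x e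
  proof (rule sat_rename)
    show "inj_on f (all_vars \<phi>)"
      using m by (auto simp: inj_on_def f_def split: nat.splits)
    show "(x ## e) i = (e(m := x)) (f i)" if "i \<in> all_vars \<phi>" for i
      using m that by (auto simp: f_def scons_def split: nat.splits)
  qed auto
  with 1 show ?case by (intro exI[of _ "Exists m (rename f id \<phi>)"] exI[of _ C]) auto
qed

lemma definable_class: "definable (\<lambda>e. Q (e 0)) \<Longrightarrow> {x. Q x} \<in> \<C>"
proof -
  assume "definable (\<lambda>e. Q (e 0))"
  from definable_sat_ex[OF this] obtain \<phi> C
    where 1: "\<forall>k. C k \<in> \<C>" "\<forall>e. Q (e 0) = sat E UNIV C e \<phi>" by blast
  from comprehension[OF 1(1), of undefined \<phi>] 1(2)[THEN spec, of "undefined(0 := _)"]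
  show ?thesis by simp
qed

lemma singleton_class: "{a} \<in> \<C>"
proof -
  obtain p where "is_upair E p a a" using pairing by blast
  then have "{y. y eps p} = {a}" by (auto simp: is_upair_def)
  then show ?thesis using sets_are_classes by metis
qed

lemma definable_const [def_rules]: "definable (\<lambda>e. b)"
proof (cases b)
  case True
  then show ?thesis using definable_eq0[of 0 0] by simp
next
  case False
  then show ?thesis using definable_not[OF definable_eq0[of 0 0]] by simp
qed

lemmas [def_rules] = definable_not definable_conj

lemma definable_disj [def_rules]: "definable P \<Longrightarrow> definable Q \<Longrightarrow> definable (\<lambda>e. P e \<or> Q e)"
  using definable_not[OF definable_conj[OF definable_not definable_not]] by simp

lemma definable_imp [def_rules]: "definable P \<Longrightarrow> definable Q \<Longrightarrow> definable (\<lambda>e. P e \<longrightarrow> Q e)"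
  using definable_not[OF definable_conj[OF _ definable_not]] by simp

lemma definable_iff [def_rules]: "definable P \<Longrightarrow> definable Q \<Longrightarrow> definable (\<lambda>e. P e = Q e)"
  using definable_conj[OF definable_imp[of P Q] definable_imp[of Q P]] by (simp add: iff_conv_conj_imp)

lemma definable_ex [def_rules]: "definable (\<lambda>e. R (e 0) (\<lambda>n. e (Suc n))) \<Longrightarrow> definable (\<lambda>e. \<exists>x. R x e)"
  using definable_ex0[of "\<lambda>e. R (e 0) (\<lambda>n. e (Suc n))"] by simp

lemma definable_all [def_rules]: "definable (\<lambda>e. R (e 0) (\<lambda>n. e (Suc n))) \<Longrightarrow> definable (\<lambda>e. \<forall>x. R x e)"
  using definable_not[OF definable_ex[of "\<lambda>x e. \<not> R x e"]] definable_not by simp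

section \<open>Definable terms\<close>

definition def_term :: "((nat \<Rightarrow> 's) \<Rightarrow> 's) \<Rightarrow> bool" where
  "def_term t \<longleftrightarrow> definable (\<lambda>e. e 0 = t (\<lambda>n. e (Suc n)))"

lemma def_term_var [def_rules]: "def_term (\<lambda>e. e i)"
  by (simp add: def_term_def definable_eq0)

lemma def_term_const [def_rules]: "def_term (\<lambda>e. a)"
  using definable_class0[OF singleton_class, of 0 a] by (simp add: def_term_def)

text \<open>Substitution is quantification over the value: some \<open>x\<close> equals
  \<open>t e\<close> and satisfies \<open>P (x ## e)\<close>.\<close>

lemma definable_subst: "definable P \<Longrightarrow> def_term t \<Longrightarrow> definable (\<lambda>e. P (t e ## e))"
proof -
  assume P: "definable P" and t: "def_term t"
  have "definable (\<lambda>e. e 0 = t (\<lambda>n. e (Suc n)) \<and> P e)"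
    using P t by (auto simp: def_term_def intro: definable_conj)
  from definable_ex0[OF this] show ?thesis by simp
qed

lemma def_term_weaken: "def_term t \<Longrightarrow> def_term (\<lambda>e. t (\<lambda>n. e (Suc n)))"
  using definable_rename[of "\<lambda>e. e 0 = t (\<lambda>n. e (Suc n))" "\<lambda>n. case n of 0 \<Rightarrow> 0 | Suc k \<Rightarrow> Suc (Suc k)"]
  by (simp add: def_term_def)

lemma def_app1: "definable (\<lambda>e. Q (e 0)) \<Longrightarrow> def_term t \<Longrightarrow> definable (\<lambda>e. Q (t e))"
  using definable_subst[of "\<lambda>e. Q (e 0)" t] by simp

lemma def_app2:
  assumes "definable (\<lambda>e. Q (e 0) (e 1))" "def_term t" "def_term s"
  shows "definable (\<lambda>e. Q (t e) (s e))"
proof -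
  have "definable (\<lambda>e. Q (e 1) (e 0))"
    using definable_rename[OF assms(1), of "\<lambda>n. if n = 0 then 1 else 0"] by simp
  from definable_subst[OF this def_term_weaken[OF assms(3)]] have "definable (\<lambda>e. Q (e 0) (s (\<lambda>n. e (Suc n))))"
    by simp
  from definable_subst[OF this assms(2)] show ?thesis by simp
qed

lemma def_app3:
  assumes "definable (\<lambda>e. Q (e 0) (e 1) (e 2))" "def_term t" "def_term s" "def_term r"
  shows "definable (\<lambda>e. Q (t e) (s e) (r e))"
proof -
  have "definable (\<lambda>e. Q (e 1) (e 2) (e 0))"
    using definable_rename[OF assms(1), of "\<lambda>n. if n = 0 then 1 else if n = 1 then 2 else 0"] by simp
  from definable_subst[OF this def_term_weaken[OF def_term_weaken[OF assms(4)]]]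
  have "definable (\<lambda>e. Q (e 0) (e 1) (r (\<lambda>n. e (Suc (Suc n)))))" by (simp add: numeral_2_eq_2)
  then have "definable (\<lambda>e. Q (e 1) (e 0) (r (\<lambda>n. e (Suc (Suc n)))))"
    using definable_rename[of "\<lambda>e. Q (e 0) (e 1) (r (\<lambda>n. e (Suc (Suc n))))"
        "\<lambda>n. if n = 0 then 1 else if n = 1 then 0 else n"] by simp
  from definable_subst[OF this def_term_weaken[OF assms(3)]]
  have "definable (\<lambda>e. Q (e 0) (s (\<lambda>n. e (Suc n))) (r (\<lambda>n. e (Suc n))))" by simp
  from definable_subst[OF this assms(2)] show ?thesis by simp
qed

lemma def_term_app1: "def_term (\<lambda>e. F (e 0)) \<Longrightarrow> def_term t \<Longrightarrow> def_term (\<lambda>e. F (t e))"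
  unfolding def_term_def[of "\<lambda>e. F (t e)"]
  by (rule def_app2[of "\<lambda>x y. x = F y" "\<lambda>e. e 0" "\<lambda>e. t (\<lambda>n. e (Suc n))"])
    (simp_all add: def_term_def[of "\<lambda>e. F (e 0)"] def_term_weaken def_term_var)

lemma def_term_app2:
  assumes "def_term (\<lambda>e. F (e 0) (e 1))" "def_term t" "def_term s"
  shows "def_term (\<lambda>e. F (t e) (s e))"
proof -
  have "definable (\<lambda>e. e 0 = F (e 1) (e 2))"
    using assms(1) by (simp add: def_term_def numeral_2_eq_2)
  from def_app3[OF this def_term_var[of 0] def_term_weaken[OF assms(2)] def_term_weaken[OF assms(3)]]
  show ?thesis by (simp add: def_term_def)
qed

lemma definable_eq [def_rules]: "def_term t \<Longrightarrow> def_term s \<Longrightarrow> definable (\<lambda>e. t e = s e)"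
  by (rule def_app2) (simp add: definable_eq0)

lemma definable_mem [def_rules]: "def_term t \<Longrightarrow> def_term s \<Longrightarrow> definable (\<lambda>e. t e eps s e)"
  by (rule def_app2) (simp add: definable_mem0)

lemma definable_in_class [def_rules]: "X \<in> \<C> \<Longrightarrow> def_term t \<Longrightarrow> definable (\<lambda>e. t e \<in> X)"
  by (rule def_app1) (simp add: definable_class0)

lemma definable_ball [def_rules]:
  "X \<in> \<C> \<Longrightarrow> definable (\<lambda>e. R (e 0) (\<lambda>n. e (Suc n))) \<Longrightarrow> definable (\<lambda>e. \<forall>x\<in>X. R x e)"
  unfolding Ball_def by (intro def_rules)

lemma definable_bex [def_rules]:
  "X \<in> \<C> \<Longrightarrow> definable (\<lambda>e. R (e 0) (\<lambda>n. e (Suc n))) \<Longrightarrow> definable (\<lambda>e. \<exists>x\<in>X. R x e)"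
  unfolding Bex_def by (intro def_rules)

lemma UNIV_class [def_rules]: "UNIV \<in> \<C>"
  using definable_class[of "\<lambda>_. True"] definable_const by simp

text \<open>\<open>set_of A\<close> is the empty set when \<open>A\<close> is a proper class.\<close>

definition small :: "'s set \<Rightarrow> bool" where
  "small A \<longleftrightarrow> (\<exists>y. \<forall>x. x eps y \<longleftrightarrow> x \<in> A)"

definition set_of :: "'s set \<Rightarrow> 's" where
  "set_of A = (THE y. if small A then \<forall>x. x eps y \<longleftrightarrow> x \<in> A else \<forall>x. \<not> x eps y)"

lemma set_eq: "(\<And>z. z eps x \<longleftrightarrow> z eps y) \<Longrightarrow> x = y"
  using extensionality by blast

lemma ex_empty: "\<exists>z. \<forall>y. \<not> y eps z"
  using infinity by blast

lemma eq_set_of_iff: "y = set_of A \<longleftrightarrow> (if small A then \<forall>x. x eps y \<longleftrightarrow> x \<in> A else \<forall>x. \<not> x eps y)"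
proof -
  let ?P = "\<lambda>y. if small A then \<forall>x. x eps y \<longleftrightarrow> x \<in> A else \<forall>x. \<not> x eps y"
  obtain z where "\<forall>y. \<not> y eps z" using ex_empty by blast
  then have "\<exists>y. ?P y" unfolding small_def by (cases "\<exists>y. \<forall>x. x eps y \<longleftrightarrow> x \<in> A") metis+
  moreover have uniq: "y = z" if "?P y" "?P z" for y z
    using that by (intro set_eq) (auto split: if_splits)
  ultimately have "\<exists>!y. ?P y" by blast
  then have "?P (set_of A)" unfolding set_of_def by (rule theI')
  with uniq show ?thesis by blast
qed

lemma mem_set_of [simp]: "small A \<Longrightarrow> x eps set_of A \<longleftrightarrow> x \<in> A"
  using iffD1[OF eq_set_of_iff refl, of A] by presburger

text \<open>The extension of \<open>Q\<close> may be a proper class: thanks to the default value of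
  \<open>set_of\<close>, the equation \<open>y = set_of A\<close> is first order in either case, and
  so is smallness. Comprehension terms can thus be nested freely.\<close>

lemma def_term_set_of [def_rules]:
  assumes "definable (\<lambda>e. Q (e 0) (\<lambda>n. e (Suc n)))"
  shows "def_term (\<lambda>e. set_of {x. Q x e})"
proof -
  have 1: "definable (\<lambda>e. Q (e 0) (\<lambda>n. e (Suc (Suc n))))"
    using definable_rename[OF assms, of "\<lambda>n. case n of 0 \<Rightarrow> 0 | Suc k \<Rightarrow> Suc (Suc k)"] by simp
  have 2: "definable (\<lambda>e. Q (e 0) (\<lambda>n. e (Suc (Suc (Suc n)))))"
    using definable_rename[OF assms, of "\<lambda>n. case n of 0 \<Rightarrow> 0 | Suc k \<Rightarrow> Suc (Suc (Suc k))"] by simp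
  have 3: "definable (\<lambda>e. small {x. Q x (\<lambda>n. e (Suc n))})"
    unfolding small_def mem_Collect_eq by (intro def_rules 2)
  show ?thesis
    unfolding def_term_def eq_set_of_iff if_bool_eq_conj mem_Collect_eq by (intro def_rules 1 3)
qed

lemma small_el [simp]: "small {x. x eps y}"
  by (auto simp: small_def)

lemma set_of_el [simp]: "set_of {x. x eps y} = y"
  by (rule sym) (simp only: eq_set_of_iff small_el if_True mem_Collect_eq simp_thms)

section \<open>Sets and ordinals\<close>

abbreviation class_graph :: "('s \<Rightarrow> 's) \<Rightarrow> bool" where
  "class_graph F \<equiv> def_term (\<lambda>e. F (e 0))"

lemma small_upair [simp]: "small {z. z = x \<or> z = y}"
  using pairing[of x y] by (auto simp: is_upair_def small_def)

lemma small_singleton [simp]: "small {x}"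
  using small_upair[of x x] by simp

lemma small_empty [simp]: "small {}"
  using ex_empty by (auto simp: small_def)

lemma small_Union [simp]: "small {z. \<exists>y. y eps x \<and> z eps y}"
  using union[of x] by (auto simp: small_def)

lemma small_power [simp]: "small {z. \<forall>w. w eps z \<longrightarrow> w eps x}"
  using power_set[of x] by (auto simp: small_def)

lemma small_disj [simp]:
  assumes "small {z. P z}" "small {z. Q z}"
  shows "small {z. P z \<or> Q z}"
proof -
  obtain a b where "\<forall>z. z eps a \<longleftrightarrow> P z" "\<forall>z. z eps b \<longleftrightarrow> Q z"
    using assms by (auto simp: small_def)
  moreover obtain c where "\<forall>z. z eps c \<longleftrightarrow> z = a \<or> z = b"
    using small_upair[of a b] by (auto simp: small_def)
  moreover obtain d where "\<forall>z. z eps d \<longleftrightarrow> (\<exists>y. y eps c \<and> z eps y)"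
    using small_Union[of c] by (auto simp: small_def)
  ultimately have "\<forall>z. z eps d \<longleftrightarrow> z \<in> {z. P z \<or> Q z}" by auto
  then show ?thesis unfolding small_def by blast
qed

definition upair :: "'s \<Rightarrow> 's \<Rightarrow> 's" where
  "upair x y = set_of {z. z = x \<or> z = y}"

definition opair :: "'s \<Rightarrow> 's \<Rightarrow> 's" where
  "opair x y = upair (upair x x) (upair x y)"

lemma mem_upair [simp]: "z eps upair x y \<longleftrightarrow> z = x \<or> z = y"
  by (simp add: upair_def)

lemma is_upair_iff: "is_upair E p x y \<longleftrightarrow> p = upair x y"
proof
  show "is_upair E p x y \<Longrightarrow> p = upair x y"
    by (rule set_eq) (simp add: is_upair_def)
qed (simp add: is_upair_def)

lemma is_opair_iff: "is_opair E p x y \<longleftrightarrow> p = opair x y"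
  by (auto simp: is_opair_def is_upair_iff opair_def)

lemma upair_inject: "upair x y = upair x' y' \<longleftrightarrow> x = x' \<and> y = y' \<or> x = y' \<and> y = x'"
proof
  assume *: "upair x y = upair x' y'"
  have "z = x \<or> z = y \<longleftrightarrow> z = x' \<or> z = y'" for z
    using mem_upair[of z x y] mem_upair[of z x' y'] * by simp
  then show "x = x' \<and> y = y' \<or> x = y' \<and> y = x'" by metis
qed (auto intro: set_eq)

lemma opair_inject [simp]: "opair x y = opair x' y' \<longleftrightarrow> x = x' \<and> y = y'"
  by (auto simp: opair_def upair_inject)

lemma maps_to_iff: "maps_to E F x y \<longleftrightarrow> opair x y \<in> F"
  by (auto simp: maps_to_def is_opair_iff)

lemma def_term_upair [def_rules]: "def_term t \<Longrightarrow> def_term s \<Longrightarrow> def_term (\<lambda>e. upair (t e) (s e))"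
  by (rule def_term_app2) (unfold upair_def, intro def_rules)

lemma def_term_opair [def_rules]: "def_term t \<Longrightarrow> def_term s \<Longrightarrow> def_term (\<lambda>e. opair (t e) (s e))"
  unfolding opair_def by (intro def_rules)

lemma small_replacement:
  assumes "definable (\<lambda>e. R (e 0) (e 1))" and "\<And>x y z. R x y \<Longrightarrow> R x z \<Longrightarrow> y = z"
  shows "small {y. \<exists>x. x eps a \<and> R x y}"
proof -
  let ?F = "{p. \<exists>x y. p = opair x y \<and> R x y}"
  have "definable (\<lambda>e. R (e 1) (e 0))"
    using def_app2[OF assms(1) def_term_var def_term_var, of 1 0] .
  then have "?F \<in> \<C>" by (intro definable_class def_rules) simp
  moreover have "functional E ?F"
    using assms(2) by (auto simp: functional_def maps_to_iff)
  ultimately obtain b where "\<forall>y. y eps b \<longleftrightarrow> (\<exists>x. x eps a \<and> maps_to E ?F x y)"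
    using replacement by meson
  then show ?thesis by (auto simp: small_def maps_to_iff)
qed

lemma small_separation:
  assumes "definable (\<lambda>e. Q (e 0))"
  shows "small {x. x eps a \<and> Q x}"
proof -
  have "definable (\<lambda>e. e 0 = e 1 \<and> Q (e 0))"
    by (intro def_rules assms)
  from small_replacement[of "\<lambda>x y. x = y \<and> Q x", OF this, of a] show ?thesis
    by (rule back_subst[of small]) auto
qed

lemma small_subset:
  assumes "definable (\<lambda>e. Q (e 0))" "\<And>x. Q x \<Longrightarrow> x eps a"
  shows "small {x. Q x}"
proof -
  have "{x. x eps a \<and> Q x} = {x. Q x}" using assms(2) by auto
  with small_separation[OF assms(1), of a] show ?thesis by simp
qed

lemma small_image:
  assumes "class_graph F"
  shows "small {y. \<exists>x. x eps a \<and> y = F x}"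
proof -
  have "definable (\<lambda>e. e 1 = F (e 0))" by (intro def_rules def_term_app1[OF assms])
  from small_replacement[of "\<lambda>x y. y = F x", OF this, of a] show ?thesis by simp
qed

lemma small_UN:
  assumes "class_graph F"
  shows "small {z. \<exists>x. x eps a \<and> z eps F x}"
proof -
  obtain b where "\<forall>y. y eps b \<longleftrightarrow> (\<exists>x. x eps a \<and> y = F x)"
    using small_image[OF assms, of a] by (auto simp: small_def)
  then have "{z. \<exists>y. y eps b \<and> z eps y} = {z. \<exists>x. x eps a \<and> z eps F x}" by auto
  with small_Union[of b] show ?thesis by simp
qed

definition empty :: 's where
  "empty = set_of {z. False}"

definition suc :: "'s \<Rightarrow> 's" where
  "suc x = set_of {z. z eps x \<or> z = x}"

definition union_of :: "'s \<Rightarrow> 's" where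
  "union_of x = set_of {z. \<exists>y. y eps x \<and> z eps y}"

definition sub :: "'s \<Rightarrow> 's \<Rightarrow> bool" (infix "\<sqsubseteq>" 50) where
  "x \<sqsubseteq> y \<longleftrightarrow> (\<forall>z. z eps x \<longrightarrow> z eps y)"

lemma mem_empty [simp]: "\<not> x eps empty"
  by (simp add: empty_def)

lemma mem_suc [simp]: "z eps suc x \<longleftrightarrow> z eps x \<or> z = x"
  using small_disj[of "\<lambda>z. z eps x" "\<lambda>z. z = x"] by (simp add: suc_def)

lemma mem_union_of [simp]: "z eps union_of x \<longleftrightarrow> (\<exists>y. y eps x \<and> z eps y)"
  by (simp add: union_of_def)

lemma def_term_suc [def_rules]: "def_term t \<Longrightarrow> def_term (\<lambda>e. suc (t e))"
  by (rule def_term_app1) (unfold suc_def, intro def_rules)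

lemma def_term_union_of [def_rules]: "def_term t \<Longrightarrow> def_term (\<lambda>e. union_of (t e))"
  by (rule def_term_app1) (unfold union_of_def, intro def_rules)

lemma definable_sub [def_rules]: "def_term t \<Longrightarrow> def_term s \<Longrightarrow> definable (\<lambda>e. t e \<sqsubseteq> s e)"
  by (rule def_app2) (unfold sub_def, intro def_rules)

lemma subD: "x \<sqsubseteq> y \<Longrightarrow> z eps x \<Longrightarrow> z eps y"
  by (auto simp: sub_def)

lemma sub_refl [simp]: "x \<sqsubseteq> x"
  by (auto simp: sub_def)

lemma sub_antisym: "x \<sqsubseteq> y \<Longrightarrow> y \<sqsubseteq> x \<Longrightarrow> x = y"
  by (rule set_eq) (auto simp: sub_def)

lemma eps_minimal:
  assumes "definable (\<lambda>e. Q (e 0))" "Q a"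
  obtains x where "Q x" "\<And>y. y eps x \<Longrightarrow> \<not> Q y"
  using foundation[OF definable_class[OF assms(1)]] assms(2) by auto

lemma eps_induct:
  assumes "definable (\<lambda>e. Q (e 0))" "\<And>x. (\<And>y. y eps x \<Longrightarrow> Q y) \<Longrightarrow> Q x"
  shows "Q x"
proof (rule ccontr)
  assume "\<not> Q x"
  with eps_minimal[OF definable_not[OF assms(1)], of x] assms(2) show False by metis
qed

lemma eps_irrefl [simp]: "\<not> x eps x"
proof -
  have "definable (\<lambda>e. e 0 = x)" by (intro def_rules)
  from eps_minimal[of "\<lambda>z. z = x", OF this refl] show ?thesis by blast
qed

lemma eps_asym: "x eps y \<Longrightarrow> \<not> y eps x"
proof -
  have "definable (\<lambda>e. e 0 = x \<or> e 0 = y)" by (intro def_rules)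
  from eps_minimal[of "\<lambda>z. z = x \<or> z = y", OF this, of x] show "x eps y \<Longrightarrow> \<not> y eps x" by metis
qed

text \<open>Transitive with transitive elements; by foundation, membership then well-orders the set.
  The quantifiers are all bounded, so that \<open>J\<close> will preserve the notion.\<close>

definition Ord :: "'s \<Rightarrow> bool" where
  "Ord x \<longleftrightarrow> (\<forall>y. y eps x \<longrightarrow> (\<forall>z. z eps y \<longrightarrow> z eps x)) \<and>
     (\<forall>y. y eps x \<longrightarrow> (\<forall>z. z eps y \<longrightarrow> (\<forall>w. w eps z \<longrightarrow> w eps y)))"

lemma definable_Ord [def_rules]: "def_term t \<Longrightarrow> definable (\<lambda>e. Ord (t e))"
  by (rule def_app1) (unfold Ord_def, intro def_rules)

lemma Ord_trans: "Ord x \<Longrightarrow> z eps y \<Longrightarrow> y eps x \<Longrightarrow> z eps x"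
  unfolding Ord_def by blast

lemma Ord_mem:
  assumes "Ord x" "y eps x"
  shows "Ord y"
proof -
  from assms have 1: "u eps x" if "u eps y" for u using that unfolding Ord_def by blast
  from assms(1) have 2: "w eps u" if "u eps x" "v eps u" "w eps v" for u v w
    using that unfolding Ord_def by blast
  show ?thesis unfolding Ord_def using 2[OF assms(2)] 2[OF 1] by blast
qed

lemma Ord_empty [simp]: "Ord empty"
  by (simp add: Ord_def)

lemma Ord_suc [simp]: "Ord x \<Longrightarrow> Ord (suc x)"
  unfolding Ord_def mem_suc by blast

lemma Ord_if_transitive:
  assumes "\<And>y z. y eps x \<Longrightarrow> z eps y \<Longrightarrow> z eps x" "\<And>y. y eps x \<Longrightarrow> Ord y"
  shows "Ord x"
  using assms unfolding Ord_def by blast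

lemma Ord_union_of:
  assumes "\<And>y. y eps x \<Longrightarrow> Ord y"
  shows "Ord (union_of x)"
proof (rule Ord_if_transitive)
  show "z eps union_of x" if "y eps union_of x" "z eps y" for y z
  proof -
    from that(1) obtain u where u: "u eps x" "y eps u" by auto
    with Ord_trans[OF assms that(2)] show ?thesis by auto
  qed
  show "Ord y" if "y eps union_of x" for y
    using that assms Ord_mem by auto
qed

text \<open>Double membership induction: if \<open>a\<close> and \<open>b\<close> were incomparable,
  they would have the same elements.\<close>

lemma Ord_linear:
  assumes "Ord a" "Ord b"
  shows "a eps b \<or> a = b \<or> b eps a"
proof -
  have "Ord a \<longrightarrow> (\<forall>b. Ord b \<longrightarrow> a eps b \<or> a = b \<or> b eps a)"
  proof (rule eps_induct[of "\<lambda>a. Ord a \<longrightarrow> (\<forall>b. Ord b \<longrightarrow> a eps b \<or> a = b \<or> b eps a)"], intro def_rules, rule impI)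
    fix a assume IH: "\<And>y. y eps a \<Longrightarrow> Ord y \<longrightarrow> (\<forall>b. Ord b \<longrightarrow> y eps b \<or> y = b \<or> b eps y)" and a: "Ord a"
    have "Ord b \<longrightarrow> a eps b \<or> a = b \<or> b eps a" for b
    proof (rule eps_induct[of "\<lambda>b. Ord b \<longrightarrow> a eps b \<or> a = b \<or> b eps a"], intro def_rules, rule impI)
      fix b assume IH2: "\<And>y. y eps b \<Longrightarrow> Ord y \<longrightarrow> a eps y \<or> a = y \<or> y eps a" and b: "Ord b"
      show "a eps b \<or> a = b \<or> b eps a"
      proof (rule ccontr)
        assume *: "\<not> (a eps b \<or> a = b \<or> b eps a)"
        have "x eps b" if "x eps a" for x
          using IH[OF that] Ord_mem[OF a that] b Ord_trans[OF a _ that] * that by auto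
        moreover have "x eps a" if "x eps b" for x
          using IH2[OF that] Ord_mem[OF b that] Ord_trans[OF b _ that] * that by auto
        ultimately have "a = b" by (intro set_eq) auto
        with * show False by simp
      qed
    qed
    then show "\<forall>b. Ord b \<longrightarrow> a eps b \<or> a = b \<or> b eps a" by blast
  qed
  with assms show ?thesis by blast
qed

lemma Ord_sub_iff: "Ord a \<Longrightarrow> Ord b \<Longrightarrow> a \<sqsubseteq> b \<longleftrightarrow> a eps b \<or> a = b"
  using Ord_linear[of a b] by (auto simp: sub_def dest: Ord_trans eps_asym)

lemma Ord_not_mem_iff: "Ord a \<Longrightarrow> Ord b \<Longrightarrow> \<not> a eps b \<longleftrightarrow> b \<sqsubseteq> a"
  using Ord_linear[of a b] Ord_sub_iff[of b a] by (auto dest: eps_asym)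

lemma Ord_least:
  assumes "definable (\<lambda>e. Q (e 0))" "Ord a" "Q a"
  shows "\<exists>b. Ord b \<and> Q b \<and> (\<forall>c. c eps b \<longrightarrow> \<not> Q c) \<and> (\<forall>c. Ord c \<longrightarrow> Q c \<longrightarrow> b \<sqsubseteq> c)"
proof -
  have "definable (\<lambda>e. Ord (e 0) \<and> Q (e 0))" by (intro def_rules assms)
  from this assms(2,3) obtain b where b: "Ord b \<and> Q b" "\<And>c. c eps b \<Longrightarrow> \<not> (Ord c \<and> Q c)"
    by (rule_tac eps_minimal[of "\<lambda>x. Ord x \<and> Q x" a]) blast+
  have "\<not> Q c" if "c eps b" for c using b Ord_mem that by blast
  moreover have "b \<sqsubseteq> c" if "Ord c" "Q c" for c using b Ord_not_mem_iff[of c b] that by blast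
  ultimately show ?thesis using b(1) by blast
qed

text \<open>The intersection of all ordinals with \<open>Q\<close>, hence a definable term. With no
  such ordinal every set is collected, and \<open>set_of\<close> returns the empty set.\<close>

definition least :: "('s \<Rightarrow> bool) \<Rightarrow> 's" where
  "least Q = set_of {x. \<forall>c. Ord c \<longrightarrow> Q c \<longrightarrow> x eps c}"

lemma def_term_least [def_rules]:
  assumes "definable (\<lambda>e. Q (e 0) (\<lambda>n. e (Suc n)))"
  shows "def_term (\<lambda>e. least (\<lambda>x. Q x e))"
proof -
  have "definable (\<lambda>e. Q (e 0) (\<lambda>n. e (Suc (Suc n))))"
    using definable_rename[OF assms, of "\<lambda>n. case n of 0 \<Rightarrow> 0 | Suc k \<Rightarrow> Suc (Suc k)"] by simp
  then show ?thesis unfolding least_def by (intro def_rules)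
qed

lemma least:
  assumes "definable (\<lambda>e. Q (e 0))" "Ord a" "Q a"
  shows "Ord (least Q)" "Q (least Q)" "least Q \<sqsubseteq> a"
proof -
  obtain b where b: "Ord b" "Q b" "\<forall>c. Ord c \<longrightarrow> Q c \<longrightarrow> b \<sqsubseteq> c"
    using Ord_least[OF assms] by blast
  then have "{x. \<forall>c. Ord c \<longrightarrow> Q c \<longrightarrow> x eps c} = {x. x eps b}"
    unfolding sub_def by blast
  then have "least Q = b" unfolding least_def by (simp only: set_of_el)
  with b assms show "Ord (least Q)" "Q (least Q)" "least Q \<sqsubseteq> a" by auto
qed

lemma Ord_not_small: "\<not> small {x. Ord x}"
proof
  assume "small {x. Ord x}"
  then obtain o' where o': "\<forall>x. x eps o' \<longleftrightarrow> Ord x" by (auto simp: small_def)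
  have "Ord o'" by (rule Ord_if_transitive) (use o' Ord_mem in blast)+
  with o' have "o' eps o'" by blast
  then show False by simp
qed

text \<open>Spelled out with bounded quantifiers instead of \<open>empty\<close> and
  \<open>suc\<close>, because it has to be transferred by \<open>J\<close>.\<close>

definition zero_or_suc :: "'s \<Rightarrow> bool" where
  "zero_or_suc m \<longleftrightarrow> (\<forall>z. \<not> z eps m) \<or> (\<exists>k. k eps m \<and> (\<forall>z. z eps m \<longrightarrow> z eps k \<or> z = k) \<and> (\<forall>z. z eps k \<longrightarrow> z eps m))"

definition Nat :: "'s \<Rightarrow> bool" where
  "Nat n \<longleftrightarrow> Ord n \<and> zero_or_suc n \<and> (\<forall>m. m eps n \<longrightarrow> zero_or_suc m)"

definition omega :: 's where
  "omega = set_of {n. Nat n}"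

lemma zero_or_suc_iff: "zero_or_suc m \<longleftrightarrow> m = empty \<or> (\<exists>k. m = suc k)"
proof -
  have "(\<forall>z. \<not> z eps m) \<longleftrightarrow> m = empty" by (auto intro: set_eq)
  moreover have "(k eps m \<and> (\<forall>z. z eps m \<longrightarrow> z eps k \<or> z = k) \<and> (\<forall>z. z eps k \<longrightarrow> z eps m)) \<longleftrightarrow> m = suc k" for k
    by (auto intro!: set_eq)
  ultimately show ?thesis unfolding zero_or_suc_def by simp
qed

lemma definable_Nat [def_rules]: "def_term t \<Longrightarrow> definable (\<lambda>e. Nat (t e))"
  by (rule def_app1) (unfold Nat_def zero_or_suc_def, intro def_rules)

lemma suc_inject: "suc x = suc y \<Longrightarrow> x = y"
proof (rule ccontr)
  assume *: "suc x = suc y" "x \<noteq> y"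
  have "x eps suc y" "y eps suc x" using mem_suc[of x x] mem_suc[of y y] *(1) by simp_all
  with *(2) show False using eps_asym by simp
qed

lemma Nat_empty [simp]: "Nat empty"
  unfolding Nat_def zero_or_suc_iff using Ord_empty mem_empty by blast

lemma Nat_suc [simp]: "Nat n \<Longrightarrow> Nat (suc n)"
  unfolding Nat_def zero_or_suc_iff mem_suc using Ord_suc by blast

lemma Nat_Ord: "Nat n \<Longrightarrow> Ord n"
  by (simp add: Nat_def)

lemma Nat_mem: "Nat n \<Longrightarrow> m eps n \<Longrightarrow> Nat m"
  unfolding Nat_def using Ord_mem Ord_trans by blast

lemma Nat_cases: "Nat n \<Longrightarrow> n = empty \<or> (\<exists>k. Nat k \<and> n = suc k)"
  using Nat_mem[of n] mem_suc unfolding Nat_def[of n] zero_or_suc_iff by metis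

lemma Nat_induct:
  assumes "definable (\<lambda>e. Q (e 0))" "Nat n" "Q empty" "\<And>n. Nat n \<Longrightarrow> Q n \<Longrightarrow> Q (suc n)"
  shows "Q n"
proof -
  have "Nat n \<longrightarrow> Q n"
  proof (rule eps_induct[of "\<lambda>n. Nat n \<longrightarrow> Q n"], intro def_rules assms, rule impI)
    fix n assume IH: "\<And>y. y eps n \<Longrightarrow> Nat y \<longrightarrow> Q y" and n: "Nat n"
    from Nat_cases[OF n] IH assms(3,4) show "Q n" by auto
  qed
  with assms(2) show ?thesis by simp
qed

lemma small_Nat: "small {n. Nat n}"
proof -
  obtain w where w: "\<exists>z. (\<forall>y. \<not> y eps z) \<and> z eps w"
    "\<forall>x. x eps w \<longrightarrow> (\<exists>s. (\<forall>y. y eps s \<longleftrightarrow> y eps x \<or> y = x) \<and> s eps w)"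
    using infinity by blast
  have 0: "empty eps w"
  proof -
    from w(1) obtain z where z: "\<forall>y. \<not> y eps z" "z eps w" by blast
    then have "z = empty" by (intro set_eq) simp
    with z show ?thesis by simp
  qed
  have 1: "suc n eps w" if n: "n eps w" for n
  proof -
    from w(2) n obtain s where s: "\<forall>y. y eps s \<longleftrightarrow> y eps n \<or> y = n" "s eps w" by blast
    then have "s = suc n" by (intro set_eq) simp
    with s show ?thesis by simp
  qed
  have "n eps w" if n: "Nat n" for n
    by (rule Nat_induct[of "\<lambda>n. n eps w", OF _ n 0 1]) (intro def_rules)
  then show ?thesis by (intro small_subset[of Nat w] def_rules)
qed

lemma mem_omega [simp]: "n eps omega \<longleftrightarrow> Nat n"
  using small_Nat by (simp add: omega_def)

lemma Ord_omega [simp]: "Ord omega"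
  by (rule Ord_if_transitive) (use Nat_mem Nat_Ord in \<open>simp; blast\<close>)+

section \<open>Transfinite recursion, collection and choice\<close>

text \<open>The union of the values of \<open>f\<close> at \<open>x\<close>, which is the value
  itself when there is exactly one.\<close>

definition val :: "'s \<Rightarrow> 's \<Rightarrow> 's" where
  "val f x = set_of {z. \<exists>y. opair x y eps f \<and> z eps y}"

lemma def_term_val [def_rules]: "def_term t \<Longrightarrow> def_term s \<Longrightarrow> def_term (\<lambda>e. val (t e) (s e))"
  by (rule def_term_app2) (unfold val_def, intro def_rules)

lemma val_eq: "(\<And>y. opair x y eps f \<longleftrightarrow> y = v) \<Longrightarrow> val f x = v"
  by (simp add: val_def)

definition graph :: "'s \<Rightarrow> ('s \<Rightarrow> 's) \<Rightarrow> 's" where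
  "graph a F = set_of {p. \<exists>x. x eps a \<and> p = opair x (F x)}"

lemma mem_graph:
  assumes "class_graph F"
  shows "p eps graph a F \<longleftrightarrow> (\<exists>x. x eps a \<and> p = opair x (F x))"
proof -
  have "class_graph (\<lambda>x. opair x (F x))" by (intro def_rules assms)
  from small_image[OF this, of a] show ?thesis by (simp add: graph_def)
qed

lemma Ord_sup:
  assumes "class_graph F" "\<And>t. t eps b \<Longrightarrow> Ord (F t)"
  obtains c where "Ord c" "\<And>t. t eps b \<Longrightarrow> F t eps c"
proof -
  let ?S = "set_of {y. \<exists>t. t eps b \<and> y = suc (F t)}"
  have F: "class_graph (\<lambda>x. suc (F x))" by (intro def_rules assms)
  from small_image[OF this, of b] have S: "y eps ?S \<longleftrightarrow> (\<exists>t. t eps b \<and> y = suc (F t))" for y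
    by simp
  have "Ord (union_of ?S)" using assms(2) by (intro Ord_union_of) (auto simp: S)
  moreover have "F t eps union_of ?S" if "t eps b" for t
    unfolding mem_union_of S using that mem_suc[of "F t" "F t"] by blast
  ultimately show ?thesis by (rule that)
qed

text \<open>An approximation to the recursion below \<open>a\<close>. It constrains only the values
  \<open>val f b\<close>, so \<open>f\<close> itself need not be a function.\<close>

definition attempt :: "('s \<Rightarrow> 's) \<Rightarrow> 's \<Rightarrow> 's \<Rightarrow> 's \<Rightarrow> bool" where
  "attempt H A f a \<longleftrightarrow>
     (\<forall>b. b eps a \<longrightarrow> val f b = set_of {z. z eps A \<or> (\<exists>c. c eps b \<and> z eps H (val f c))})"

lemma attemptD:
  "attempt H A f a \<Longrightarrow> b eps a \<Longrightarrow>
    val f b = set_of {z. z eps A \<or> (\<exists>c. c eps b \<and> z eps H (val f c))}"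
  by (simp add: attempt_def)

text \<open>\<open>trec H A a = A \<union> (\<Union>b \<in> a. H (trec H A b))\<close>.\<close>

definition trec :: "('s \<Rightarrow> 's) \<Rightarrow> 's \<Rightarrow> 's \<Rightarrow> 's" where
  "trec H A a = set_of {z. \<exists>f. attempt H A f (suc a) \<and> z eps val f a}"

lemma def_attempt:
  assumes "class_graph H" "def_term t" "def_term s" "def_term r"
  shows "definable (\<lambda>e. attempt H (t e) (s e) (r e))"
  by (rule def_app3[OF _ assms(2-4)]) (unfold attempt_def, intro def_rules def_term_app1[OF assms(1)])

lemma def_term_trec:
  assumes "class_graph H" "def_term t" "def_term s"
  shows "def_term (\<lambda>e. trec H (t e) (s e))"
  by (rule def_term_app2[OF _ assms(2,3)]) (unfold trec_def, intro def_rules def_attempt assms(1))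

lemma attempt_unique:
  assumes H: "class_graph H" and fg: "attempt H A f a" "attempt H A g b"
    and tr: "Ord a" "Ord b" and x: "x eps a" "x eps b"
  shows "val f x = val g x"
proof -
  have "x eps a \<longrightarrow> x eps b \<longrightarrow> val f x = val g x"
  proof (rule eps_induct[of "\<lambda>x. x eps a \<longrightarrow> x eps b \<longrightarrow> val f x = val g x"], intro def_rules, intro impI)
    fix x assume IH: "\<And>y. y eps x \<Longrightarrow> y eps a \<longrightarrow> y eps b \<longrightarrow> val f y = val g y"
      and x: "x eps a" "x eps b"
    have "val f c = val g c" if "c eps x" for c
      using IH[OF that] Ord_trans[OF tr(1) that x(1)] Ord_trans[OF tr(2) that x(2)] by blast
    then have "{z. z eps A \<or> (\<exists>c. c eps x \<and> z eps H (val f c))} =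
      {z. z eps A \<or> (\<exists>c. c eps x \<and> z eps H (val g c))}" by auto
    with attemptD[OF fg(1) x(1)] attemptD[OF fg(2) x(2)] show "val f x = val g x" by simp
  qed
  with x show ?thesis by blast
qed

lemma trec_eq_attempt:
  assumes "class_graph H" "Ord a" "attempt H A f (suc a)"
  shows "trec H A a = val f a"
proof -
  have "val g a = val f a" if "attempt H A g (suc a)" for g
    using attempt_unique[OF assms(1) that assms(3)] assms(2) by simp
  with assms(3) have "(\<exists>g. attempt H A g (suc a) \<and> z eps val g a) \<longleftrightarrow> z eps val f a" for z
    by metis
  then show ?thesis unfolding trec_def by simp
qed

lemma attempt_mono: "attempt H A f a \<Longrightarrow> b \<sqsubseteq> a \<Longrightarrow> attempt H A f b"
  unfolding attempt_def sub_def by blast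

text \<open>Attempts agree where they overlap, so \<open>trec\<close> already obeys the recursion
  below \<open>a\<close>. Its graph on \<open>a\<close>, with one more pair for the value at
  \<open>a\<close>, is an attempt on \<open>suc a\<close>.\<close>

lemma ex_attempt_step:
  assumes H: "class_graph H" and a: "Ord a"
    and ex: "\<And>b. b eps a \<Longrightarrow> \<exists>f. attempt H A f (suc b)"
  shows "\<exists>f. attempt H A f (suc a) \<and>
    val f a = set_of {z. z eps A \<or> (\<exists>c. c eps a \<and> z eps H (trec H A c))}"
proof -
  have cr: "class_graph (\<lambda>x. trec H A x)" by (intro def_rules def_term_trec H)
  let ?S = "\<lambda>b. set_of {z. z eps A \<or> (\<exists>c. c eps b \<and> z eps H (trec H A c))}"
  define V where "V = ?S a"
  let ?f = "set_of {p. p eps graph a (trec H A) \<or> p = opair a V}"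
  have "small {p. p eps graph a (trec H A) \<or> p = opair a V}"
    using small_disj[of "\<lambda>p. p eps graph a (trec H A)" "\<lambda>p. p = opair a V"] by simp
  then have f: "p eps ?f \<longleftrightarrow> (\<exists>x. x eps a \<and> p = opair x (trec H A x)) \<or> p = opair a V" for p
    using mem_graph[OF cr] by simp
  have fb: "val ?f b = trec H A b" if "b eps a" for b
    using that by (intro val_eq) (auto simp: f)
  have fa: "val ?f a = V"
    by (intro val_eq) (auto simp: f)
  have "trec H A b = ?S b" if b: "b eps a" for b
  proof -
    obtain g where g: "attempt H A g (suc b)" using ex[OF b] by blast
    have Ob: "Ord b" using Ord_mem a b by blast
    have "trec H A c = val g c" if c: "c eps b" for c
    proof (rule trec_eq_attempt[OF H])
      show "Ord c" using Ord_mem Ob c by blast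
      show "attempt H A g (suc c)"
        by (rule attempt_mono[OF g]) (use Ord_trans[OF Ob _ c] c in \<open>auto simp: sub_def\<close>)
    qed
    then have "{z. z eps A \<or> (\<exists>c. c eps b \<and> z eps H (val g c))} =
      {z. z eps A \<or> (\<exists>c. c eps b \<and> z eps H (trec H A c))}" by auto
    moreover have "trec H A b = val g b" by (rule trec_eq_attempt[OF H Ob g])
    ultimately show ?thesis using attemptD[OF g, of b] by simp
  qed
  then have "val ?f b = ?S b" if "b eps suc a" for b
    using that fa fb by (auto simp: V_def)
  moreover have "{z. z eps A \<or> (\<exists>c. c eps b \<and> z eps H (trec H A c))} =
      {z. z eps A \<or> (\<exists>c. c eps b \<and> z eps H (val ?f c))}" if "b eps suc a" for b
    using that fb Ord_trans[OF a] by auto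
  ultimately have "attempt H A ?f (suc a)" unfolding attempt_def by simp
  with fa show ?thesis unfolding V_def by blast
qed

lemma ex_attempt:
  assumes "class_graph H" "Ord a"
  shows "\<exists>f. attempt H A f (suc a)"
proof -
  have "Ord a \<longrightarrow> (\<exists>f. attempt H A f (suc a))"
  proof (rule eps_induct[of "\<lambda>a. Ord a \<longrightarrow> (\<exists>f. attempt H A f (suc a))"], intro def_rules def_attempt assms(1), rule impI)
    fix x assume IH: "\<And>y. y eps x \<Longrightarrow> Ord y \<longrightarrow> (\<exists>f. attempt H A f (suc y))" and x: "Ord x"
    have "\<exists>f. attempt H A f (suc b)" if "b eps x" for b
      using IH[OF that] Ord_mem[OF x that] by blast
    from ex_attempt_step[OF assms(1) x this] show "\<exists>f. attempt H A f (suc x)" by blast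
  qed
  with assms(2) show ?thesis by blast
qed

lemma mem_trec:
  assumes H: "class_graph H" and a: "Ord a"
  shows "z eps trec H A a \<longleftrightarrow> z eps A \<or> (\<exists>c. c eps a \<and> z eps H (trec H A c))"
proof -
  have "\<exists>f. attempt H A f (suc b)" if "b eps a" for b
    using ex_attempt[OF H Ord_mem[OF a that]] .
  from ex_attempt_step[OF H a this] obtain f where f: "attempt H A f (suc a)"
    "val f a = set_of {z. z eps A \<or> (\<exists>c. c eps a \<and> z eps H (trec H A c))}" by blast
  have "class_graph (\<lambda>c. H (trec H A c))" by (intro def_rules def_term_trec def_term_app1[OF H] H)
  from small_UN[OF this, of a]
  have "small {z. z eps A \<or> (\<exists>c. c eps a \<and> z eps H (trec H A c))}"
    by (intro small_disj) simp
  with f trec_eq_attempt[OF H a f(1)] show ?thesis by simp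
qed

lemma trec_mono:
  assumes "class_graph H" "Ord a" "c \<sqsubseteq> a" "Ord c"
  shows "trec H A c \<sqsubseteq> trec H A a"
  using assms mem_trec[OF assms(1)] by (auto simp: sub_def)

lemma trec_suc:
  assumes "class_graph H" "Ord a"
  shows "z eps trec H A (suc a) \<longleftrightarrow> z eps trec H A a \<or> z eps H (trec H A a)"
  using assms mem_trec[OF assms(1)] by auto

lemma trec_empty: "class_graph H \<Longrightarrow> trec H A empty = A"
  by (rule set_eq) (simp add: mem_trec)

section \<open>The cumulative hierarchy and collection\<close>

definition power :: "'s \<Rightarrow> 's" where
  "power x = set_of {z. z \<sqsubseteq> x}"

lemma mem_power [simp]: "z eps power x \<longleftrightarrow> z \<sqsubseteq> x"
  using small_power[of x] by (simp add: power_def sub_def)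

lemma def_term_power [def_rules]: "def_term t \<Longrightarrow> def_term (\<lambda>e. power (t e))"
  by (rule def_term_app1) (unfold power_def, intro def_rules)

lemma class_graph_power: "class_graph power" by (intro def_rules)

definition V :: "'s \<Rightarrow> 's" where
  "V a = trec power empty a"

lemma def_term_V [def_rules]: "def_term t \<Longrightarrow> def_term (\<lambda>e. V (t e))"
  unfolding V_def by (intro def_rules def_term_trec)

lemma mem_V: "Ord a \<Longrightarrow> x eps V a \<longleftrightarrow> (\<exists>b. b eps a \<and> x \<sqsubseteq> V b)"
  using mem_trec[OF class_graph_power] by (simp add: V_def)

lemma ex_V: "\<exists>a. Ord a \<and> x \<sqsubseteq> V a"
proof (rule eps_induct[of "\<lambda>x. \<exists>a. Ord a \<and> x \<sqsubseteq> V a"], intro def_rules)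
  fix x assume IH: "\<And>y. y eps x \<Longrightarrow> \<exists>a. Ord a \<and> y \<sqsubseteq> V a"
  let ?F = "\<lambda>y. least (\<lambda>a. y \<sqsubseteq> V a)"
  have d: "definable (\<lambda>e. y \<sqsubseteq> V (e 0))" for y by (intro def_rules)
  have F: "Ord (?F y)" "y \<sqsubseteq> V (?F y)" if y: "y eps x" for y
  proof -
    from IH[OF y] obtain a where "Ord a" "y \<sqsubseteq> V a" by blast
    from least[OF d this] show "Ord (?F y)" "y \<sqsubseteq> V (?F y)" by blast+
  qed
  have "class_graph ?F" by (intro def_rules)
  from Ord_sup[OF this F(1)] obtain c where c: "Ord c" "\<And>y. y eps x \<Longrightarrow> ?F y eps c" by blast
  have "x \<sqsubseteq> V c" unfolding sub_def using F(2) c mem_V by blast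
  with c(1) show "\<exists>a. Ord a \<and> x \<sqsubseteq> V a" by blast
qed

text \<open>Scott's trick: each \<open>t\<close> is sent to the least stage of the hierarchy that
  includes a witness, and replacement bounds these stages.\<close>

lemma collection:
  assumes "definable (\<lambda>e. R (e 0) (e 1))" "\<And>t. t eps b \<Longrightarrow> \<exists>X. R t X"
  shows "\<exists>Z. \<forall>t. t eps b \<longrightarrow> (\<exists>X. X eps Z \<and> R t X)"
proof -
  let ?F = "\<lambda>t. least (\<lambda>a. \<exists>X. X \<sqsubseteq> V a \<and> R t X)"
  have d: "definable (\<lambda>e. \<exists>X. X \<sqsubseteq> V (e 0) \<and> R t X)" for t by (intro def_rules def_app2[OF assms(1)])
  have F: "Ord (?F t)" "\<exists>X. X \<sqsubseteq> V (?F t) \<and> R t X" if t: "t eps b" for t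
  proof -
    from assms(2)[OF t] ex_V obtain a X where "Ord a" "X \<sqsubseteq> V a" "R t X" by blast
    then have "Ord a" "\<exists>X. X \<sqsubseteq> V a \<and> R t X" by auto
    from least[OF d this] show "Ord (?F t)" "\<exists>X. X \<sqsubseteq> V (?F t) \<and> R t X" by blast+
  qed
  have "class_graph ?F" by (intro def_rules def_app2[OF assms(1)])
  from Ord_sup[OF this F(1)] obtain c where c: "Ord c" "\<And>t. t eps b \<Longrightarrow> ?F t eps c" by blast
  have "\<exists>X. X eps V c \<and> R t X" if t: "t eps b" for t
    using F(2)[OF t] c(2)[OF t] mem_V[OF c(1)] by blast
  then show ?thesis by blast
qed

section \<open>Global choice and well-ordering\<close>

definition choice_class :: "'s set" where
  "choice_class = (SOME F. F \<in> \<C> \<and> functional E F \<and>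
     (\<forall>x. (\<exists>y. y eps x) \<longrightarrow> (\<exists>y. y eps x \<and> maps_to E F x y)))"

definition choice :: "'s \<Rightarrow> 's" where
  "choice x = set_of {z. \<exists>y. y eps x \<and> opair x y \<in> choice_class \<and> z eps y}"

lemma choice_class: "choice_class \<in> \<C>" "functional E choice_class"
  "y eps x \<Longrightarrow> \<exists>y. y eps x \<and> maps_to E choice_class x y"
proof -
  from global_choice have "\<exists>F. F \<in> \<C> \<and> functional E F \<and>
     (\<forall>x. (\<exists>y. y eps x) \<longrightarrow> (\<exists>y. y eps x \<and> maps_to E F x y))" by blast
  from someI_ex[OF this] show "choice_class \<in> \<C>" "functional E choice_class"
    "y eps x \<Longrightarrow> \<exists>y. y eps x \<and> maps_to E choice_class x y" unfolding choice_class_def by blast+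
qed

lemma def_term_choice [def_rules]: "def_term t \<Longrightarrow> def_term (\<lambda>e. choice (t e))"
  by (rule def_term_app1) (unfold choice_def, intro def_rules choice_class)

lemma choice:
  assumes "y eps x"
  shows "choice x eps x"
proof -
  obtain y where y: "y eps x" "opair x y \<in> choice_class"
    using choice_class(3)[OF assms] by (auto simp: maps_to_iff)
  then have "\<And>u. opair x u \<in> choice_class \<longleftrightarrow> u = y"
    using choice_class(2) unfolding functional_def maps_to_iff by blast
  then have "{z. \<exists>y. y eps x \<and> opair x y \<in> choice_class \<and> z eps y} = {z. z eps y}" using y by auto
  then have "choice x = y" unfolding choice_def by simp
  with y show ?thesis by simp
qed

text \<open>The candidates are subsets of \<open>b\<close>, so they form a set to which global
  choice applies. It serves to pick maps and clubs uniformly in definable parameters.\<close>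

lemma choice_in:
  assumes Q: "definable (\<lambda>e. Q (e 0))" and bound: "\<And>h. Q h \<Longrightarrow> h \<sqsubseteq> b" and h: "Q h"
  shows "Q (choice (set_of {h. Q h}))"
proof -
  have s: "small {h. Q h}" by (rule small_subset[OF Q, of "power b"]) (simp add: bound)
  with h have "h eps set_of {h. Q h}" by simp
  from choice[OF this] s show ?thesis by simp
qed

definition bdd_upair :: "'s \<Rightarrow> 's \<Rightarrow> 's \<Rightarrow> bool" where
  "bdd_upair p x y \<longleftrightarrow> (\<forall>z. z eps p \<longrightarrow> z = x \<or> z = y) \<and> x eps p \<and> y eps p"

text \<open>Membership of a Kuratowski pair in \<open>f\<close>, read with quantifiers bounded by
  \<open>f\<close> and by the pair, so that \<open>J\<close> preserves it.\<close>

definition rel :: "'s \<Rightarrow> 's \<Rightarrow> 's \<Rightarrow> bool" where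
  "rel f x y \<longleftrightarrow> (\<exists>p. p eps f \<and> (\<exists>s. s eps p \<and> (\<exists>t. t eps p \<and> bdd_upair s x x \<and> bdd_upair t x y \<and> bdd_upair p s t)))"

lemma bdd_upair_iff: "bdd_upair p x y \<longleftrightarrow> p = upair x y"
proof
  show "bdd_upair p x y \<Longrightarrow> p = upair x y" by (rule set_eq) (auto simp: bdd_upair_def)
qed (simp add: bdd_upair_def)

lemma rel_iff: "rel f x y \<longleftrightarrow> opair x y eps f"
  by (auto simp: rel_def bdd_upair_iff opair_def)

lemma definable_rel [def_rules]: "def_term t \<Longrightarrow> def_term s \<Longrightarrow> def_term r \<Longrightarrow> definable (\<lambda>e. rel (t e) (s e) (r e))"
  unfolding rel_iff by (intro def_rules)

text \<open>Here and in \<open>cofinal\<close>, the pairs of \<open>f\<close> outside \<open>a \<times> b\<close> are ignored.\<close>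

definition onto :: "'s \<Rightarrow> 's \<Rightarrow> 's \<Rightarrow> bool" where
  "onto f a b \<longleftrightarrow> (\<forall>x. x eps a \<longrightarrow> (\<forall>y. y eps b \<longrightarrow> (\<forall>z. z eps b \<longrightarrow> rel f x y \<longrightarrow> rel f x z \<longrightarrow> y = z))) \<and>
     (\<forall>y. y eps b \<longrightarrow> (\<exists>x. x eps a \<and> rel f x y))"

lemma definable_onto [def_rules]: "def_term t \<Longrightarrow> def_term s \<Longrightarrow> def_term r \<Longrightarrow> definable (\<lambda>e. onto (t e) (s e) (r e))"
  by (rule def_app3) (unfold onto_def, intro def_rules)

text \<open>Zermelo's enumeration: \<open>W a\<close> holds what was chosen before stage
  \<open>a\<close>, and \<open>g a\<close> is the next choice. If \<open>b\<close> were never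
  exhausted, \<open>g\<close> would map the ordinals injectively into the set
  \<open>b\<close>.\<close>

lemma ex_ordinal_surj: "\<exists>a f. Ord a \<and> onto f a b"
proof -
  define D where "D X = set_of {z. z eps b \<and> \<not> z eps X}" for X
  define H where "H X = set_of {z. z eps X \<or> z = choice (D X) \<and> (\<exists>u. u eps D X)}" for X
  have mD: "z eps D X \<longleftrightarrow> z eps b \<and> \<not> z eps X" for z X
  proof -
    have "definable (\<lambda>e. \<not> e 0 eps X)" by (intro def_rules)
    from small_separation[of "\<lambda>z. \<not> z eps X", OF this, of b] show ?thesis by (simp add: D_def)
  qed
  have DD: "def_term (\<lambda>e. D (t e))" if "def_term t" for t
    by (rule def_term_app1[OF _ that]) (unfold D_def, intro def_rules)
  have mH: "z eps H X \<longleftrightarrow> z eps X \<or> z = choice (D X) \<and> (\<exists>u. u eps D X)" for z X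
  proof -
    have "definable (\<lambda>e. e 0 = choice (D X) \<and> (\<exists>u. u eps D X))" by (intro def_rules)
    from small_subset[of "\<lambda>z. z = choice (D X) \<and> (\<exists>u. u eps D X)", OF this, of "upair (choice (D X)) (choice (D X))"]
    have "small {z. z = choice (D X) \<and> (\<exists>u. u eps D X)}" by simp
    from small_disj[of "\<lambda>z. z eps X", OF small_el this] show ?thesis by (simp add: H_def)
  qed
  have cH: "class_graph H" unfolding H_def by (intro def_rules DD)
  define W where "W a = trec H empty a" for a
  have DW: "def_term (\<lambda>e. W (t e))" if "def_term t" for t
    unfolding W_def by (intro def_term_trec cH def_rules that)
  have W: "z eps W a \<longleftrightarrow> (\<exists>c. c eps a \<and> z eps H (W c))" if "Ord a" for z a
    using mem_trec[OF cH that] by (simp add: W_def)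
  define g where "g a = choice (D (W a))" for a
  have cg: "class_graph g" unfolding g_def by (intro def_rules DD DW)
  have gne: "g a eps b \<and> \<not> g a eps W a" if "u eps D (W a)" for a u
    using choice[OF that] mD by (simp add: g_def)
  have ginW: "g c eps W a" if "Ord a" "c eps a" "u eps D (W c)" for a c u
    using W[OF that(1)] mH that by (auto simp: g_def)
  have "\<exists>a. Ord a \<and> \<not> (\<exists>u. u eps D (W a))"
  proof (rule ccontr)
    assume "\<not> ?thesis"
    then have ne: "\<exists>u. u eps D (W a)" if "Ord a" for a using that by blast
    have inj: "a = c" if "Ord a" "Ord c" "g a = g c" for a c
      using Ord_linear[OF that(1,2)] ginW[OF that(1)] ginW[OF that(2)] ne[OF that(1)] ne[OF that(2)]
        gne that(3) by metis
    have "definable (\<lambda>e. Ord (e 1) \<and> e 0 = g (e 1))" by (intro def_rules def_term_app1[OF cg])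
    from small_replacement[of "\<lambda>y a. Ord a \<and> y = g a", OF this, of b] inj
    have "small {a. \<exists>y. y eps b \<and> Ord a \<and> y = g a}" by blast
    moreover have "{a. \<exists>y. y eps b \<and> Ord a \<and> y = g a} = {a. Ord a}" using ne gne by blast
    ultimately show False using Ord_not_small by simp
  qed
  then obtain a where a: "Ord a" "\<not> (\<exists>u. u eps D (W a))" by blast
  have img: "Ord a \<longrightarrow> (\<forall>y. y eps W a \<longrightarrow> (\<exists>c. c eps a \<and> y = g c))" for a
  proof (rule eps_induct[of "\<lambda>a. Ord a \<longrightarrow> (\<forall>y. y eps W a \<longrightarrow> (\<exists>c. c eps a \<and> y = g c))"],
      intro def_rules DW def_term_app1[OF cg], intro impI allI)
    fix x y assume IH: "\<And>u. u eps x \<Longrightarrow> Ord u \<longrightarrow> (\<forall>y. y eps W u \<longrightarrow> (\<exists>c. c eps u \<and> y = g c))"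
      and x: "Ord x" and y: "y eps W x"
    from y W[OF x] obtain c where c: "c eps x" "y eps H (W c)" by blast
    from c(2) mH consider "y eps W c" | "y = g c" by (auto simp: g_def)
    then show "\<exists>c. c eps x \<and> y = g c"
    proof cases
      case 1
      with IH[OF c(1)] Ord_mem[OF x c(1)] obtain d where "d eps c" "y = g d" by blast
      with Ord_trans[OF x _ c(1)] show ?thesis by blast
    qed (use c in blast)
  qed
  have m: "opair x y eps graph a g \<longleftrightarrow> x eps a \<and> y = g x" for x y
    using mem_graph[OF cg] by auto
  have "y eps W a" if "y eps b" for y using that a(2) mD by blast
  with img a(1) have "\<exists>x. x eps a \<and> y = g x" if "y eps b" for y using that by blast
  then have "onto (graph a g) a b" unfolding onto_def rel_iff m by simp
  with a(1) show ?thesis by blast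
qed

end

section \<open>Assignments with a finite prefix, and sets of witnesses for tuples\<close>

definition prefix :: "'a list \<Rightarrow> (nat \<Rightarrow> 'a) \<Rightarrow> nat \<Rightarrow> 'a" where
  "prefix xs e n = (if n < length xs then xs ! n else e (n - length xs))"

lemma prefix_Nil [simp]: "prefix [] e = e"
  by (rule ext) (simp add: prefix_def)

lemma prefix_snoc: "prefix (xs @ [a]) e = prefix xs (a ## e)"
proof
  fix n
  consider "n < length xs" | "n = length xs" | k where "n = Suc (length xs + k)"
    using less_imp_Suc_add by (metis linorder_neqE_nat)
  then show "prefix (xs @ [a]) e n = prefix xs (a ## e) n"
    by cases (auto simp: prefix_def nth_append Suc_diff_le)
qed

lemma prefix_mem: "set xs \<subseteq> A \<Longrightarrow> (\<And>i. e i \<in> A) \<Longrightarrow> prefix xs e n \<in> A"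
  by (auto simp: prefix_def)

lemma prefix_map: "(\<lambda>n. f (prefix xs e n)) = prefix (map f xs) (\<lambda>n. f (e n))"
  by (rule ext) (simp add: prefix_def)

lemma prefix_upt: "i < m \<Longrightarrow> prefix (map e [0..<m]) e' i = e i"
  by (simp add: prefix_def)

lemma ex_list_snoc:
  "(\<exists>xs. length xs = Suc m \<and> set xs \<subseteq> A \<and> Q xs) \<longleftrightarrow>
    (\<exists>t\<in>A. \<exists>xs. length xs = m \<and> set xs \<subseteq> A \<and> Q (xs @ [t]))" (is "?L \<longleftrightarrow> ?R")
proof
  assume ?L
  then obtain ys where ys: "length ys = Suc m" "set ys \<subseteq> A" "Q ys" by blast
  then obtain xs t where "ys = xs @ [t]" by (metis length_Suc_conv_rev)
  with ys show ?R by auto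
next
  assume ?R
  then obtain t xs where "t \<in> A" "length xs = m" "set xs \<subseteq> A" "Q (xs @ [t])" by blast
  then show ?L by (intro exI[of _ "xs @ [t]"]) auto
qed

lemma delta0_rename: "delta0 \<phi> \<Longrightarrow> inj_on f (all_vars \<phi>) \<Longrightarrow> delta0 (rename f g \<phi>)"
proof (induction rule: delta0.induct)
  case (5 i k \<phi>)
  then have "f i \<noteq> f k" "inj_on f (all_vars \<phi>)" by (auto simp: inj_on_def)
  with 5 show ?case by (auto intro: delta0.intros)
qed (auto intro: delta0.intros simp: inj_on_Un)

context NGBC
begin

lemma definable_substs: "definable P \<Longrightarrow> (\<And>n. def_term (t n)) \<Longrightarrow> definable (\<lambda>e. P (\<lambda>n. t n e))"
proof (induction arbitrary: t rule: definable.induct)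
  case (definable_ex0 P)
  let ?t = "\<lambda>n. case n of 0 \<Rightarrow> (\<lambda>e. e 0) | Suc k \<Rightarrow> (\<lambda>e. t k (\<lambda>n. e (Suc n)))"
  have "definable (\<lambda>e. P (\<lambda>n. ?t n e))"
    using definable_ex0.prems by (intro definable_ex0.IH) (auto intro: def_term_var def_term_weaken split: nat.split)
  from definable.definable_ex0[OF this]
  have "definable (\<lambda>e. \<exists>x. P (\<lambda>n. ?t n (x ## e)))" .
  moreover have "(\<lambda>n. ?t n (x ## e)) = x ## (\<lambda>n. t n e)" for x e
    by (rule ext) (simp add: scons_def split: nat.split)
  ultimately show ?case by simp
next
  case (definable_mem0 i k)
  show ?case by (rule definable_mem[OF definable_mem0[of i] definable_mem0[of k]])
next
  case (definable_eq0 i k)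
  show ?case by (rule definable_eq[OF definable_eq0[of i] definable_eq0[of k]])
next
  case (definable_class0 X i)
  show ?case by (rule definable_in_class[OF definable_class0(1) definable_class0(2)[of i]])
next
  case (definable_not P)
  show ?case by (rule definable.definable_not[OF definable_not.IH[OF definable_not.prems]])
next
  case (definable_conj P Q)
  show ?case by (rule definable.definable_conj[OF definable_conj.IH(1)[OF definable_conj.prems] definable_conj.IH(2)[OF definable_conj.prems]])
qed

text \<open>Only finitely many variables matter, so a quantifier over assignments can be replaced by
  one over tuples of a fixed length.\<close>

lemma definable_support: "definable P \<Longrightarrow> \<exists>m. \<forall>e e'. (\<forall>i<m. e i = e' i) \<longrightarrow> P e = P e'"
proof (induction rule: definable.induct)
  case (definable_mem0 i k)
  then show ?case by (intro exI[of _ "Suc (max i k)"]) auto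
next
  case (definable_eq0 i k)
  then show ?case by (intro exI[of _ "Suc (max i k)"]) auto
next
  case (definable_class0 X i)
  then show ?case by (intro exI[of _ "Suc i"]) auto
next
  case (definable_not P)
  then obtain m where m: "\<forall>e e'. (\<forall>i<m. e i = e' i) \<longrightarrow> P e = P e'" by blast
  have "(\<not> P e) = (\<not> P e')" if "\<forall>i<m. e i = e' i" for e e'
    using m[rule_format, of e e'] that by simp
  then show ?case by (intro exI[of _ m]) simp
next
  case (definable_conj P Q)
  then obtain m n where 1: "\<forall>e e'. (\<forall>i<m. e i = e' i) \<longrightarrow> P e = P e'"
    "\<forall>e e'. (\<forall>i<n. e i = e' i) \<longrightarrow> Q e = Q e'" by blast
  have "(P e \<and> Q e) = (P e' \<and> Q e')" if "\<forall>i<max m n. e i = e' i" for e e'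
    using 1(1)[rule_format, of e e'] 1(2)[rule_format, of e e'] that by simp
  then show ?case by (intro exI[of _ "max m n"]) simp
next
  case (definable_ex0 P)
  then obtain m where m: "\<forall>e e'. (\<forall>i<m. e i = e' i) \<longrightarrow> P e = P e'" by blast
  have eq: "P (x ## e) = P (x ## e')" if "\<forall>i<m. e i = e' i" for x e e'
    using that by (intro m[rule_format]) (auto simp: scons_def split: nat.split)
  show ?case by (intro exI[of _ m] allI impI ex_cong1) (rule eq)
qed

lemma finite_small: "finite F \<Longrightarrow> small F"
proof (induction rule: finite_induct)
  case (insert x F)
  then have "small {z. z = x \<or> z \<in> F}" by (intro small_disj) auto
  moreover have "{z. z = x \<or> z \<in> F} = insert x F" by auto
  ultimately show ?case by simp
qed simp

text \<open>For every \<open>m\<close>-tuple from \<open>b\<close> put in front of \<open>e\<close>,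
  the set \<open>X\<close> holds a witness for \<open>P\<close> if \<open>D\<close> has one at all.
  The number \<open>m\<close> belongs to the metatheory, and the recursion unfolds to
  \<open>m\<close> nested quantifiers, so the predicate is definable.\<close>

primrec collects ::
  "'s set \<Rightarrow> 's \<Rightarrow> ((nat \<Rightarrow> 's) \<Rightarrow> bool) \<Rightarrow> nat \<Rightarrow> 's \<Rightarrow> (nat \<Rightarrow> 's) \<Rightarrow> bool" where
  "collects D b P 0 X e \<longleftrightarrow> ((\<exists>y\<in>D. P (y ## e)) \<longrightarrow> (\<exists>y\<in>D. y eps X \<and> P (y ## e)))"
| "collects D b P (Suc m) X e \<longleftrightarrow> (\<forall>t. t eps b \<longrightarrow> collects D b P m X (t ## e))"

lemma collectsD:
  "collects D b P m X e \<Longrightarrow> length xs = m \<Longrightarrow> set xs \<subseteq> {x. x eps b} \<Longrightarrow> y \<in> D \<Longrightarrow>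
    P (y ## prefix xs e) \<Longrightarrow> \<exists>y\<in>D. y eps X \<and> P (y ## prefix xs e)"
proof (induction m arbitrary: e xs)
  case (Suc m)
  then obtain ys t where xs: "xs = ys @ [t]" by (metis length_Suc_conv_rev)
  with Suc.prems have "collects D b P m X (t ## e)" "length ys = m" "set ys \<subseteq> {x. x eps b}"
    "P (y ## prefix ys (t ## e))" by (auto simp: prefix_snoc)
  from Suc.IH[OF this(1,2,3) Suc.prems(4) this(4)] xs show ?case by (simp add: prefix_snoc)
qed auto

lemma collects_mono: "collects D b P m X e \<Longrightarrow> X \<sqsubseteq> Y \<Longrightarrow> collects D b P m Y e"
  by (induction m arbitrary: e) (auto dest: subD)

lemma def_collects:
  assumes "definable P" "D \<in> \<C>"
  shows "definable (\<lambda>e. collects D b P m (e 0) (\<lambda>n. e (Suc n)))"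
proof (induction m)
  case 0
  have "(\<lambda>n. e (case n of 0 \<Rightarrow> 0 | Suc k \<Rightarrow> Suc (Suc k))) = e 0 ## (\<lambda>n. e (Suc (Suc n)))"
    for e :: "nat \<Rightarrow> 's" by (rule ext) (simp add: scons_def split: nat.split)
  with definable_rename[OF assms(1), of "\<lambda>n. case n of 0 \<Rightarrow> 0 | Suc k \<Rightarrow> Suc (Suc k)"]
  have 1: "definable (\<lambda>e. P (e 0 ## (\<lambda>n. e (Suc (Suc n)))))" by simp
  show ?case unfolding collects.simps by (intro def_rules assms(2) 1)
next
  case (Suc m)
  have eq: "(\<lambda>n. e (if Suc n = 0 then 1 else if Suc n = 1 then 0 else Suc n)) = e 0 ## (\<lambda>n. e (Suc (Suc n)))"
    for e :: "nat \<Rightarrow> 's" by (rule ext) (simp add: scons_def split: nat.split)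
  have "definable (\<lambda>e. collects D b P m (e 1) (e 0 ## (\<lambda>n. e (Suc (Suc n)))))"
    using definable_rename[OF Suc, of "\<lambda>n. if n = 0 then 1 else if n = 1 then 0 else n"] eq by simp
  then show ?case unfolding collects.simps by (intro def_rules) simp
qed

text \<open>Induction on \<open>m\<close>: for each \<open>t\<close> some set handles the remaining
  parameters; collection gathers such sets, and their union handles all \<open>t\<close> by
  monotonicity.\<close>

lemma ex_collects:
  assumes "definable P" "D \<in> \<C>"
  shows "\<exists>X. collects D b P m X e"
proof (induction m arbitrary: e)
  case 0
  show ?case
  proof (cases "\<exists>y\<in>D. P (y ## e)")
    case True
    then obtain y where "y \<in> D" "P (y ## e)" by blast
    then show ?thesis by (intro exI[of _ "upair y y"]) auto
  qed auto
next
  case (Suc m)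
  let ?t = "\<lambda>n. case n of 0 \<Rightarrow> (\<lambda>e. e 1) | Suc k \<Rightarrow> (case k of 0 \<Rightarrow> (\<lambda>e. e 0) | Suc l \<Rightarrow> (\<lambda>_. e l))"
  have dt: "def_term (?t n)" for n
    by (auto intro: def_term_var def_term_const split: nat.split)
  note d = definable_substs[OF def_collects[OF assms, of b m], of ?t, OF dt]
  have "(case n of 0 \<Rightarrow> \<lambda>e. e 0 | Suc l \<Rightarrow> \<lambda>_. e l) e' = (e' 0 ## e) n" for n and e' :: "nat \<Rightarrow> 's"
    by (simp add: scons_def split: nat.split)
  with d have "definable (\<lambda>e'. collects D b P m (e' 1) (e' 0 ## e))" by simp
  from collection[of "\<lambda>t X. collects D b P m X (t ## e)", OF this Suc] obtain Z
    where Z: "\<And>t. t eps b \<Longrightarrow> \<exists>X. X eps Z \<and> collects D b P m X (t ## e)" by blast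
  have "collects D b P m (union_of Z) (t ## e)" if t: "t eps b" for t
  proof -
    obtain X where "X eps Z" "collects D b P m X (t ## e)" using Z[OF t] by blast
    then show ?thesis by (elim collects_mono) (auto simp: sub_def)
  qed
  then show ?case by auto
qed

end

section \<open>Bounded formulas\<close>

locale embedding = NGBC E \<C> for E :: "'s \<Rightarrow> 's \<Rightarrow> bool" and \<C> :: "'s set set" +
  fixes M j :: "'s set"
  assumes j_class: "j \<in> \<C>"
    and M_transitive: "transitive_class E M"
    and j_embedding: "elementary_embedding E j M UNIV"
begin

notation E (infix "eps" 50)

abbreviation C0 :: "nat \<Rightarrow> 's set" where
  "C0 \<equiv> \<lambda>_. {}"

text \<open>The class function \<open>j\<close> made total, with the empty set as value outside
  \<open>M\<close>.\<close>

definition J :: "'s \<Rightarrow> 's" where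
  "J x = set_of {z. \<exists>y. opair x y \<in> j \<and> z eps y}"

lemma def_term_J [def_rules]: "def_term t \<Longrightarrow> def_term (\<lambda>e. J (t e))"
  by (rule def_term_app1) (unfold J_def, intro def_rules j_class)

lemma M_trans: "x \<in> M \<Longrightarrow> y eps x \<Longrightarrow> y \<in> M"
  using M_transitive by (auto simp: transitive_class_def)

lemma J: "x \<in> M \<Longrightarrow> opair x y \<in> j \<longleftrightarrow> y = J x"
proof -
  assume "x \<in> M"
  then have "\<exists>!y. opair x y \<in> j"
    using j_embedding unfolding elementary_embedding_def class_fun_def maps_to_iff by blast
  then obtain u where "\<And>y. opair x y \<in> j \<longleftrightarrow> y = u" by blast
  then have "J x = u" and "opair x y \<in> j \<longleftrightarrow> y = u" for y by (simp_all add: J_def)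
  then show ?thesis by simp
qed

lemma opair_j_iff: "opair x y \<in> j \<longleftrightarrow> x \<in> M \<and> y = J x"
proof -
  have "x \<in> M" if "opair x y \<in> j"
    using that j_embedding opair_inject
    unfolding elementary_embedding_def class_fun_def is_opair_iff by metis
  then show ?thesis using J by blast
qed

lemma M_class [def_rules]: "M \<in> \<C>"
proof -
  have "definable (\<lambda>e. \<exists>y. opair (e 0) y \<in> j)" by (intro def_rules j_class)
  from definable_class[OF this] show ?thesis by (simp add: opair_j_iff)
qed

lemma J_cofinal: "\<exists>x\<in>M. y eps J x"
proof -
  have "\<exists>x\<in>M. \<exists>z. opair x z \<in> j \<and> y eps z"
    using j_embedding unfolding elementary_embedding_def cofinal_map_def maps_to_iff by blast
  then show ?thesis by (auto simp: opair_j_iff)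
qed

lemma J_delta0:
  assumes "delta0 \<phi>" "\<And>n. e n \<in> M"
  shows "sat E M C0 e \<phi> \<longleftrightarrow> sat E UNIV C0 (\<lambda>n. J (e n)) \<phi>"
proof -
  have "delta0_elementary E j M UNIV" using j_embedding by (simp add: elementary_embedding_def)
  from this[unfolded delta0_elementary_def maps_to_iff opair_j_iff, rule_format, of \<phi> e "\<lambda>n. J (e n)"] assms
  show ?thesis by simp
qed

text \<open>
  Bounded predicates in \<open>M\<close> with parameters, paired with the predicates that the same formulas
  define in \<open>V\<close> from the images of the parameters.
\<close>

inductive bdd :: "((nat \<Rightarrow> 's) \<Rightarrow> bool) \<Rightarrow> ((nat \<Rightarrow> 's) \<Rightarrow> bool) \<Rightarrow> bool" where
  bdd_mem: "bdd (\<lambda>e. e i eps e k) (\<lambda>e. e i eps e k)"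
| bdd_eq: "bdd (\<lambda>e. e i = e k) (\<lambda>e. e i = e k)"
| bdd_not: "bdd P P' \<Longrightarrow> bdd (\<lambda>e. \<not> P e) (\<lambda>e. \<not> P' e)"
| bdd_conj: "bdd P P' \<Longrightarrow> bdd Q Q' \<Longrightarrow> bdd (\<lambda>e. P e \<and> Q e) (\<lambda>e. P' e \<and> Q' e)"
| bdd_bex0: "bdd P P' \<Longrightarrow> bdd (\<lambda>e. \<exists>x. x eps e k \<and> P (x ## e)) (\<lambda>e. \<exists>x. x eps e k \<and> P' (x ## e))"
| bdd_param0: "bdd P P' \<Longrightarrow> a \<in> M \<Longrightarrow> bdd (\<lambda>e. P (a ## e)) (\<lambda>e. P' (J a ## e))"

lemma bdd_rename: "bdd P P' \<Longrightarrow> bdd (\<lambda>e. P (\<lambda>n. e (f n))) (\<lambda>e. P' (\<lambda>n. e (f n)))"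
proof (induction arbitrary: f rule: bdd.induct)
  case (bdd_bex0 P P' k)
  from bdd.bdd_bex0[OF bdd_bex0.IH[of "\<lambda>n. case n of 0 \<Rightarrow> 0 | Suc k \<Rightarrow> Suc (f k)"], of "f k"]
  show ?case by (simp add: scons_comp)
next
  case (bdd_param0 P P' a)
  from bdd.bdd_param0[OF bdd_param0.IH[of "\<lambda>n. case n of 0 \<Rightarrow> 0 | Suc k \<Rightarrow> Suc (f k)"] bdd_param0(2)]
  show ?case by (simp add: scons_comp)
qed (intro bdd.intros; assumption?)+

text \<open>All parameters are moved into a list \<open>ps\<close> in front of the assignment, so
  that one formula is evaluated in \<open>M\<close> at \<open>ps\<close> and in \<open>V\<close> at
  the images under \<open>J\<close>.\<close>

lemma bdd_sat:
  "bdd P P' \<Longrightarrow> \<exists>\<phi> ps. delta0 \<phi> \<and> set ps \<subseteq> M \<and>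
    (\<forall>e. (\<forall>i. e i \<in> M) \<longrightarrow> P e = sat E M C0 (prefix ps e) \<phi>) \<and>
    (\<forall>e. P' e = sat E UNIV C0 (prefix (map J ps) e) \<phi>)"
proof (induction rule: bdd.induct)
  case (bdd_mem i k)
  show ?case by (intro exI[of _ "Mem i k"] exI[of _ "[]"]) (auto intro: delta0.intros)
next
  case (bdd_eq i k)
  show ?case by (intro exI[of _ "Eq i k"] exI[of _ "[]"]) (auto intro: delta0.intros)
next
  case (bdd_not P P')
  then obtain \<phi> ps where 1: "delta0 \<phi>" "set ps \<subseteq> M"
    "\<forall>e. (\<forall>i. e i \<in> M) \<longrightarrow> P e = sat E M C0 (prefix ps e) \<phi>"
    "\<forall>e. P' e = sat E UNIV C0 (prefix (map J ps) e) \<phi>" by blast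
  then show ?case by (intro exI[of _ "Neg \<phi>"] exI[of _ ps]) (auto intro: delta0.intros)
next
  case (bdd_conj P P' Q Q')
  then obtain \<phi> ps \<psi> qs where 1: "delta0 \<phi>" "set ps \<subseteq> M"
    "\<forall>e. (\<forall>i. e i \<in> M) \<longrightarrow> P e = sat E M C0 (prefix ps e) \<phi>"
    "\<forall>e. P' e = sat E UNIV C0 (prefix (map J ps) e) \<phi>"
    and 2: "delta0 \<psi>" "set qs \<subseteq> M"
    "\<forall>e. (\<forall>i. e i \<in> M) \<longrightarrow> Q e = sat E M C0 (prefix qs e) \<psi>"
    "\<forall>e. Q' e = sat E UNIV C0 (prefix (map J qs) e) \<psi>" by blast
  \<comment> \<open>Both parameter lists stand in front: the variables of \<open>\<phi>\<close>
    behind \<open>ps\<close> jump over \<open>qs\<close>, and all those of \<open>\<psi>\<close>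
    jump over \<open>ps\<close>.\<close>
  define f where "f i = (if i < length ps then i else i + length qs)" for i
  define g where "g i = length ps + i" for i
  have f: "sat E D C0 (prefix rs e) \<phi> \<longleftrightarrow> sat E D C0 (prefix (rs @ ss) e) (rename f id \<phi>)"
    if "length rs = length ps" "length ss = length qs" for D e rs ss
    by (rule sat_rename) (use that in \<open>auto simp: f_def inj_on_def prefix_def nth_append split: if_splits\<close>)
  have g: "sat E D C0 (prefix ss e) \<psi> \<longleftrightarrow> sat E D C0 (prefix (rs @ ss) e) (rename g id \<psi>)"
    if "length rs = length ps" "length ss = length qs" for D e rs ss
    by (rule sat_rename) (use that in \<open>auto simp: g_def inj_on_def prefix_def nth_append split: if_splits\<close>)
  have "inj_on f A" "inj_on g A" for A by (auto simp: inj_on_def f_def g_def split: if_splits)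
  then have "delta0 (Conj (rename f id \<phi>) (rename g id \<psi>))"
    using 1(1) 2(1) by (auto intro!: delta0.intros delta0_rename)
  moreover have "set (ps @ qs) \<subseteq> M" using 1(2) 2(2) by simp
  moreover have "P e \<and> Q e \<longleftrightarrow> sat E M C0 (prefix (ps @ qs) e) (Conj (rename f id \<phi>) (rename g id \<psi>))"
    if "\<forall>i. e i \<in> M" for e
    using that 1(3) 2(3) f[of ps qs] g[of ps qs] by simp
  moreover have "P' e \<and> Q' e \<longleftrightarrow>
    sat E UNIV C0 (prefix (map J (ps @ qs)) e) (Conj (rename f id \<phi>) (rename g id \<psi>))" for e
    using 1(4) 2(4) f[of "map J ps" "map J qs"] g[of "map J ps" "map J qs"] by simp
  ultimately show ?case by blast
next
  case (bdd_bex0 P P' k)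
  then obtain \<phi> ps where 1: "delta0 \<phi>" "set ps \<subseteq> M"
    "\<forall>e. (\<forall>i. e i \<in> M) \<longrightarrow> P e = sat E M C0 (prefix ps e) \<phi>"
    "\<forall>e. P' e = sat E UNIV C0 (prefix (map J ps) e) \<phi>" by blast
  let ?l = "length ps"
  obtain m where m: "\<forall>i\<in>all_vars \<phi>. i < m" "?l + k < m" using fresh_var by blast
  \<comment> \<open>The bound variable sits just behind the parameters; it becomes the fresh
    \<open>m\<close>, and the variables behind it move down by one.\<close>
  define f where "f i = (if i < ?l then i else if i = ?l then m else i - 1)" for i
  have inj: "inj_on f (all_vars \<phi>)"
    using m by (auto simp: inj_on_def f_def split: if_splits)
  let ?\<psi> = "Exists m (Conj (Mem m (?l + k)) (rename f id \<phi>))"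
  have *: "sat E D C0 (prefix rs (x ## e)) \<phi> \<longleftrightarrow> sat E D C0 ((prefix rs e)(m := x)) (rename f id \<phi>)"
    if "length rs = ?l" for D rs x e
  proof (rule sat_rename[OF inj])
    fix i assume i: "i \<in> all_vars \<phi>"
    consider "i < ?l" | "i = ?l" | n where "i = Suc (?l + n)"
      using less_imp_Suc_add by (metis linorder_neqE_nat)
    then show "prefix rs (x ## e) i = ((prefix rs e)(m := x)) (f i)"
      by cases (use m i that in \<open>auto simp: f_def prefix_def Suc_diff_le\<close>)
  qed simp
  have **: "prefix rs e (?l + k) = e k" if "length rs = ?l" for rs and e :: "nat \<Rightarrow> 's"
    using that by (simp add: prefix_def)
  have "delta0 ?\<psi>"
    using m by (intro delta0.intros delta0_rename[OF 1(1) inj]) simp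
  moreover have "(\<exists>x. x eps e k \<and> P (x ## e)) \<longleftrightarrow> sat E M C0 (prefix ps e) ?\<psi>"
    if e: "\<forall>i. e i \<in> M" for e
  proof -
    have "P (x ## e) = sat E M C0 ((prefix ps e)(m := x)) (rename f id \<phi>)" if x: "x \<in> M" for x
    proof -
      have "\<forall>i. (x ## e) i \<in> M" using x e by (auto simp: scons_def split: nat.split)
      then show ?thesis using 1(3) *[of ps] by simp
    qed
    moreover have "x \<in> M" if "x eps e k" for x using M_trans e that by blast
    ultimately show ?thesis using m(2) **[of ps] by auto
  qed
  moreover have "(\<exists>x. x eps e k \<and> P' (x ## e)) \<longleftrightarrow> sat E UNIV C0 (prefix (map J ps) e) ?\<psi>" for e
    using 1(4) *[of "map J ps"] **[of "map J ps"] m(2) by auto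
  ultimately show ?case using 1(2) by blast
next
  case (bdd_param0 P P' a)
  then obtain \<phi> ps where 1: "delta0 \<phi>" "set ps \<subseteq> M"
    "\<forall>e. (\<forall>i. e i \<in> M) \<longrightarrow> P e = sat E M C0 (prefix ps e) \<phi>"
    "\<forall>e. P' e = sat E UNIV C0 (prefix (map J ps) e) \<phi>" by blast
  have "\<forall>i. (a ## e) i \<in> M" if "\<forall>i. e i \<in> M" for e
    using that bdd_param0(2) by (auto simp: scons_def split: nat.split)
  with 1 bdd_param0(2) show ?case
    by (intro exI[of _ \<phi>] exI[of _ "ps @ [a]"]) (simp add: prefix_snoc)
qed

lemma bdd_transfer:
  assumes "bdd P P'" "\<And>i. e i \<in> M"
  shows "P e \<longleftrightarrow> P' (\<lambda>n. J (e n))"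
proof -
  from bdd_sat[OF assms(1)] obtain \<phi> ps where 1: "delta0 \<phi>" "set ps \<subseteq> M"
    "\<forall>e. (\<forall>i. e i \<in> M) \<longrightarrow> P e = sat E M C0 (prefix ps e) \<phi>"
    "\<forall>e. P' e = sat E UNIV C0 (prefix (map J ps) e) \<phi>" by blast
  have "prefix ps e n \<in> M" for n
    by (rule prefix_mem) (use 1(2) assms(2) in auto)
  from J_delta0[OF 1(1) this] 1(3,4) assms(2) show ?thesis by (simp add: prefix_map)
qed

lemma bdd_transfer2:
  assumes "bdd P P'" "a \<in> M" "b \<in> M"
  shows "P (a ## (\<lambda>_. b)) \<longleftrightarrow> P' (J a ## (\<lambda>_. J b))"
proof -
  have "(a ## (\<lambda>_. b)) i \<in> M" for i
    using assms(2,3) by (simp add: scons_def split: nat.split)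
  moreover have "(\<lambda>n. J ((a ## (\<lambda>_. b)) n)) = J a ## (\<lambda>_. J b)"
    by (rule ext) (simp add: scons_def split: nat.split)
  ultimately show ?thesis using bdd_transfer[OF assms(1)] by metis
qed

named_theorems bdd_rules

lemmas [bdd_rules] = bdd_mem bdd_eq bdd_not bdd_conj

lemma bdd_bex [bdd_rules]:
  "bdd (\<lambda>e. R (e 0) (\<lambda>n. e (Suc n))) (\<lambda>e. R' (e 0) (\<lambda>n. e (Suc n))) \<Longrightarrow>
    bdd (\<lambda>e. \<exists>x. x eps e k \<and> R x e) (\<lambda>e. \<exists>x. x eps e k \<and> R' x e)"
  using bdd_bex0[of "\<lambda>e. R (e 0) (\<lambda>n. e (Suc n))" "\<lambda>e. R' (e 0) (\<lambda>n. e (Suc n))" k] by simp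

lemma bdd_ball [bdd_rules]:
  "bdd (\<lambda>e. R (e 0) (\<lambda>n. e (Suc n))) (\<lambda>e. R' (e 0) (\<lambda>n. e (Suc n))) \<Longrightarrow>
    bdd (\<lambda>e. \<forall>x. x eps e k \<longrightarrow> R x e) (\<lambda>e. \<forall>x. x eps e k \<longrightarrow> R' x e)"
  using bdd_not[OF bdd_bex[of "\<lambda>x e. \<not> R x e" "\<lambda>x e. \<not> R' x e" k]] bdd_not by simp

lemma bdd_cbex:
  assumes "bdd P P'" "b \<in> M"
  shows "bdd (\<lambda>e. \<exists>x. x eps b \<and> P (x ## e)) (\<lambda>e. \<exists>x. x eps J b \<and> P' (x ## e))"
proof -
  let ?f = "\<lambda>n. case n of 0 \<Rightarrow> 0 | Suc k \<Rightarrow> Suc (Suc k)"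
  have "(\<lambda>n. (x ## y ## e) (?f n)) = x ## e" for x y and e :: "nat \<Rightarrow> 's"
    by (rule ext) (simp add: scons_def split: nat.split)
  with bdd_param0[OF bdd_bex0[OF bdd_rename[OF assms(1), of ?f], of 0] assms(2)]
  show ?thesis by simp
qed

lemma bdd_cmem: "s \<in> M \<Longrightarrow> bdd (\<lambda>e. e i eps s) (\<lambda>e. e i eps J s)"
  using bdd_param0[OF bdd_mem[of "Suc i" 0], of s] by simp

text \<open>A quantifier over all \<open>m\<close>-tuples from \<open>b\<close> is a chain of
  \<open>m\<close> bounded ones. One bounded statement can thus speak about all choices of
  parameters at once.\<close>

lemma bdd_ctuple:
  assumes "bdd P P'" "b \<in> M"
  shows "bdd (\<lambda>e. \<exists>xs. length xs = m \<and> set xs \<subseteq> {x. x eps b} \<and> P (prefix xs e))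
    (\<lambda>e. \<exists>xs. length xs = m \<and> set xs \<subseteq> {x. x eps J b} \<and> P' (prefix xs e))"
proof (induction m)
  case 0
  show ?case using assms(1) by simp
next
  case (Suc m)
  from bdd_cbex[OF Suc assms(2)] show ?case
    unfolding ex_list_snoc prefix_snoc by simp
qed

lemma J_mem_iff: "x \<in> M \<Longrightarrow> y \<in> M \<Longrightarrow> J x eps J y \<longleftrightarrow> x eps y"
  using bdd_transfer2[OF bdd_mem[of 0 1], of x y] by simp

lemma J_sub:
  assumes "x \<in> M" "y \<in> M" "x \<sqsubseteq> y"
  shows "J x \<sqsubseteq> J y"
proof -
  have "bdd (\<lambda>e. \<forall>z. z eps e 0 \<longrightarrow> z eps e 1) (\<lambda>e. \<forall>z. z eps e 0 \<longrightarrow> z eps e 1)" by (intro bdd_rules)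
  from bdd_transfer2[OF this assms(1,2)] assms(3) show ?thesis by (simp add: sub_def)
qed

lemma covering:
  assumes "small X" "X \<subseteq> M"
  obtains c where "c \<in> M" "\<And>x. x \<in> X \<Longrightarrow> x eps c"
proof -
  obtain a where a: "\<And>x. x eps a \<longleftrightarrow> x \<in> X" using assms(1) by (auto simp: small_def)
  have "class_graph J" by (intro def_rules)
  from small_image[OF this, of a] obtain y where y: "\<And>z. z eps y \<longleftrightarrow> (\<exists>x. x \<in> X \<and> z = J x)"
    unfolding a small_def by auto
  obtain c where c: "c \<in> M" "y eps J c" using J_cofinal by blast
  obtain d where d: "d \<in> M" "union_of (J c) eps J d" using J_cofinal by blast
  have "bdd (\<lambda>e. \<exists>u. u eps e 0 \<and> (\<forall>w. w eps e 1 \<longrightarrow> (\<forall>x. x eps w \<longrightarrow> x eps u)))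
    (\<lambda>e. \<exists>u. u eps e 0 \<and> (\<forall>w. w eps e 1 \<longrightarrow> (\<forall>x. x eps w \<longrightarrow> x eps u)))"
    by (intro bdd_rules)
  from bdd_transfer2[OF this d(1) c(1)]
  have "(\<exists>u. u eps d \<and> (\<forall>w. w eps c \<longrightarrow> (\<forall>x. x eps w \<longrightarrow> x eps u))) \<longleftrightarrow>
      (\<exists>u. u eps J d \<and> (\<forall>w. w eps J c \<longrightarrow> (\<forall>x. x eps w \<longrightarrow> x eps u)))"
    by simp
  moreover have "union_of (J c) eps J d \<and> (\<forall>w. w eps J c \<longrightarrow> (\<forall>x. x eps w \<longrightarrow> x eps union_of (J c)))"
    using d(2) by auto
  ultimately have "\<exists>u. u eps d \<and> (\<forall>w. w eps c \<longrightarrow> (\<forall>x. x eps w \<longrightarrow> x eps u))"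
    by blast
  then obtain u where u: "u eps d" "\<And>w x. w eps c \<Longrightarrow> x eps w \<Longrightarrow> x eps u" by blast
  have "bdd (\<lambda>e. \<exists>w. w eps e 0 \<and> e 1 eps w) (\<lambda>e. \<exists>w. w eps e 0 \<and> e 1 eps w)"
    by (intro bdd_rules)
  note t = bdd_transfer2[OF this c(1)]
  \<comment> \<open>As \<open>J x eps y\<close> and \<open>y eps J c\<close>, the point
    \<open>J x\<close> lies in an element of \<open>J c\<close>; pulled back, \<open>x\<close> lies
    in an element of \<open>c\<close>.\<close>
  have "x eps u" if x: "x \<in> X" for x
  proof -
    have "x \<in> M" using x assms(2) by blast
    moreover have "J x eps y" using x y by blast
    ultimately have "\<exists>w. w eps c \<and> x eps w"
      using t[of x] c(2) by auto
    with u show ?thesis by blast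
  qed
  moreover have "u \<in> M" using u(1) d(1) M_trans by blast
  ultimately show ?thesis using that by blast
qed

section \<open>Full elementarity\<close>

definition amenable :: "'s set \<Rightarrow> 's set \<Rightarrow> bool" where
  "amenable X X' \<longleftrightarrow> (\<forall>z\<in>M. \<exists>s\<in>M. (\<forall>x. x eps s \<longleftrightarrow> x eps z \<and> x \<in> X) \<and> (\<forall>x. x eps J s \<longleftrightarrow> x eps J z \<and> x \<in> X'))"

text \<open>
  Predicates over \<open>(M, X)\<close> paired with the predicates that the same formulas define over \<open>(V, X')\<close>,
  for classes \<open>X, X'\<close> such that \<open>J\<close> maps \<open>X \<inter> z\<close> to \<open>X' \<inter> J z\<close>.
\<close>

inductive elem :: "((nat \<Rightarrow> 's) \<Rightarrow> bool) \<Rightarrow> ((nat \<Rightarrow> 's) \<Rightarrow> bool) \<Rightarrow> bool" where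
  elem_mem: "elem (\<lambda>e. e i eps e k) (\<lambda>e. e i eps e k)"
| elem_eq: "elem (\<lambda>e. e i = e k) (\<lambda>e. e i = e k)"
| elem_class: "X \<in> \<C> \<Longrightarrow> X' \<in> \<C> \<Longrightarrow> amenable X X' \<Longrightarrow> elem (\<lambda>e. e i \<in> X) (\<lambda>e. e i \<in> X')"
| elem_not: "elem P P' \<Longrightarrow> elem (\<lambda>e. \<not> P e) (\<lambda>e. \<not> P' e)"
| elem_conj: "elem P P' \<Longrightarrow> elem Q Q' \<Longrightarrow> elem (\<lambda>e. P e \<and> Q e) (\<lambda>e. P' e \<and> Q' e)"
| elem_ex0: "elem P P' \<Longrightarrow> elem (\<lambda>e. \<exists>x\<in>M. P (x ## e)) (\<lambda>e. \<exists>x. P' (x ## e))"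
| elem_cong: "elem P P' \<Longrightarrow> (\<And>e. (\<And>i. e i \<in> M) \<Longrightarrow> P e = R e) \<Longrightarrow> elem R P'"

lemma scons_M: "x \<in> A \<Longrightarrow> (\<And>i. e i \<in> A) \<Longrightarrow> (x ## e) i \<in> A"
  by (simp add: scons_def split: nat.split)

lemma elem_rename: "elem P P' \<Longrightarrow> elem (\<lambda>e. P (\<lambda>n. e (f n))) (\<lambda>e. P' (\<lambda>n. e (f n)))"
proof (induction arbitrary: f rule: elem.induct)
  case (elem_ex0 P P')
  from elem.elem_ex0[OF elem_ex0.IH[of "\<lambda>n. case n of 0 \<Rightarrow> 0 | Suc k \<Rightarrow> Suc (f k)"]]
  show ?case by (simp add: scons_comp)
next
  case (elem_cong P P' R)
  have "P (\<lambda>n. e (f n)) = R (\<lambda>n. e (f n))" if "\<And>i. e i \<in> M" for e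
    by (rule elem_cong(2)) (rule that)
  then show ?case by (rule elem.elem_cong[OF elem_cong.IH[of f], of "\<lambda>e. R (\<lambda>n. e (f n))"])
next
  case (elem_class X X' i)
  then show ?case by (rule elem.elem_class[of X X' "f i"])
next
  case (elem_mem i k)
  show ?case by (rule elem.elem_mem)
next
  case (elem_eq i k)
  show ?case by (rule elem.elem_eq)
next
  case (elem_not P P')
  show ?case by (rule elem.elem_not[OF elem_not.IH])
next
  case (elem_conj P P' Q Q')
  show ?case by (rule elem.elem_conj[OF elem_conj.IH])
qed

text \<open>\<open>elem_cong\<close> leaves \<open>P\<close> free on assignments outside
  \<open>M\<close>, so \<open>P\<close> itself may fail to be definable and a definable substitute
  is supplied.\<close>

lemma elem_definable: "elem P P' \<Longrightarrow> \<exists>P0. definable P0 \<and> (\<forall>e. (\<forall>i. e i \<in> M) \<longrightarrow> P e = P0 e)"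
proof (induction rule: elem.induct)
  case (elem_mem i k)
  show ?case by (intro exI[of _ "\<lambda>e. e i eps e k"]) (simp add: definable_mem0)
next
  case (elem_eq i k)
  show ?case by (intro exI[of _ "\<lambda>e. e i = e k"]) (simp add: definable_eq0)
next
  case (elem_class X X' i)
  then show ?case by (intro exI[of _ "\<lambda>e. e i \<in> X"]) (simp add: definable_class0)
next
  case (elem_not P P')
  then obtain P0 where "definable P0" "\<forall>e. (\<forall>i. e i \<in> M) \<longrightarrow> P e = P0 e" by blast
  then show ?case by (intro exI[of _ "\<lambda>e. \<not> P0 e"]) (simp add: definable_not)
next
  case (elem_conj P P' Q Q')
  then obtain P0 Q0 where "definable P0" "\<forall>e. (\<forall>i. e i \<in> M) \<longrightarrow> P e = P0 e"
    "definable Q0" "\<forall>e. (\<forall>i. e i \<in> M) \<longrightarrow> Q e = Q0 e" by blast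
  then show ?case by (intro exI[of _ "\<lambda>e. P0 e \<and> Q0 e"]) (simp add: definable_conj)
next
  case (elem_ex0 P P')
  then obtain P0 where P0: "definable P0" "\<forall>e. (\<forall>i. e i \<in> M) \<longrightarrow> P e = P0 e" by blast
  have "definable (\<lambda>e. \<exists>x. x \<in> M \<and> P0 (x ## e))"
    using definable_ex0[OF definable_conj[OF definable_class0[OF M_class, of 0] P0(1)]] by simp
  moreover have "P (x ## e) = P0 (x ## e)" if "\<forall>i. e i \<in> M" "x \<in> M" for e x
    using P0(2) scons_M[OF that(2), of e] that(1) by blast
  ultimately show ?case by (intro exI[of _ "\<lambda>e. \<exists>x. x \<in> M \<and> P0 (x ## e)"]) auto
next
  case (elem_cong P P' R)
  then obtain P0 where P0: "definable P0" "\<forall>e. (\<forall>i. e i \<in> M) \<longrightarrow> P e = P0 e" by blast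
  have "R e = P0 e" if "\<forall>i. e i \<in> M" for e
    using elem_cong(2)[of e] P0(2) that by blast
  with P0(1) show ?case by blast
qed

lemma elem_definable_V: "elem P P' \<Longrightarrow> definable P'"
  by (induction rule: elem.induct) (auto intro: definable.intros)

text \<open>The induction hypothesis of Gaifman's argument: over each \<open>b \<in> M\<close> the
  pair coincides with a bounded one, which may depend on \<open>b\<close> and contain further
  parameters.\<close>

definition locally_bdd :: "((nat \<Rightarrow> 's) \<Rightarrow> bool) \<Rightarrow> ((nat \<Rightarrow> 's) \<Rightarrow> bool) \<Rightarrow> bool" where
  "locally_bdd P P' \<longleftrightarrow> (\<forall>b\<in>M. \<exists>Q Q'. bdd Q Q' \<and> (\<forall>e. (\<forall>i. e i eps b) \<longrightarrow> P e = Q e) \<and>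
     (\<forall>e. (\<forall>i. e i eps J b) \<longrightarrow> P' e = Q' e))"

lemma cover_common:
  assumes "a \<in> M" "b \<in> M"
  obtains c where "c \<in> M" "a \<sqsubseteq> c" "b \<sqsubseteq> c"
proof -
  have "small {z. z eps a \<or> z eps b}" by simp
  then obtain c where "c \<in> M" "\<And>x. x \<in> {z. z eps a \<or> z eps b} \<Longrightarrow> x eps c"
    by (rule covering) (use M_trans assms in auto)
  with that[of c] show ?thesis by (simp add: sub_def)
qed

lemma prefix_agree:
  fixes P :: "(nat \<Rightarrow> 's) \<Rightarrow> bool"
  assumes "\<forall>e e'. (\<forall>i<m. e i = e' i) \<longrightarrow> P e = P e'" "m \<le> m'"
  shows "P (x ## prefix (map e [0..<m']) e') = P (x ## e)"
  using assms(2)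
  by (intro assms(1)[rule_format]) (auto simp: scons_def prefix_upt split: nat.split)

text \<open>
  The existential step of Gaifman's theorem: witnesses in \<open>M\<close> can be collected in a set
  \<open>c \<in> M\<close>, so that the quantifier becomes bounded by \<open>c\<close>; in \<open>V\<close> a witness lies in some \<open>J d\<close>, and
  the equivalence of the bounds \<open>c\<close> and \<open>c \<union> d\<close> is a bounded statement, which \<open>J\<close> preserves.
\<close>

lemma locally_bdd_ex:
  assumes P: "elem P P'" and IH: "locally_bdd P P'"
  shows "locally_bdd (\<lambda>e. \<exists>x\<in>M. P (x ## e)) (\<lambda>e. \<exists>x. P' (x ## e))"
  unfolding locally_bdd_def
proof
  fix b assume b: "b \<in> M"
  let ?goal = "\<exists>Q Q'. bdd Q Q' \<and> (\<forall>e. (\<forall>i. e i eps b) \<longrightarrow> (\<exists>x\<in>M. P (x ## e)) = Q e) \<and>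
    (\<forall>e. (\<forall>i. e i eps J b) \<longrightarrow> (\<exists>x. P' (x ## e)) = Q' e)"
  show ?goal
  proof (cases "\<exists>x. x eps b")
    case False
    \<comment> \<open>An empty \<open>b\<close> admits no assignment, and \<open>J b\<close> is then
      empty too, so any bounded pair serves.\<close>
    have "bdd (\<lambda>e. \<exists>x. x eps e 0 \<and> x = x) (\<lambda>e. \<exists>x. x eps e 0 \<and> x = x)"
      using bdd_bex0[OF bdd_eq[of 0 0], of 0] by simp
    from bdd_transfer2[OF this b b] False have "\<not> x eps J b" for x by simp
    with False bdd_eq[of 0 0] show ?thesis by blast
  next
    case True
    then obtain b0 where b0: "b0 eps b" by blast
    have b0M: "b0 \<in> M" using M_trans[OF b b0] .
    have Jb0: "J b0 eps J b" using J_mem_iff[OF b0M b] b0 by simp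
    obtain P0 where P0: "definable P0" "\<And>e. (\<And>i. e i \<in> M) \<Longrightarrow> P e = P0 e"
      using elem_definable[OF P] by blast
    obtain m1 where m1: "\<forall>e e'. (\<forall>i<m1. e i = e' i) \<longrightarrow> P0 e = P0 e'"
      using definable_support[OF P0(1)] by blast
    obtain m2 where m2: "\<forall>e e'. (\<forall>i<m2. e i = e' i) \<longrightarrow> P' e = P' e'"
      using definable_support[OF elem_definable_V[OF P]] by blast
    define m where "m = max m1 m2"
    \<comment> \<open>Values from index \<open>m\<close> on are irrelevant; cutting the assignment
      there leaves a tuple over which a bounded statement can quantify.\<close>
    let ?p = "\<lambda>e. prefix (map e [0..<m])"
    have pP0: "P0 (x ## ?p e e') = P0 (x ## e)" for x e e'
      by (rule prefix_agree[OF m1]) (simp add: m_def)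
    have pP': "P' (x ## ?p e e') = P' (x ## e)" for x e e'
      by (rule prefix_agree[OF m2]) (simp add: m_def)
    have p_in: "prefix xs e n eps a" if "set xs \<subseteq> {x. x eps a}" "\<And>i. e i eps a" for xs e n a
      using prefix_mem[OF that(1), of e n] that(2) by simp
    obtain X where X: "collects M b P0 m X (\<lambda>_. b0)" using ex_collects[OF P0(1) M_class] by blast
    have "definable (\<lambda>e. e 0 eps X \<and> e 0 \<in> M)" by (intro def_rules)
    from small_subset[of "\<lambda>x. x eps X \<and> x \<in> M", OF this, of X]
    have "small {x. (x eps X \<and> x \<in> M) \<or> x eps b}" by (intro small_disj) auto
    moreover have "{x. (x eps X \<and> x \<in> M) \<or> x eps b} \<subseteq> M" using M_trans[OF b] by blast
    ultimately obtain c where c: "c \<in> M" and "\<And>x. x \<in> {x. (x eps X \<and> x \<in> M) \<or> x eps b} \<Longrightarrow> x eps c"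
      by (rule covering) blast
    then have cX: "\<And>x. x eps X \<Longrightarrow> x \<in> M \<Longrightarrow> x eps c" and bc: "b \<sqsubseteq> c"
      by (simp_all add: sub_def)
    have Jbc: "J b \<sqsubseteq> J c" by (rule J_sub[OF b c bc])
    obtain Q Q' where Q: "bdd Q Q'" "\<And>e. (\<And>i. e i eps c) \<Longrightarrow> P e = Q e"
      "\<And>e. (\<And>i. e i eps J c) \<Longrightarrow> P' e = Q' e"
      using IH c unfolding locally_bdd_def by blast
    let ?S = "\<lambda>e. \<exists>x. x eps c \<and> Q (x ## e)" and ?S' = "\<lambda>e. \<exists>x. x eps J c \<and> Q' (x ## e)"
    have S: "bdd ?S ?S'" by (rule bdd_cbex[OF Q(1) c])
    have inM: "(x ## e) i \<in> M" if "x \<in> M" "\<And>i. e i eps b" for x e i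
      using that M_trans[OF b] by (intro scons_M) auto
    have inc: "(x ## e) i eps c" if "x eps c" "\<And>i. e i eps b" for x e i
      using that subD[OF bc] scons_M[of x "{x. x eps c}" e i] by simp
    have inJc: "(x ## e) i eps J c" if "x eps J c" "\<And>i. e i eps J b" for x e i
      using that subD[OF Jbc] scons_M[of x "{x. x eps J c}" e i] by simp
    have eqM: "P (x ## e) = P0 (x ## ?p e e')" if "x \<in> M" "\<And>i. e i eps b" for x e e'
      unfolding pP0 by (rule P0(2), rule inM) (use that in simp_all)
    have eqQ: "P (x ## e) = Q (x ## e)" if "x eps c" "\<And>i. e i eps b" for x e
      by (rule Q(2), rule inc) (use that in simp_all)
    have eqQ': "P' (x ## e) = Q' (x ## e)" if "x eps J c" "\<And>i. e i eps J b" for x e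
      by (rule Q(3), rule inJc) (use that in simp_all)
    have Mside: "(\<exists>x\<in>M. P (x ## e)) \<longleftrightarrow> ?S e" if e: "\<And>i. e i eps b" for e
    proof
      assume "\<exists>x\<in>M. P (x ## e)"
      then obtain x where x: "x \<in> M" "P (x ## e)" by blast
      then have "P0 (x ## ?p e (\<lambda>_. b0))" using eqM[of x e, OF x(1) e] by simp
      from collectsD[OF X _ _ x(1) this] e obtain y
        where y: "y \<in> M" "y eps X" "P0 (y ## ?p e (\<lambda>_. b0))" by auto
      have "P (y ## e)" using y(3) eqM[of y e, OF y(1) e] by simp
      moreover have yc: "y eps c" using cX[OF y(2,1)] .
      ultimately show "?S e" using eqQ[of y e, OF yc e] by blast
    next
      assume "?S e"
      then obtain x where x: "x eps c" "Q (x ## e)" by blast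
      then have "P (x ## e)" using eqQ[of x e, OF x(1) e] by simp
      then show "\<exists>x\<in>M. P (x ## e)" using M_trans[OF c x(1)] by blast
    qed
    have Vside: "(\<exists>x. P' (x ## e)) \<longleftrightarrow> ?S' e" if e: "\<And>i. e i eps J b" for e
    proof
      assume "?S' e"
      then obtain x where x: "x eps J c" "Q' (x ## e)" by blast
      then show "\<exists>x. P' (x ## e)" using eqQ'[of x e, OF x(1) e] by blast
    next
      assume "\<exists>x. P' (x ## e)"
      then obtain y where y: "P' (y ## e)" by blast
      obtain d where d: "d \<in> M" "y eps J d" using J_cofinal by blast
      obtain c' where c': "c' \<in> M" "c \<sqsubseteq> c'" "d \<sqsubseteq> c'" using cover_common[OF c d(1)] .
      have yc': "y eps J c'" using J_sub[OF d(1) c'(1,3)] d(2) subD by blast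
      obtain Q2 Q2' where Q2: "bdd Q2 Q2'" "\<And>e. (\<And>i. e i eps c') \<Longrightarrow> P e = Q2 e"
        "\<And>e. (\<And>i. e i eps J c') \<Longrightarrow> P' e = Q2' e"
        using IH c'(1) unfolding locally_bdd_def by blast
      have inc': "(x ## e) i eps c'" if "x eps c'" "\<And>i. e i eps b" for x e i
        using that subD[OF bc] subD[OF c'(2)] scons_M[of x "{x. x eps c'}" e i] by simp
      have inJc': "(x ## e) i eps J c'" if "x eps J c'" "\<And>i. e i eps J b" for x e i
        using that subD[OF Jbc] subD[OF J_sub[OF c c'(1,2)]] scons_M[of x "{x. x eps J c'}" e i] by simp
      \<comment> \<open>\<open>?T\<close> says that \<open>c'\<close> holds a witness where
        \<open>c\<close> holds none. No tuple from \<open>b\<close> satisfies it, and this bounded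
        fact passes through \<open>J\<close>: no tuple from \<open>J b\<close> satisfies
        \<open>?T'\<close>.\<close>
      let ?T = "\<lambda>e. (\<exists>x. x eps c' \<and> Q2 (x ## e)) \<and> \<not> ?S e"
      let ?T' = "\<lambda>e. (\<exists>x. x eps J c' \<and> Q2' (x ## e)) \<and> \<not> ?S' e"
      have T: "bdd ?T ?T'" by (intro bdd_conj bdd_not S bdd_cbex[OF Q2(1) c'(1)])
      have nT0: "\<not> ?T f" if f: "\<And>i. f i eps b" for f
      proof
        assume "?T f"
        then obtain x where x: "x eps c'" "Q2 (x ## f)" "\<not> ?S f" by blast
        have "P (x ## f) = Q2 (x ## f)" by (rule Q2(2), rule inc') (use x f in simp_all)
        with x(2,3) Mside[of f, OF f] M_trans[OF c'(1) x(1)] show False by blast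
      qed
      have nM: "\<not> (\<exists>xs. length xs = m \<and> set xs \<subseteq> {x. x eps b} \<and> ?T (prefix xs (\<lambda>_. b0)))"
      proof
        assume "\<exists>xs. length xs = m \<and> set xs \<subseteq> {x. x eps b} \<and> ?T (prefix xs (\<lambda>_. b0))"
        then obtain xs where xs: "set xs \<subseteq> {x. x eps b}" "?T (prefix xs (\<lambda>_. b0))" by blast
        have "\<And>i. prefix xs (\<lambda>_. b0) i eps b" by (rule p_in[OF xs(1)]) (rule b0)
        from nT0[of "prefix xs (\<lambda>_. b0)", OF this] xs(2) show False by simp
      qed
      have nT: "\<not> (\<exists>xs. length xs = m \<and> set xs \<subseteq> {x. x eps J b} \<and> ?T' (prefix xs (\<lambda>_. J b0)))"
        by (rule contrapos_nn[OF nM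
              iffD2[OF bdd_transfer[OF bdd_ctuple[OF T b, of m], of "\<lambda>_. b0", OF b0M]]])
      let ?f = "?p e (\<lambda>_. J b0)"
      have f: "?f i eps J b" for i by (rule p_in) (use e Jb0 in auto)
      have "\<not> ?T' ?f"
      proof
        assume "?T' ?f"
        with e have "length (map e [0..<m]) = m \<and> set (map e [0..<m]) \<subseteq> {x. x eps J b} \<and> ?T' ?f"
          by auto
        with nT show False by blast
      qed
      moreover have "P' (y ## ?f)" using y pP' by simp
      moreover have "P' (y ## ?f) = Q2' (y ## ?f)"
        by (rule Q2(3), rule inJc') (use yc' f in simp_all)
      ultimately have "?S' ?f" using yc' by blast
      then obtain x where x: "x eps J c" "Q' (x ## ?f)" by blast
      then have "P' (x ## e)" using eqQ'[of x ?f, OF x(1) f] pP' by simp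
      then show "?S' e" using eqQ'[of x e, OF x(1) e] x(1) by blast
    qed
    show ?thesis
    proof (rule exI[of _ ?S], rule exI[of _ ?S'], intro conjI allI impI)
      show "bdd ?S ?S'" by (rule S)
    qed (rule Mside Vside, blast)+
  qed
qed

lemma elem_locally_bdd: "elem P P' \<Longrightarrow> locally_bdd P P'"
proof (induction rule: elem.induct)
  case (elem_mem i k)
  show ?case unfolding locally_bdd_def using bdd_mem by blast
next
  case (elem_eq i k)
  show ?case unfolding locally_bdd_def using bdd_eq by blast
next
  case (elem_class X X' i)
  show ?case unfolding locally_bdd_def
  proof
    fix b assume "b \<in> M"
    with elem_class(3) obtain s where s: "s \<in> M" "\<forall>x. x eps s \<longleftrightarrow> x eps b \<and> x \<in> X"
      "\<forall>x. x eps J s \<longleftrightarrow> x eps J b \<and> x \<in> X'" unfolding amenable_def by blast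
    then show "\<exists>Q Q'. bdd Q Q' \<and> (\<forall>e. (\<forall>i. e i eps b) \<longrightarrow> (e i \<in> X) = Q e) \<and>
      (\<forall>e. (\<forall>i. e i eps J b) \<longrightarrow> (e i \<in> X') = Q' e)"
      by - (rule exI[of _ "\<lambda>e. e i eps s"], rule exI[of _ "\<lambda>e. e i eps J s"],
          intro conjI allI impI, rule bdd_cmem, simp_all)
  qed
next
  case (elem_not P P')
  show ?case unfolding locally_bdd_def
  proof
    fix b assume "b \<in> M"
    with elem_not.IH obtain Q Q' where "bdd Q Q'" "\<forall>e. (\<forall>i. e i eps b) \<longrightarrow> P e = Q e"
      "\<forall>e. (\<forall>i. e i eps J b) \<longrightarrow> P' e = Q' e" unfolding locally_bdd_def by blast
    then show "\<exists>Q Q'. bdd Q Q' \<and> (\<forall>e. (\<forall>i. e i eps b) \<longrightarrow> (\<not> P e) = Q e) \<and>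
      (\<forall>e. (\<forall>i. e i eps J b) \<longrightarrow> (\<not> P' e) = Q' e)"
      by - (rule exI[of _ "\<lambda>e. \<not> Q e"], rule exI[of _ "\<lambda>e. \<not> Q' e"], simp add: bdd_not)
  qed
next
  case (elem_conj P P' R R')
  show ?case unfolding locally_bdd_def
  proof
    fix b assume b: "b \<in> M"
    from b elem_conj.IH(1) obtain Q Q' where 1: "bdd Q Q'" "\<forall>e. (\<forall>i. e i eps b) \<longrightarrow> P e = Q e"
      "\<forall>e. (\<forall>i. e i eps J b) \<longrightarrow> P' e = Q' e" unfolding locally_bdd_def by blast
    from b elem_conj.IH(2) obtain S S' where 2: "bdd S S'" "\<forall>e. (\<forall>i. e i eps b) \<longrightarrow> R e = S e"
      "\<forall>e. (\<forall>i. e i eps J b) \<longrightarrow> R' e = S' e" unfolding locally_bdd_def by blast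
    from 1 2 show "\<exists>Q Q'. bdd Q Q' \<and> (\<forall>e. (\<forall>i. e i eps b) \<longrightarrow> (P e \<and> R e) = Q e) \<and>
      (\<forall>e. (\<forall>i. e i eps J b) \<longrightarrow> (P' e \<and> R' e) = Q' e)"
      by - (rule exI[of _ "\<lambda>e. Q e \<and> S e"], rule exI[of _ "\<lambda>e. Q' e \<and> S' e"], simp add: bdd_conj)
  qed
next
  case (elem_ex0 P P')
  then show ?case by (rule locally_bdd_ex)
next
  case (elem_cong P P' R)
  have "R e = P e" if "\<forall>i. e i eps b" "b \<in> M" for e b
    using elem_cong(2)[of e] M_trans[OF that(2)] that(1) by blast
  with elem_cong.IH show ?case unfolding locally_bdd_def by metis
qed

theorem elementary_transfer:
  assumes P: "elem P P'" and e: "\<And>i. e i \<in> M"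
  shows "P e \<longleftrightarrow> P' (\<lambda>n. J (e n))"
proof -
  obtain P0 where P0: "definable P0" "\<And>e. (\<And>i. e i \<in> M) \<Longrightarrow> P e = P0 e"
    using elem_definable[OF P] by blast
  obtain m1 where m1: "\<forall>e e'. (\<forall>i<m1. e i = e' i) \<longrightarrow> P0 e = P0 e'"
    using definable_support[OF P0(1)] by blast
  obtain m2 where m2: "\<forall>e e'. (\<forall>i<m2. e i = e' i) \<longrightarrow> P' e = P' e'"
    using definable_support[OF elem_definable_V[OF P]] by blast
  define m where "m = Suc (max m1 m2)"
  \<comment> \<open>The relevant values are finitely many, so one \<open>b \<in> M\<close> covers
    them. The \<open>Suc\<close> in \<open>m\<close> keeps \<open>e 0\<close> among them, and
    \<open>f\<close> uses it as filler beyond \<open>m\<close>.\<close>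
  have "small (e ` {..<m})" by (rule finite_small) simp
  then obtain b where b: "b \<in> M" "\<And>x. x \<in> e ` {..<m} \<Longrightarrow> x eps b"
    by (rule covering) (use e in auto)
  define f where "f i = (if i < m then e i else e 0)" for i
  have fb: "f i eps b" for i using b(2) by (auto simp: f_def m_def)
  have fM: "f i \<in> M" for i using M_trans[OF b(1) fb] .
  have Jfb: "J (f i) eps J b" for i using J_mem_iff[OF fM b(1)] fb by simp
  obtain Q Q' where Q: "bdd Q Q'" "\<forall>e. (\<forall>i. e i eps b) \<longrightarrow> P e = Q e"
    "\<forall>e. (\<forall>i. e i eps J b) \<longrightarrow> P' e = Q' e"
    using elem_locally_bdd[OF P] b(1) unfolding locally_bdd_def by blast
  have "P e = P0 e" by (rule P0(2)[OF e])
  also have "\<dots> = P0 f" by (rule m1[rule_format]) (auto simp: f_def m_def)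
  also have "\<dots> = P f" using P0(2)[of f] fM by simp
  also have "\<dots> = Q f" using Q(2) fb by blast
  also have "\<dots> = Q' (\<lambda>n. J (f n))" by (rule bdd_transfer[OF Q(1) fM])
  also have "\<dots> = P' (\<lambda>n. J (f n))" using Q(3)[rule_format, of "\<lambda>n. J (f n)"] Jfb by simp
  also have "\<dots> = P' (\<lambda>n. J (e n))" by (rule m2[rule_format]) (auto simp: f_def m_def)
  finally show ?thesis .
qed

section \<open>Consequences of elementarity\<close>

abbreviation absolute :: "((nat \<Rightarrow> 's) \<Rightarrow> bool) \<Rightarrow> bool" where
  "absolute P \<equiv> elem P P"

named_theorems elem_rules

lemmas [elem_rules] = elem_mem elem_eq elem_not elem_conj

lemma elem_const [elem_rules]: "absolute (\<lambda>e. b)"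
  using elem_eq[of 0 0] elem_not[OF elem_eq[of 0 0]] by (cases b) simp_all

lemma elem_disj [elem_rules]: "elem P P' \<Longrightarrow> elem Q Q' \<Longrightarrow> elem (\<lambda>e. P e \<or> Q e) (\<lambda>e. P' e \<or> Q' e)"
  using elem_not[OF elem_conj[OF elem_not elem_not]] by simp

lemma elem_imp [elem_rules]: "elem P P' \<Longrightarrow> elem Q Q' \<Longrightarrow> elem (\<lambda>e. P e \<longrightarrow> Q e) (\<lambda>e. P' e \<longrightarrow> Q' e)"
  using elem_not[OF elem_conj[OF _ elem_not, of P P' Q Q']] by simp

lemma elem_iff [elem_rules]:
  assumes "elem P P'" "elem Q Q'"
  shows "elem (\<lambda>e. P e = Q e) (\<lambda>e. P' e = Q' e)"
  using elem_conj[OF elem_imp[OF assms] elem_imp[OF assms(2,1)]] by (simp add: iff_conv_conj_imp)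

lemma elem_bex [elem_rules]:
  "elem (\<lambda>e. R (e 0) (\<lambda>n. e (Suc n))) (\<lambda>e. R' (e 0) (\<lambda>n. e (Suc n))) \<Longrightarrow>
    elem (\<lambda>e. \<exists>x\<in>M. R x e) (\<lambda>e. \<exists>x\<in>UNIV. R' x e)"
  using elem_ex0[of "\<lambda>e. R (e 0) (\<lambda>n. e (Suc n))" "\<lambda>e. R' (e 0) (\<lambda>n. e (Suc n))"] by simp

lemma elem_ball [elem_rules]:
  "elem (\<lambda>e. R (e 0) (\<lambda>n. e (Suc n))) (\<lambda>e. R' (e 0) (\<lambda>n. e (Suc n))) \<Longrightarrow>
    elem (\<lambda>e. \<forall>x\<in>M. R x e) (\<lambda>e. \<forall>x\<in>UNIV. R' x e)"
  using elem_not[OF elem_bex[of "\<lambda>x e. \<not> R x e" "\<lambda>x e. \<not> R' x e"]] elem_not by simp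

text \<open>Bounded quantifiers need no relativization because \<open>M\<close> is transitive.\<close>

lemma elem_mex [elem_rules]:
  assumes "elem (\<lambda>e. R (e 0) (\<lambda>n. e (Suc n))) (\<lambda>e. R' (e 0) (\<lambda>n. e (Suc n)))"
  shows "elem (\<lambda>e. \<exists>x. x eps e k \<and> R x e) (\<lambda>e. \<exists>x. x eps e k \<and> R' x e)"
proof -
  have "elem (\<lambda>e. \<exists>x\<in>M. x eps e k \<and> R x e) (\<lambda>e. \<exists>x\<in>UNIV. x eps e k \<and> R' x e)"
    by (intro elem_rules assms)
  then have "elem (\<lambda>e. \<exists>x. x eps e k \<and> R x e) (\<lambda>e. \<exists>x\<in>UNIV. x eps e k \<and> R' x e)"
  proof (rule elem_cong)
    fix e :: "nat \<Rightarrow> 's" assume "\<And>i. e i \<in> M"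
    then have "e k \<in> M" .
    then show "(\<exists>x\<in>M. x eps e k \<and> R x e) = (\<exists>x. x eps e k \<and> R x e)" using M_trans by blast
  qed
  then show ?thesis by simp
qed

lemma elem_mall [elem_rules]:
  "elem (\<lambda>e. R (e 0) (\<lambda>n. e (Suc n))) (\<lambda>e. R' (e 0) (\<lambda>n. e (Suc n))) \<Longrightarrow>
    elem (\<lambda>e. \<forall>x. x eps e k \<longrightarrow> R x e) (\<lambda>e. \<forall>x. x eps e k \<longrightarrow> R' x e)"
  using elem_not[OF elem_mex[of "\<lambda>x e. \<not> R x e" "\<lambda>x e. \<not> R' x e" k]] elem_not by simp

lemma transfer1:
  "elem (\<lambda>e. P (e 0)) (\<lambda>e. P' (e 0)) \<Longrightarrow> x \<in> M \<Longrightarrow> P x \<longleftrightarrow> P' (J x)"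
  using elementary_transfer[of "\<lambda>e. P (e 0)" "\<lambda>e. P' (e 0)" "\<lambda>_. x"] by simp

lemma transfer3:
  assumes "elem (\<lambda>e. P (e 0) (e 1) (e 2)) (\<lambda>e. P' (e 0) (e 1) (e 2))" "x \<in> M" "y \<in> M" "z \<in> M"
  shows "P x y z \<longleftrightarrow> P' (J x) (J y) (J z)"
proof -
  have "(x ## y ## (\<lambda>_. z)) i \<in> M" for i using assms(2-4) by (intro scons_M)
  from elementary_transfer[OF assms(1), of "x ## y ## (\<lambda>_. z)", OF this] show ?thesis by (simp add: numeral_2_eq_2)
qed

lemma transfer2:
  assumes "elem (\<lambda>e. P (e 0) (e 1)) (\<lambda>e. P' (e 0) (e 1))" "x \<in> M" "y \<in> M"
  shows "P x y \<longleftrightarrow> P' (J x) (J y)"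
  using transfer3[of "\<lambda>x y z. P x y" "\<lambda>x y z. P' x y" x y y] assms by simp

lemma elem_bdd_upair [elem_rules]: "absolute (\<lambda>e. bdd_upair (e i) (e k) (e l))"
  unfolding bdd_upair_def by (intro elem_rules)

lemma elem_rel [elem_rules]: "absolute (\<lambda>e. rel (e i) (e k) (e l))"
  unfolding rel_def by (intro elem_rules)

lemma elem_Ord [elem_rules]: "absolute (\<lambda>e. Ord (e i))"
  unfolding Ord_def by (intro elem_rules)

lemma elem_sub [elem_rules]: "absolute (\<lambda>e. e i \<sqsubseteq> e k)"
  unfolding sub_def by (intro elem_rules)

lemma elem_onto [elem_rules]: "absolute (\<lambda>e. onto (e i) (e k) (e l))"
  unfolding onto_def by (intro elem_rules)

text \<open>Separation holds in \<open>V\<close> at \<open>J z\<close>, so the existence of the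
  separated set pulls back to \<open>M\<close>; its defining property, transferred once more,
  identifies \<open>J s\<close>. The conclusion is the instance at \<open>z\<close> of amenability
  of the two extensions.\<close>

lemma M_separation:
  assumes Q: "elem (\<lambda>e. Q (e 0)) (\<lambda>e. Q' (e 0))" and z: "z \<in> M"
  shows "\<exists>s\<in>M. (\<forall>x. x eps s \<longleftrightarrow> x eps z \<and> Q x) \<and> (\<forall>x. x eps J s \<longleftrightarrow> x eps J z \<and> Q' x)"
proof -
  have A: "elem (\<lambda>e. \<forall>x\<in>M. x eps e i \<longleftrightarrow> x eps e k \<and> Q x) (\<lambda>e. \<forall>x\<in>UNIV. x eps e i \<longleftrightarrow> x eps e k \<and> Q' x)"
    for i k by (intro elem_rules Q)
  have B: "elem (\<lambda>e. \<exists>s\<in>M. \<forall>x\<in>M. x eps s \<longleftrightarrow> x eps e 0 \<and> Q x)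
      (\<lambda>e. \<exists>s\<in>UNIV. \<forall>x\<in>UNIV. x eps s \<longleftrightarrow> x eps e 0 \<and> Q' x)"
    by (intro elem_rules Q)
  have "\<exists>s\<in>UNIV. \<forall>x\<in>UNIV. x eps s \<longleftrightarrow> x eps J z \<and> Q' x"
    using small_separation[OF elem_definable_V[OF Q], of "J z"] by (simp add: small_def)
  with transfer1[OF B z] obtain s where s: "s \<in> M" "\<forall>x\<in>M. x eps s \<longleftrightarrow> x eps z \<and> Q x" by blast
  then have "\<forall>x. x eps J s \<longleftrightarrow> x eps J z \<and> Q' x"
    using transfer2[OF A[of 0 1] s(1) z] by simp
  moreover have "\<forall>x. x eps s \<longleftrightarrow> x eps z \<and> Q x" using s M_trans[OF s(1)] M_trans[OF z] by blast
  ultimately show ?thesis using s(1) by blast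
qed

text \<open>The least ordinal outside \<open>M\<close> would be a subset of \<open>M\<close>, hence
  covered by some \<open>c \<in> M\<close>. The ordinals in \<open>c\<close> form a set in
  \<open>M\<close> by separation, and that set is the ordinal in question.\<close>

lemma Ord_in_M: "Ord a \<Longrightarrow> a \<in> M"
proof (rule ccontr)
  assume "Ord a" "a \<notin> M"
  moreover have "definable (\<lambda>e. e 0 \<notin> M)" by (intro def_rules)
  ultimately obtain a where a: "Ord a" "a \<notin> M" "\<And>b. b eps a \<Longrightarrow> b \<in> M"
    using Ord_least[of "\<lambda>x. x \<notin> M"] by blast
  obtain c where c: "c \<in> M" "\<And>x. x \<in> {x. x eps a} \<Longrightarrow> x eps c"
    by (rule covering[of "{x. x eps a}"]) (use a in auto)
  obtain s where s: "s \<in> M" "\<forall>x. x eps s \<longleftrightarrow> x eps c \<and> Ord x"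
    using M_separation[OF elem_Ord[of 0] c(1)] by blast
  have "x eps a" if "x eps s" for x
  proof -
    have x: "Ord x" "x \<in> M" using s that M_trans by blast+
    from Ord_linear[OF this(1) a(1)] a(2) x(2) M_trans show ?thesis by blast
  qed
  moreover have "x eps s" if "x eps a" for x
    using s(2) c(2) Ord_mem[OF a(1) that] that by blast
  ultimately have "s = a" by (intro set_eq) blast
  with s(1) a(2) show False by blast
qed

lemma Ord_J: "Ord a \<Longrightarrow> Ord (J a)"
  using transfer1[OF elem_Ord[of 0] Ord_in_M] by blast

lemma J_mem: "Ord a \<Longrightarrow> Ord b \<Longrightarrow> J a eps J b \<longleftrightarrow> a eps b"
  using J_mem_iff Ord_in_M by blast

text \<open>If \<open>a\<close> is least with \<open>J a\<close> below \<open>a\<close>, applying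
  \<open>J\<close> puts \<open>J (J a)\<close> below \<open>J a\<close>, against minimality.\<close>

lemma Ord_sub_J: "Ord a \<Longrightarrow> a \<sqsubseteq> J a"
proof (rule ccontr)
  assume "Ord a" "\<not> a \<sqsubseteq> J a"
  moreover have "definable (\<lambda>e. \<not> e 0 \<sqsubseteq> J (e 0))" by (intro def_rules)
  ultimately obtain a where a: "Ord a" "\<not> a \<sqsubseteq> J a" "\<And>b. b eps a \<Longrightarrow> b \<sqsubseteq> J b"
    using Ord_least[of "\<lambda>x. \<not> x \<sqsubseteq> J x"] by blast
  have "J a eps a" using a(1,2) Ord_not_mem_iff[OF Ord_J[OF a(1)] a(1)] by blast
  moreover from this have "J (J a) eps J a" using J_mem[OF Ord_J[OF a(1)] a(1)] by blast
  ultimately show False using a(3) subD eps_irrefl by blast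
qed

text \<open>Given \<open>z\<close> in \<open>J b\<close>, elementarity puts into \<open>M\<close> a
  map \<open>f\<close> from an ordinal \<open>a\<close> onto \<open>b\<close>. \<open>J f\<close>
  maps the same \<open>a\<close> onto \<open>J b\<close>, and its value at a fixed \<open>x\<close>
  is the image under \<open>J\<close> of the value of \<open>f\<close> at \<open>x\<close>.\<close>

lemma J_onto:
  assumes "\<And>a. Ord a \<Longrightarrow> J a = a"
  shows "\<exists>y\<in>M. z = J y"
proof -
  obtain b where b: "b \<in> M" "z eps J b" using J_cofinal by blast
  have B: "elem (\<lambda>e. \<exists>a\<in>M. \<exists>f\<in>M. Ord a \<and> onto f a (e 0)) (\<lambda>e. \<exists>a\<in>UNIV. \<exists>f\<in>UNIV. Ord a \<and> onto f a (e 0))"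
    by (intro elem_rules)
  have "\<exists>a\<in>UNIV. \<exists>f\<in>UNIV. Ord a \<and> onto f a (J b)" using ex_ordinal_surj by simp
  with transfer1[OF B b(1)] obtain a f where f: "a \<in> M" "f \<in> M" "onto f a b"
    and a: "Ord a" "J a = a" using assms by blast
  have s: "onto (J f) a (J b)" using transfer3[OF elem_onto[of 0 1 2] f(2,1) b(1)] f(3) a(2) by simp
  with b(2) obtain x where x: "x eps a" "rel (J f) x z" unfolding onto_def by blast
  have xO: "Ord x" using Ord_mem[OF a(1) x(1)] .
  have xM: "x \<in> M" "J x = x" using Ord_in_M[OF xO] assms[OF xO] by auto
  have E: "absolute (\<lambda>e. \<exists>y. y eps e 0 \<and> rel (e 1) (e 2) y)"
    by (intro elem_rules)
  from transfer3[OF E b(1) f(2) xM(1)] xM(2) x(2) b(2) obtain y where y: "y eps b" "rel f x y" by auto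
  have yM: "y \<in> M" using M_trans b(1) y(1) by blast
  have "rel (J f) x (J y)" using transfer3[OF elem_rel[of 0 1 2] f(2) xM(1) yM] y(2) xM(2) by simp
  moreover have "J y eps J b" using J_mem_iff[OF yM b(1)] y(1) by simp
  ultimately have "z = J y" using s x b(2) unfolding onto_def by blast
  with yM show ?thesis by blast
qed

lemma ex_moved:
  assumes "nontrivial E j M UNIV"
  shows "\<exists>a. Ord a \<and> J a \<noteq> a"
proof (rule ccontr)
  assume "\<not> ?thesis"
  then have onto: "\<exists>y\<in>M. z = J y" for z using J_onto by blast
  have fix_J: "w \<in> M \<longrightarrow> J w = w" for w
  proof (rule eps_induct[of "\<lambda>w. w \<in> M \<longrightarrow> J w = w"], intro def_rules, rule impI)
    fix w assume IH: "\<And>y. y eps w \<Longrightarrow> y \<in> M \<longrightarrow> J y = y" and w: "w \<in> M"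
    show "J w = w"
    proof (rule set_eq)
      fix z
      obtain y where y: "y \<in> M" "z = J y" using onto by blast
      show "z eps J w \<longleftrightarrow> z eps w"
      proof
        assume "z eps J w"
        then have "y eps w" using J_mem_iff[OF y(1) w] y(2) by simp
        with IH[OF this] y show "z eps w" by simp
      next
        assume z: "z eps w"
        then have "z \<in> M" "J z = z" using IH[OF z] M_trans[OF w z] by auto
        with J_mem_iff[of z w] w z show "z eps J w" by simp
      qed
    qed
  qed
  have "z \<in> M" for z using onto[of z] fix_J by metis
  then have "M = UNIV" by blast
  with fix_J assms show False unfolding nontrivial_def maps_to_iff opair_j_iff by simp
qed

text \<open>Lets truth in a class be transferred. It is applied with
  \<open>M\<^sub>n\<^sub>+\<^sub>1\<close> on the side of \<open>M\<close> and
  \<open>M\<^sub>n\<close> on the side of \<open>V\<close>.\<close>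

lemma elem_sat:
  assumes "X \<in> \<C>" "X' \<in> \<C>" "amenable X X'" "X \<subseteq> M"
  shows "elem (\<lambda>e. sat E X C0 e \<phi>) (\<lambda>e. sat E X' C0 e \<phi>)"
proof (induction \<phi>)
  case (Exists i \<phi>)
  let ?f = "\<lambda>n. if n = i then 0 else Suc n"
  have "(\<lambda>n. (x ## e) (?f n)) = e(i := x)" for x and e :: "nat \<Rightarrow> 's"
    by (rule ext) simp
  with elem_ex0[OF elem_conj[OF elem_class[OF assms(1-3), of 0] elem_rename[OF Exists, of ?f]]]
  have "elem (\<lambda>e. \<exists>x\<in>M. x \<in> X \<and> sat E X C0 (e(i := x)) \<phi>)
     (\<lambda>e. \<exists>x. x \<in> X' \<and> sat E X' C0 (e(i := x)) \<phi>)" by simp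
  moreover have "(\<exists>x\<in>M. x \<in> X \<and> Q x) \<longleftrightarrow> (\<exists>x\<in>X. Q x)" "(\<exists>x. x \<in> X' \<and> Q x) \<longleftrightarrow> (\<exists>x\<in>X'. Q x)" for Q
    using assms(4) by blast+
  ultimately show ?case by simp
next
  case (ClassMem i k)
  show ?case using elem_const[of False] by simp
next
  case (Mem i k)
  show ?case using elem_mem by simp
next
  case (Eq i k)
  show ?case using elem_eq by simp
next
  case (Neg \<phi>)
  show ?case using elem_not[OF Neg] by simp
next
  case (Conj \<phi> \<psi>)
  show ?case using elem_conj[OF Conj] by simp
qed

end

context NGBC
begin

section \<open>The iterates of the embedding\<close>

lemma definable_update: "definable P \<Longrightarrow> definable (\<lambda>e. \<exists>x. P (e(i := x)))"
proof -
  assume P: "definable P"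
  let ?f = "\<lambda>n. if n = i then 0 else Suc n"
  have "(\<lambda>n. (x ## e) (?f n)) = e(i := x)" for x and e :: "nat \<Rightarrow> 's"
    by (rule ext) simp
  with definable_ex0[OF definable_rename[OF P, of ?f]] show ?thesis by simp
qed

text \<open>The formula is fixed in the metatheory, so truth of it in a class given by a parameter
  is one definable predicate. This permits internal induction on the index of the iterate.\<close>

lemma definable_sat_relativized:
  assumes R: "definable (\<lambda>e. R (e 0) (e 1))"
  shows "definable (\<lambda>e. sat E {y. R (e 0) y} (\<lambda>_. {}) (\<lambda>n. e (Suc n)) \<phi>)"
proof (induction \<phi>)
  case (Exists i \<phi>)
  have "definable (\<lambda>e. R (e 0) (e (Suc i)) \<and> sat E {y. R (e 0) y} (\<lambda>_. {}) (\<lambda>n. e (Suc n)) \<phi>)"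
    by (intro definable_conj Exists def_app2[OF R] def_term_var)
  from definable_update[OF this, of "Suc i"] show ?case
    by (simp add: fun_upd_def Bex_def)
next
  case (ClassMem i k)
  show ?case using definable_const[of False] by simp
qed (simp_all add: definable_mem0 definable_eq0 definable_not definable_conj)

end

context embedding
begin

definition J_image :: "'s \<Rightarrow> 's" where
  "J_image X = set_of {z. \<exists>y. y eps X \<and> y \<in> M \<and> z = J y}"

lemma mem_J_image: "z eps J_image X \<longleftrightarrow> (\<exists>y. y eps X \<and> y \<in> M \<and> z = J y)"
proof -
  have "definable (\<lambda>e. e 0 \<in> M \<and> e 1 = J (e 0))" by (intro def_rules)
  from small_replacement[of "\<lambda>y z. y \<in> M \<and> z = J y", OF this, of X] show ?thesis
    by (simp add: J_image_def)
qed

lemma class_graph_J_image: "class_graph J_image"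
  unfolding J_image_def by (intro def_rules)

text \<open>\<open>trace x n = {x, J x, \<dots>, J\<^sup>n x}\<close>, as far as these are defined.\<close>

definition trace :: "'s \<Rightarrow> 's \<Rightarrow> 's" where
  "trace x n = trec J_image (upair x x) n"

lemma def_term_trace [def_rules]: "def_term t \<Longrightarrow> def_term s \<Longrightarrow> def_term (\<lambda>e. trace (t e) (s e))"
  unfolding trace_def by (intro def_rules def_term_trec class_graph_J_image)

lemma trace_empty: "z eps trace x empty \<longleftrightarrow> z = x"
  by (simp add: trace_def trec_empty[OF class_graph_J_image])

lemma trace_self: "Nat k \<Longrightarrow> x eps trace x k"
  by (simp add: trace_def mem_trec[OF class_graph_J_image Nat_Ord])

lemma trace_suc: "Nat k \<Longrightarrow> z eps trace x (suc k) \<longleftrightarrow> z eps trace x k \<or> z eps J_image (trace x k)"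
  by (simp only: trace_def trec_suc[OF class_graph_J_image Nat_Ord])

text \<open>The recursion appends the last step, whereas transfer along \<open>J\<close> needs the
  first step split off; this converts one unrolling into the other.\<close>

lemma trace_shift:
  assumes x: "x \<in> M" and k: "Nat k"
  shows "\<forall>z. z eps trace x (suc k) \<longleftrightarrow> z = x \<or> z eps trace (J x) k"
proof (rule Nat_induct[of "\<lambda>k. \<forall>z. z eps trace x (suc k) \<longleftrightarrow> z = x \<or> z eps trace (J x) k", OF _ k])
  show "definable (\<lambda>e. \<forall>z. z eps trace x (suc (e 0)) \<longleftrightarrow> z = x \<or> z eps trace (J x) (e 0))"
    by (intro def_rules)
  show "\<forall>z. z eps trace x (suc empty) \<longleftrightarrow> z = x \<or> z eps trace (J x) empty"
    using x by (auto simp: trace_suc trace_empty mem_J_image)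
next
  fix k assume k: "Nat k" and IH: "\<forall>z. z eps trace x (suc k) \<longleftrightarrow> z = x \<or> z eps trace (J x) k"
  have "z eps J_image (trace x (suc k)) \<longleftrightarrow> z = J x \<or> z eps J_image (trace (J x) k)" for z
    using IH x by (auto simp: mem_J_image)
  then show "\<forall>z. z eps trace x (suc (suc k)) \<longleftrightarrow> z = x \<or> z eps trace (J x) (suc k)"
    using IH k trace_self[OF k, of "J x"] trace_suc[OF k, of _ "J x"] trace_suc[OF Nat_suc[OF k], of _ x]
    by auto
qed

text \<open>The domain of the \<open>n\<close>-fold iterate of \<open>J\<close>, for a natural number \<open>n\<close> of the model.\<close>

definition iter_dom :: "'s \<Rightarrow> 's \<Rightarrow> bool" where
  "iter_dom n x \<longleftrightarrow> (\<forall>k. k eps n \<longrightarrow> (\<forall>y. y eps trace x k \<longrightarrow> y \<in> M))"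

lemma definable_iter_dom [def_rules]: "def_term t \<Longrightarrow> def_term s \<Longrightarrow> definable (\<lambda>e. iter_dom (t e) (s e))"
  by (rule def_app2) (unfold iter_dom_def, intro def_rules)

lemma iter_dom_empty [simp]: "iter_dom empty x"
  by (simp add: iter_dom_def)

lemma iter_dom_suc:
  assumes n: "Nat n"
  shows "iter_dom (suc n) x \<longleftrightarrow> x \<in> M \<and> iter_dom n (J x)"
proof
  assume *: "iter_dom (suc n) x"
  have "empty eps suc n" using Ord_linear[OF Ord_empty Nat_Ord[OF n]] by auto
  with * trace_empty have x: "x \<in> M" unfolding iter_dom_def by blast
  have "y \<in> M" if k: "k eps n" and y: "y eps trace (J x) k" for k y
  proof -
    have "suc k eps suc n"
    proof -
      have "Ord k" "Ord n" using n k Nat_Ord Nat_mem by blast+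
      from Ord_linear[OF Ord_suc[OF this(1)] Ord_suc[OF this(2)]] k show ?thesis
        using eps_asym[of k n] Ord_trans[OF \<open>Ord k\<close>, of n "suc n"] by (auto dest: suc_inject)
    qed
    moreover have "y eps trace x (suc k)" using trace_shift[OF x Nat_mem[OF n k]] y by blast
    ultimately show ?thesis using * unfolding iter_dom_def by blast
  qed
  then show "x \<in> M \<and> iter_dom n (J x)" using x unfolding iter_dom_def by blast
next
  assume *: "x \<in> M \<and> iter_dom n (J x)"
  have "y \<in> M" if k: "k eps suc n" and y: "y eps trace x k" for k y
  proof -
    have "Nat k" using Nat_mem[OF Nat_suc[OF n] k] .
    then consider "k = empty" | l where "Nat l" "k = suc l" using Nat_cases by blast
    then show ?thesis
    proof cases
      case 1
      with y * show ?thesis by (simp add: trace_empty)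
    next
      case 2
      then have "l eps n" using k Ord_trans[OF Nat_Ord[OF n], of l k] by auto
      moreover have "y = x \<or> y eps trace (J x) l" using trace_shift[of x l] * 2 y by blast
      ultimately show ?thesis using * unfolding iter_dom_def by blast
    qed
  qed
  then show "iter_dom (suc n) x" unfolding iter_dom_def by blast
qed

end

locale definable_embedding = embedding E \<C> M j
  for E :: "'s \<Rightarrow> 's \<Rightarrow> bool" and \<C> :: "'s set set" and M j :: "'s set" +
  fixes \<phi> :: fm
  assumes M_def: "M = {x. sat E UNIV (\<lambda>_. {}) (\<lambda>_. x) \<phi>}"
begin

notation E (infix "eps" 50)

text \<open>The two clauses support each other: amenability lets \<open>J\<close> transfer truth of
  \<open>\<phi>\<close> in the iterates, which defines the next domain in the current one, and
  separation by that definition yields the next amenability.\<close>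

definition iter_ok :: "'s \<Rightarrow> bool" where
  "iter_ok n \<longleftrightarrow> (\<forall>x. iter_dom (suc n) x \<longleftrightarrow> iter_dom n x \<and> sat E {y. iter_dom n y} C0 (\<lambda>_. x) \<phi>) \<and>
    amenable {x. iter_dom (suc n) x} {x. iter_dom n x}"

lemma definable_iter_ok: "definable (\<lambda>e. iter_ok (e 0))"
proof -
  have "definable (\<lambda>e. iter_dom (e 0) (e 1))" by (intro def_rules)
  from definable_rename[OF definable_sat_relativized[OF this, of \<phi>], of "\<lambda>n. if n = 0 then 1 else 0"]
  have "definable (\<lambda>e. sat E {y. iter_dom (e 1) y} C0 (\<lambda>_. e 0) \<phi>)" by simp
  then have 1: "definable (\<lambda>e. sat E {y. iter_dom (e (Suc 0)) y} C0 (\<lambda>_. e 0) \<phi>)" by simp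
  show ?thesis unfolding iter_ok_def amenable_def mem_Collect_eq by (intro def_rules 1)
qed

lemma iter_dom_class: "{x. iter_dom n x} \<in> \<C>"
  by (intro definable_class def_rules)

lemma iter_ok:
  assumes "Nat n"
  shows "iter_ok n"
proof (rule Nat_induct[of iter_ok, OF definable_iter_ok assms])
  have 0: "{x. iter_dom empty x} = UNIV" by simp
  have 1: "iter_dom (suc empty) x \<longleftrightarrow> x \<in> M" for x using iter_dom_suc[OF Nat_empty] by simp
  have 2: "x \<in> M \<longleftrightarrow> sat E UNIV C0 (\<lambda>_. x) \<phi>" for x by (subst M_def) simp
  have "amenable M UNIV" unfolding amenable_def using M_trans by blast
  then show "iter_ok empty"
    unfolding iter_ok_def 0 1 by (simp add: 2[symmetric])
next
  fix n assume n: "Nat n" and IH: "iter_ok n"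
  let ?X = "{x. iter_dom (suc n) x}" and ?X' = "{x. iter_dom n x}"
  let ?Q = "\<lambda>x. x \<in> ?X \<and> sat E ?X C0 (\<lambda>_. x) \<phi>"
  let ?Q' = "\<lambda>x. x \<in> ?X' \<and> sat E ?X' C0 (\<lambda>_. x) \<phi>"
  have amenable: "amenable ?X ?X'" and Q': "iter_dom (suc n) x \<longleftrightarrow> ?Q' x" for x
    using IH by (auto simp: iter_ok_def)
  have XM: "?X \<subseteq> M" using iter_dom_suc[OF n] by auto
  have "elem (\<lambda>e. sat E ?X C0 (\<lambda>_. e 0) \<phi>) (\<lambda>e. sat E ?X' C0 (\<lambda>_. e 0) \<phi>)"
    using elem_rename[OF elem_sat[OF iter_dom_class iter_dom_class amenable XM, of \<phi>], of "\<lambda>_. 0"] .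
  then have EQ: "elem (\<lambda>e. ?Q (e 0)) (\<lambda>e. ?Q' (e 0))"
    by (intro elem_rules elem_class[OF iter_dom_class iter_dom_class amenable])
  \<comment> \<open>\<open>?Q'\<close> defines the domain \<open>M\<^sub>n\<^sub>+\<^sub>1\<close>
    in \<open>V\<close>. Its counterpart \<open>?Q\<close> in \<open>M\<close> thus says that
    \<open>J x\<close> lies there, which is membership of \<open>x\<close> in the next
    domain.\<close>
  have "?Q x \<longleftrightarrow> iter_dom (suc n) (J x)" if "x \<in> M" for x
    using transfer1[OF EQ that] Q' by simp
  then have Q: "iter_dom (suc (suc n)) x \<longleftrightarrow> ?Q x" for x
    using iter_dom_suc[OF Nat_suc[OF n], of x] XM by blast
  then have "\<forall>x. iter_dom (suc (suc n)) x \<longleftrightarrow> iter_dom (suc n) x \<and> sat E ?X C0 (\<lambda>_. x) \<phi>" by simp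
  moreover have "amenable {x. iter_dom (suc (suc n)) x} ?X"
    using M_separation[OF EQ] unfolding amenable_def mem_Collect_eq Q Q' by simp
  ultimately show "iter_ok (suc n)" unfolding iter_ok_def by (rule conjI)
qed

lemma elem_iter_dom: "Nat n \<Longrightarrow> elem (\<lambda>e. e i \<in> {x. iter_dom (suc n) x}) (\<lambda>e. e i \<in> {x. iter_dom n x})"
  by (rule elem_class[OF iter_dom_class iter_dom_class]) (use iter_ok iter_ok_def in blast)

text \<open>
  If \<open>\<gamma>\<^sub>n\<close> is the least ordinal whose \<open>\<Sigma>\<^sub>1\<close> property has a witness in \<open>M\<^sub>n\<close> but not in
  \<open>M\<^sub>n\<^sub>+\<^sub>1\<close>, then \<open>J \<gamma>\<^sub>n\<^sub>+\<^sub>1 = \<gamma>\<^sub>n\<close>, so \<open>\<gamma>\<^sub>n\<^sub>+\<^sub>1 \<le> \<gamma>\<^sub>n\<close>; the two are distinct, and the ordinals would descend.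
\<close>

lemma witness_in_M:
  assumes \<Theta>: "absolute (\<lambda>e. \<Theta> (e 0) (e 1) (e 2))"
    and g: "Ord g" "\<Theta> a f g"
  shows "\<exists>a\<in>M. \<exists>f\<in>M. \<Theta> a f g"
proof (rule ccontr)
  assume no: "\<not> ?thesis"
  define W where "W n g \<longleftrightarrow> (\<exists>a f. iter_dom n a \<and> iter_dom n f \<and> \<Theta> a f g)" for n g
  define K where "K n g \<longleftrightarrow> Ord g \<and> W n g \<and> \<not> W (suc n) g" for n g
  note D\<Theta> = def_app3[OF elem_definable_V[OF \<Theta>]]
  have DW: "definable (\<lambda>e. W (t e) (s e))" if "def_term t" "def_term s" for t s
    by (rule def_app2[OF _ that]) (unfold W_def, intro def_rules D\<Theta>)
  have DK: "definable (\<lambda>e. K (t e) (s e))" if "def_term t" "def_term s" for t s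
    by (rule def_app2[OF _ that]) (unfold K_def, intro def_rules DW)
  have EW: "elem (\<lambda>e. W (suc n) (e i)) (\<lambda>e. W n (e i))" if n: "Nat n" for n i
  proof -
    have \<Theta>': "absolute (\<lambda>e. \<Theta> (e (Suc 0)) (e 0) (e (Suc (Suc i))))"
      using elem_rename[OF \<Theta>, of "\<lambda>n. if n = 0 then Suc 0 else if n = 1 then 0 else Suc (Suc i)"] by simp
    have "elem (\<lambda>e. \<exists>a\<in>M. \<exists>f\<in>M. a \<in> {x. iter_dom (suc n) x} \<and> f \<in> {x. iter_dom (suc n) x} \<and> \<Theta> a f (e i))
      (\<lambda>e. \<exists>a\<in>UNIV. \<exists>f\<in>UNIV. a \<in> {x. iter_dom n x} \<and> f \<in> {x. iter_dom n x} \<and> \<Theta> a f (e i))"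
      by (intro elem_rules elem_iter_dom[OF n] \<Theta>')
    moreover have "(\<exists>a\<in>M. \<exists>f\<in>M. a \<in> {x. iter_dom (suc n) x} \<and> f \<in> {x. iter_dom (suc n) x} \<and> \<Theta> a f g) \<longleftrightarrow> W (suc n) g" for g
      using iter_dom_suc[OF n] unfolding W_def by blast
    moreover have "(\<exists>a\<in>UNIV. \<exists>f\<in>UNIV. a \<in> {x. iter_dom n x} \<and> f \<in> {x. iter_dom n x} \<and> \<Theta> a f g) \<longleftrightarrow> W n g" for g
      unfolding W_def by blast
    ultimately show ?thesis by simp
  qed
  have EK: "elem (\<lambda>e. K (suc n) (e i)) (\<lambda>e. K n (e i))" if "Nat n" for n i
    unfolding K_def by (intro elem_rules EW that Nat_suc)
  have "\<not> W (suc empty) g" using no iter_dom_suc[OF Nat_empty] by (auto simp: W_def)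
  moreover have "W empty g" using g by (auto simp: W_def)
  ultimately have "K empty g" using g by (simp add: K_def)
  then have "\<exists>n. Nat n \<and> K n g" using Nat_empty by blast
  moreover have "definable (\<lambda>e. \<exists>n. Nat n \<and> K n (e 0))" by (intro def_rules DK)
  \<comment> \<open>The descending sequence is not built: \<open>c\<close> is minimal over all
    indices at once, and the disagreement one index further turns out to occur at the same ordinal,
    which is contradictory.\<close>
  ultimately obtain c where c: "Ord c" "\<exists>n. Nat n \<and> K n c" "\<forall>d. Ord d \<longrightarrow> (\<exists>n. Nat n \<and> K n d) \<longrightarrow> c \<sqsubseteq> d"
    using Ord_least[of "\<lambda>d. \<exists>n. Nat n \<and> K n d" g] g(1) by blast
  then obtain n where n: "Nat n" "K n c" by blast
  have "elem (\<lambda>e. \<exists>d\<in>M. K (suc n) d) (\<lambda>e. \<exists>d\<in>UNIV. K n d)" by (intro elem_rules EK n(1))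
  from transfer1[OF this Ord_in_M[OF Ord_empty]] n(2) obtain d where "K (suc n) d" by blast
  moreover from this have "Ord d" by (simp add: K_def)
  moreover have "definable (\<lambda>e. K (suc n) (e 0))" by (intro def_rules DK)
  ultimately obtain m where m: "Ord m" "K (suc n) m" "\<forall>d. d eps m \<longrightarrow> \<not> K (suc n) d"
    using Ord_least[of "K (suc n)" d] by blast
  have "elem (\<lambda>e. \<forall>d. d eps e 0 \<longrightarrow> \<not> K (suc n) d) (\<lambda>e. \<forall>d. d eps e 0 \<longrightarrow> \<not> K n d)"
    by (intro elem_rules EK n(1))
  from transfer1[OF this Ord_in_M[OF m(1)]] m(3) have Jm: "\<forall>d. d eps J m \<longrightarrow> \<not> K n d" by simp
  have "K n (J m)" using transfer1[OF EK[OF n(1), of 0] Ord_in_M[OF m(1)]] m(2) by simp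
  with c(3) n(1) Ord_J[OF m(1)] have "c \<sqsubseteq> J m" by blast
  moreover have "J m \<sqsubseteq> c" using Jm n(2) Ord_not_mem_iff[OF c(1) Ord_J[OF m(1)]] by blast
  ultimately have "J m = c" by (intro sub_antisym)
  then have "m \<sqsubseteq> c" using Ord_sub_J[OF m(1)] by simp
  moreover have "c \<sqsubseteq> m" using c(3) m(1,2) n(1) Nat_suc by blast
  ultimately have "m = c" by (rule sub_antisym)
  with m(2) n(2) show False by (simp add: K_def)
qed

end

context NGBC
begin

section \<open>Regular ordinals\<close>

definition cart :: "'s \<Rightarrow> 's \<Rightarrow> 's" where
  "cart A B = set_of {p. \<exists>a. a eps A \<and> (\<exists>b. b eps B \<and> p = opair a b)}"

definition subrel :: "'s \<Rightarrow> 's \<Rightarrow> ('s \<Rightarrow> 's \<Rightarrow> bool) \<Rightarrow> 's" where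
  "subrel A B R = set_of {p. \<exists>a. a eps A \<and> (\<exists>b. b eps B \<and> p = opair a b \<and> R a b)}"

lemma mem_cart: "p eps cart A B \<longleftrightarrow> (\<exists>a. a eps A \<and> (\<exists>b. b eps B \<and> p = opair a b))"
proof -
  have "class_graph (\<lambda>b. opair a b)" for a by (intro def_rules)
  from small_image[OF this, of B] have 1: "p eps set_of {p. \<exists>b. b eps B \<and> p = opair a b} \<longleftrightarrow> (\<exists>b. b eps B \<and> p = opair a b)"
    for p a by simp
  have "class_graph (\<lambda>a. set_of {p. \<exists>b. b eps B \<and> p = opair a b})" by (intro def_rules)
  from small_UN[OF this, of A] have "small {p. \<exists>a. a eps A \<and> (\<exists>b. b eps B \<and> p = opair a b)}"
    unfolding 1 .
  then show ?thesis by (simp add: cart_def)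
qed

lemma def_term_cart [def_rules]: "def_term t \<Longrightarrow> def_term s \<Longrightarrow> def_term (\<lambda>e. cart (t e) (s e))"
  by (rule def_term_app2) (unfold cart_def, intro def_rules)

lemma mem_subrel:
  assumes "definable (\<lambda>e. R (e 0) (e 1))"
  shows "p eps subrel A B R \<longleftrightarrow> (\<exists>a. a eps A \<and> (\<exists>b. b eps B \<and> p = opair a b \<and> R a b))"
proof -
  have "definable (\<lambda>e. \<exists>a. a eps A \<and> (\<exists>b. b eps B \<and> e 0 = opair a b \<and> R a b))"
    by (intro def_rules def_app2[OF assms])
  from small_subset[of "\<lambda>p. \<exists>a. a eps A \<and> (\<exists>b. b eps B \<and> p = opair a b \<and> R a b)", OF this, of "cart A B"]
  have "small {p. \<exists>a. a eps A \<and> (\<exists>b. b eps B \<and> p = opair a b \<and> R a b)}"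
    using mem_cart by blast
  then show ?thesis by (simp add: subrel_def)
qed

lemma rel_subrel:
  assumes "definable (\<lambda>e. R (e 0) (e 1))"
  shows "rel (subrel A B R) a b \<longleftrightarrow> a eps A \<and> b eps B \<and> R a b"
  unfolding rel_iff mem_subrel[OF assms] by auto

lemma subrel_sub: "definable (\<lambda>e. R (e 0) (e 1)) \<Longrightarrow> subrel A B R \<sqsubseteq> cart A B"
  unfolding sub_def mem_subrel mem_cart by blast

text \<open>The bound \<open>u eps y\<close> is strict, so a successor ordinal has no cofinal map,
  while the empty set has one vacuously.\<close>

definition cofinal :: "'s \<Rightarrow> 's \<Rightarrow> 's \<Rightarrow> bool" where
  "cofinal f a g \<longleftrightarrow> (\<forall>x. x eps a \<longrightarrow> (\<forall>y. y eps g \<longrightarrow> (\<forall>z. z eps g \<longrightarrow> rel f x y \<longrightarrow> rel f x z \<longrightarrow> y = z))) \<and>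
     (\<forall>u. u eps g \<longrightarrow> (\<exists>x. x eps a \<and> (\<exists>y. y eps g \<and> rel f x y \<and> u eps y)))"

definition limit :: "'s \<Rightarrow> bool" where
  "limit g \<longleftrightarrow> (\<forall>x. x eps g \<longrightarrow> (\<exists>y. y eps g \<and> x eps y))"

text \<open>The conjunct \<open>x = x\<close> gives nonemptiness the shape of a bounded quantifier
  to which the transfer rules apply.\<close>

definition is_omega :: "'s \<Rightarrow> bool" where
  "is_omega w \<longleftrightarrow> Ord w \<and> (\<exists>x. x eps w \<and> x = x) \<and> limit w \<and> (\<forall>x. x eps w \<longrightarrow> zero_or_suc x)"

text \<open>
  Singularity and countable cofinality, relativized to a class \<open>N\<close> so that they can be compared
  between \<open>M\<close> and \<open>V\<close>.
\<close>

definition singular :: "'s set \<Rightarrow> 's \<Rightarrow> bool" where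
  "singular N g \<longleftrightarrow> (\<exists>a\<in>N. \<exists>f\<in>N. a eps g \<and> cofinal f a g)"

definition cof_omega :: "'s set \<Rightarrow> 's \<Rightarrow> bool" where
  "cof_omega N g \<longleftrightarrow> (\<exists>w\<in>N. \<exists>f\<in>N. is_omega w \<and> cofinal f w g)"

definition regular :: "'s \<Rightarrow> bool" where
  "regular d \<longleftrightarrow> Ord d \<and> limit d \<and> \<not> singular UNIV d"

lemma definable_cofinal [def_rules]: "def_term t \<Longrightarrow> def_term s \<Longrightarrow> def_term r \<Longrightarrow> definable (\<lambda>e. cofinal (t e) (s e) (r e))"
  by (rule def_app3) (unfold cofinal_def, intro def_rules)

lemma definable_is_omega [def_rules]: "def_term t \<Longrightarrow> definable (\<lambda>e. is_omega (t e))"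
  by (rule def_app1) (unfold is_omega_def limit_def zero_or_suc_def, intro def_rules)

lemma definable_cof_omega [def_rules]: "def_term t \<Longrightarrow> definable (\<lambda>e. cof_omega UNIV (t e))"
  by (rule def_app1) (unfold cof_omega_def, intro def_rules)

lemma limit_suc: "Ord g \<Longrightarrow> limit g \<Longrightarrow> x eps g \<Longrightarrow> suc x eps g"
proof -
  assume g: "Ord g" "limit g" and x: "x eps g"
  then obtain y where y: "y eps g" "x eps y" unfolding limit_def by blast
  have o: "Ord x" "Ord y" using g(1) x y(1) Ord_mem by blast+
  have "\<not> y eps suc x" using y(2) eps_asym by auto
  then have "suc x eps y \<or> suc x = y" using Ord_linear[OF o(2) Ord_suc[OF o(1)]] by auto
  then show ?thesis using y(1) Ord_trans[OF g(1)] by blast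
qed

lemma is_omega_iff: "is_omega w \<longleftrightarrow> w = omega"
proof
  assume w: "is_omega w"
  then have Ow: "Ord w" and lw: "limit w" and zw: "\<And>x. x eps w \<Longrightarrow> zero_or_suc x" and ne: "\<exists>x. x eps w"
    unfolding is_omega_def by blast+
  have "Nat x" if "x eps w" for x
    unfolding Nat_def using Ord_mem[OF Ow that] zw[OF that] zw Ord_trans[OF Ow _ that] by blast
  moreover have "x eps w" if "Nat x" for x
  proof (rule Nat_induct[of "\<lambda>x. x eps w", OF _ that])
    show "definable (\<lambda>e. e 0 eps w)" by (intro def_rules)
    show "empty eps w"
    proof -
      from ne obtain x where x: "x eps w" by blast
      with Ord_linear[OF Ord_empty Ow] show ?thesis by auto
    qed
    show "suc n eps w" if "n eps w" for n using limit_suc[OF Ow lw that] .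
  qed
  ultimately show "w = omega" by (intro set_eq) auto
next
  have "limit omega" unfolding limit_def
  proof (intro allI impI)
    fix x assume "x eps omega"
    then show "\<exists>y. y eps omega \<and> x eps y" by (intro exI[of _ "suc x"]) simp
  qed
  moreover have "zero_or_suc x" if "x eps omega" for x using that by (simp add: Nat_def)
  moreover have "\<exists>x. x eps omega \<and> x = x" by (rule exI[of _ empty]) simp
  ultimately show "w = omega \<Longrightarrow> is_omega w" by (auto simp: is_omega_def)
qed

lemma cof_omega_iff: "cof_omega UNIV g \<longleftrightarrow> (\<exists>f. cofinal f omega g)"
  by (simp add: cof_omega_def is_omega_iff)

lemma cofinal_limit: "cofinal f a g \<Longrightarrow> limit g"
  unfolding cofinal_def limit_def by blast

lemma cofinal_graph:
  assumes "class_graph F" "\<And>u. u eps g \<Longrightarrow> \<exists>x. x eps a \<and> F x eps g \<and> u eps F x"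
  shows "cofinal (graph a F) a g"
proof -
  have 1: "rel (graph a F) x y \<longleftrightarrow> x eps a \<and> y = F x" for x y
    using mem_graph[OF assms(1)] by (auto simp: rel_iff)
  have "\<exists>x. x eps a \<and> (\<exists>y. y eps g \<and> (x eps a \<and> y = F x) \<and> u eps y)" if "u eps g" for u
    using assms(2)[OF that] by blast
  then show ?thesis unfolding cofinal_def 1 by simp
qed

text \<open>Otherwise the values of \<open>F\<close> inside \<open>d\<close> would form a cofinal
  map from \<open>a\<close>. Values outside \<open>d\<close> are ignored, so \<open>F\<close> may be
  total on the universe.\<close>

lemma regular_bound:
  assumes d: "regular d" and F: "class_graph F" and a: "a eps d"
  shows "\<exists>u. u eps d \<and> (\<forall>x. x eps a \<longrightarrow> F x eps d \<longrightarrow> F x eps u)"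
proof (rule ccontr)
  assume no: "\<not> ?thesis"
  have Od: "Ord d" and ld: "limit d" using d by (auto simp: regular_def)
  have "\<exists>x. x eps a \<and> F x eps d \<and> u eps F x" if u: "u eps d" for u
  proof -
    have su: "suc u eps d" by (rule limit_suc[OF Od ld u])
    with no obtain x where x: "x eps a" "F x eps d" "\<not> F x eps suc u" by blast
    have "suc u \<sqsubseteq> F x"
      using x(3) Ord_not_mem_iff[OF Ord_mem[OF Od x(2)] Ord_mem[OF Od su]] by blast
    then have "u eps F x" by (simp add: sub_def)
    with x show ?thesis by blast
  qed
  from cofinal_graph[OF F this] have "singular UNIV d" unfolding singular_def using a by blast
  with d show False by (simp add: regular_def)
qed

text \<open>Cantor's diagonal argument replaces Hartogs' construction: some ordinal \<open>t\<close>
  maps onto the power set of \<open>X\<close>, so a map from \<open>X\<close> onto \<open>t\<close>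
  would compose to one from \<open>X\<close> onto its power set.\<close>

lemma ex_not_image: "\<exists>t. Ord t \<and> \<not> (\<exists>f. onto f X t)"
proof -
  obtain t g where t: "Ord t" and g: "onto g t (power X)" using ex_ordinal_surj by blast
  have "\<not> onto f X t" for f
  proof
    assume f: "onto f X t"
    let ?P = "\<lambda>x. \<exists>u. u eps t \<and> (\<exists>Y. Y \<sqsubseteq> X \<and> rel f x u \<and> rel g u Y \<and> \<not> x eps Y)"
    have "definable (\<lambda>e. ?P (e 0))" by (intro def_rules)
    from small_separation[OF this, of X] obtain D where D: "\<And>x. x eps D \<longleftrightarrow> x eps X \<and> ?P x"
      by (auto simp: small_def)
    then have DX: "D \<sqsubseteq> X" by (auto simp: sub_def)
    then obtain u where u: "u eps t" "rel g u D" using g unfolding onto_def by auto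
    then obtain x where x: "x eps X" "rel f x u" using f unfolding onto_def by blast
    have "Y = D" if "rel g u Y" "Y \<sqsubseteq> X" for Y
      using g u that DX unfolding onto_def by simp
    moreover have "v = u" if "v eps t" "rel f x v" for v
      using f x u(1) that unfolding onto_def by blast
    ultimately have "?P x \<longleftrightarrow> \<not> x eps D" using x u DX by blast
    with D x(1) show False by blast
  qed
  with t show ?thesis by blast
qed

text \<open>Replaces cardinal arithmetic: since pairs from \<open>X\<close> are elements of
  \<open>X\<close>, a map defined on pairs is already one on \<open>X\<close>.\<close>

lemma ex_pair_closed: "\<exists>X. l \<sqsubseteq> X \<and> (\<forall>x y. x eps X \<longrightarrow> y eps X \<longrightarrow> opair x y eps X)"
proof -
  have cH: "class_graph (\<lambda>Y. cart Y Y)" by (intro def_rules)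
  let ?F = "trec (\<lambda>Y. cart Y Y) l"
  have X: "z eps ?F omega \<longleftrightarrow> z eps l \<or> (\<exists>n. Nat n \<and> z eps cart (?F n) (?F n))" for z
    using mem_trec[OF cH Ord_omega, of z l] by simp
  have X2: "z eps ?F omega \<longleftrightarrow> (\<exists>n. Nat n \<and> z eps ?F n)" for z
  proof
    assume "z eps ?F omega"
    with X consider "z eps l" | n where "Nat n" "z eps cart (?F n) (?F n)" by blast
    then show "\<exists>n. Nat n \<and> z eps ?F n"
    proof cases
      case 1
      then show ?thesis using trec_empty[OF cH, of l] Nat_empty by metis
    next
      case 2
      then show ?thesis using trec_suc[OF cH Nat_Ord[OF 2(1)], of z l] Nat_suc by blast
    qed
  next
    assume "\<exists>n. Nat n \<and> z eps ?F n"
    then obtain n where n: "Nat n" "z eps ?F n" by blast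
    then have "n \<sqsubseteq> omega" using Nat_mem by (auto simp: sub_def)
    from trec_mono[OF cH Ord_omega this Nat_Ord[OF n(1)], of l] n(2) subD show "z eps ?F omega" by blast
  qed
  have "opair x y eps ?F omega" if x: "x eps ?F omega" and y: "y eps ?F omega" for x y
  proof -
    obtain m n where mn: "Nat m" "x eps ?F m" "Nat n" "y eps ?F n" using x y X2 by blast
    have "\<exists>k. Nat k \<and> x eps ?F k \<and> y eps ?F k"
    proof (cases "m \<sqsubseteq> n")
      case True
      from trec_mono[OF cH _ this, of l] mn Nat_Ord subD show ?thesis by blast
    next
      case False
      then have "n \<sqsubseteq> m"
        using Ord_sub_iff[OF Nat_Ord Nat_Ord] Ord_linear[OF Nat_Ord Nat_Ord] mn by blast
      from trec_mono[OF cH _ this, of l] mn Nat_Ord subD show ?thesis by blast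
    qed
    then show ?thesis unfolding X mem_cart by blast
  qed
  moreover have "l \<sqsubseteq> ?F omega" using X by (simp add: sub_def)
  ultimately show ?thesis by blast
qed

text \<open>
  The least ordinal that is not a partial image of a pair-closed set \<open>X\<close> is regular: a cofinal map
  from a smaller ordinal, combined with chosen maps from \<open>X\<close> onto its values, would give a partial
  map from \<open>X \<times> X \<subseteq> X\<close> onto it.
\<close>

lemma ex_regular:
  assumes l: "Ord l" "omega \<sqsubseteq> l"
  shows "\<exists>d. regular d \<and> l eps d"
proof -
  obtain X where X: "l \<sqsubseteq> X" "\<And>x y. x eps X \<Longrightarrow> y eps X \<Longrightarrow> opair x y eps X"
    using ex_pair_closed[of l] by blast
  obtain t where t: "Ord t" "\<not> (\<exists>f. onto f X t)" using ex_not_image by blast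
  have "definable (\<lambda>e. \<not> (\<exists>f. onto f X (e 0)))" by (intro def_rules)
  from Ord_least[of "\<lambda>t. \<not> (\<exists>f. onto f X t)", OF this t] obtain d
    where d: "Ord d" "\<not> (\<exists>f. onto f X d)" and below: "\<And>c. c eps d \<Longrightarrow> \<exists>f. onto f X c" by blast
  have noR: False if R: "definable (\<lambda>e. R (e 0) (e 1))"
    and funR: "\<And>x y z. x eps X \<Longrightarrow> y eps d \<Longrightarrow> z eps d \<Longrightarrow> R x y \<Longrightarrow> R x z \<Longrightarrow> y = z"
    and onto: "\<And>y. y eps d \<Longrightarrow> \<exists>x. x eps X \<and> R x y" for R
  proof -
    have "onto (subrel X d R) X d" unfolding onto_def rel_subrel[OF R] using funR onto by blast
    with d(2) show False by blast
  qed
  have ld: "l eps d"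
  proof (rule ccontr)
    assume "\<not> l eps d"
    then have "d \<sqsubseteq> l" using Ord_not_mem_iff[OF l(1) d(1)] by blast
    then have "\<exists>x. x eps X \<and> x = y" if "y eps d" for y using that subD X(1) by blast
    moreover have "definable (\<lambda>e. e 0 = e 1)" by (intro def_rules)
    ultimately show False using noR[of "\<lambda>x y. x = y"] by blast
  qed
  have limit: "limit d" unfolding limit_def
  proof (intro allI impI, rule ccontr)
    fix x assume x: "x eps d" and max: "\<not> (\<exists>y. y eps d \<and> x eps y)"
    have Ox: "Ord x" using Ord_mem d(1) x by blast
    have split: "y eps x \<or> y = x" if "y eps d" for y
      using Ord_linear[OF Ord_mem[OF d(1) that] Ox] max that by blast
    obtain f where f: "onto f X x" using below[OF x] by blast
    \<comment> \<open>Two distinct tags: pairs \<open>opair p s\<close> code the elements of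
      \<open>x\<close>, and \<open>opair q q\<close> codes \<open>x\<close> itself, so
      \<open>X\<close> would map onto all of \<open>d\<close>.\<close>
    define p where "p = empty"
    define q where "q = suc empty"
    have "empty \<noteq> suc empty" using mem_suc[of empty empty] mem_empty[of empty] by metis
    then have pq: "p eps X" "q eps X" "p \<noteq> q"
      using subD[OF X(1)] subD[OF l(2)] by (auto simp: p_def q_def)
    let ?R = "\<lambda>r y. (\<exists>s. r = opair p s \<and> s eps X \<and> y eps x \<and> rel f s y) \<or> r = opair q q \<and> y = x"
    have "definable (\<lambda>e. ?R (e 0) (e 1))" by (intro def_rules)
    then show False
    proof (rule noR[of ?R])
      show "y = z" if "?R r y" "?R r z" for r y z
        using that pq(3) f unfolding onto_def by auto
      show "\<exists>r. r eps X \<and> ?R r y" if "y eps d" for y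
        using split[OF that]
      proof
        assume y: "y eps x"
        then obtain s where "s eps X" "rel f s y" using f unfolding onto_def by blast
        with y X(2)[OF pq(1)] show ?thesis by (intro exI[of _ "opair p s"]) blast
      next
        assume "y = x"
        with X(2)[OF pq(2,2)] show ?thesis by (intro exI[of _ "opair q q"]) blast
      qed
    qed
  qed
  have "\<not> singular UNIV d"
  proof
    assume "singular UNIV d"
    then obtain a g where a: "a eps d" and g: "cofinal g a d" unfolding singular_def by blast
    obtain f where f: "onto f X a" using below[OF a] by blast
    define c where "c y = choice (set_of {h. h \<sqsubseteq> cart X y \<and> onto h X y})" for y
    have Dc: "def_term (\<lambda>e. c (t e))" if "def_term t" for t
      by (rule def_term_app1[OF _ that]) (unfold c_def, intro def_rules)
    have c: "onto (c y) X y" if y: "y eps d" for y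
    proof -
      obtain h where h: "onto h X y" using below[OF y] by blast
      have R: "definable (\<lambda>e. rel h (e 0) (e 1))" by (intro def_rules)
      let ?h = "subrel X y (\<lambda>a b. rel h a b)"
      have "onto ?h X y" using h unfolding onto_def rel_subrel[OF R] by blast
      moreover have "?h \<sqsubseteq> cart X y" by (rule subrel_sub[OF R])
      moreover have "definable (\<lambda>e. e 0 \<sqsubseteq> cart X y \<and> onto (e 0) X y)" by (intro def_rules)
      ultimately show ?thesis unfolding c_def
        using choice_in[of "\<lambda>h. h \<sqsubseteq> cart X y \<and> onto h X y" "cart X y" ?h] by blast
    qed
    let ?R = "\<lambda>r u. \<exists>p q k y. r = opair p q \<and> p eps X \<and> q eps X \<and> k eps a \<and> y eps d \<and>
      rel f p k \<and> rel g k y \<and> rel (c y) q u \<and> u eps y"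
    have "definable (\<lambda>e. ?R (e 0) (e 1))" by (intro def_rules Dc)
    then show False
    proof (rule noR[of ?R])
      show "u = v" if r1: "?R r u" and r2: "?R r v" for r u v
      proof -
        obtain p q k y where 1: "r = opair p q" "p eps X" "q eps X" "k eps a" "y eps d"
          "rel f p k" "rel g k y" "rel (c y) q u" "u eps y" using r1 by blast
        obtain k' y' where 2: "k' eps a" "y' eps d"
          "rel f p k'" "rel g k' y'" "rel (c y') q v" "v eps y'" using r2 unfolding 1(1) opair_inject by blast
        have "k' = k" using f 1 2 unfolding onto_def by blast
        moreover from this have "y' = y" using g 1 2 unfolding cofinal_def by blast
        ultimately show ?thesis using c[OF 1(5)] 1 2 unfolding onto_def by blast
      qed
      show "\<exists>r. r eps X \<and> ?R r u" if u: "u eps d" for u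
      proof -
        obtain k y where 1: "k eps a" "y eps d" "rel g k y" "u eps y"
          using g u unfolding cofinal_def by blast
        obtain p where 2: "p eps X" "rel f p k" using f 1(1) unfolding onto_def by blast
        obtain q where 3: "q eps X" "rel (c y) q u" using c[OF 1(2)] 1(4) unfolding onto_def by blast
        from 1 2 3 X(2)[OF 2(1) 3(1)] show ?thesis by (intro exI[of _ "opair p q"]) blast
      qed
    qed
  qed
  with d(1) limit ld show ?thesis unfolding regular_def by blast
qed

section \<open>Stationary splitting\<close>

text \<open>Closure is required only at points of cofinality omega in \<open>N\<close>, where
  \<open>J\<close> can be shown continuous. Zero counts among them vacuously.\<close>

definition club :: "'s set \<Rightarrow> 's \<Rightarrow> 's \<Rightarrow> bool" where
  "club N D d \<longleftrightarrow> D \<sqsubseteq> d \<and> (\<forall>x. x eps d \<longrightarrow> (\<exists>y. y eps D \<and> x eps y)) \<and>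
     (\<forall>a. a eps d \<longrightarrow> cof_omega N a \<longrightarrow> (\<forall>x. x eps a \<longrightarrow> (\<exists>y. y eps D \<and> y eps a \<and> x eps y)) \<longrightarrow> a eps D)"

text \<open>The fibres of \<open>h\<close> over the elements of \<open>d\<close> are disjoint and
  each meets every such club in \<open>N\<close>. Coding them all in one set allows \<open>J\<close>
  to be applied.\<close>

definition splits :: "'s set \<Rightarrow> 's \<Rightarrow> 's \<Rightarrow> bool" where
  "splits N h d \<longleftrightarrow> (\<forall>a\<in>N. \<forall>x\<in>N. \<forall>y\<in>N. rel h a x \<longrightarrow> rel h a y \<longrightarrow> x = y) \<and>
     (\<forall>x. x eps d \<longrightarrow> (\<forall>D\<in>N. club N D d \<longrightarrow> (\<exists>a. a eps D \<and> rel h a x)))"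

lemma definable_club [def_rules]: "def_term t \<Longrightarrow> def_term s \<Longrightarrow> definable (\<lambda>e. club UNIV (t e) (s e))"
  by (rule def_app2) (unfold club_def, intro def_rules)

text \<open>As \<open>x\<close> lies below the ordinal \<open>G x\<close>, the accumulating
  recursion has exactly \<open>G (F n)\<close> as its next value; its value at omega is the supremum
  of the orbit.\<close>

lemma iterate_omega:
  assumes cG: "class_graph G" and definable: "definable (\<lambda>e. P (e 0))" and P0: "P x0"
    and step: "\<And>x. P x \<Longrightarrow> Ord x \<and> x eps G x \<and> P (G x)"
  shows "\<exists>F a. class_graph F \<and> (\<forall>n. Nat n \<longrightarrow> P (F n) \<and> F (suc n) = G (F n) \<and> F n eps a) \<and>
    Ord a \<and> cof_omega UNIV a \<and> x0 eps a \<and> (\<forall>z. z eps a \<longrightarrow> (\<exists>n. Nat n \<and> z eps F n))"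
proof -
  let ?F = "trec G x0"
  have cF: "class_graph ?F" by (intro def_term_trec cG def_rules)
  have F0: "?F empty = x0" by (rule trec_empty[OF cG])
  have Fsuc: "?F (suc n) = G (?F n)" if n: "Nat n" "P (?F n)" for n
  proof (rule set_eq)
    fix z
    have "Ord (G (?F n))" "?F n eps G (?F n)" using step n(2) by blast+
    then show "z eps ?F (suc n) \<longleftrightarrow> z eps G (?F n)"
      using trec_suc[OF cG Nat_Ord[OF n(1)]] Ord_trans by blast
  qed
  have PF: "P (?F n)" if n: "Nat n" for n
  proof (rule Nat_induct[of "\<lambda>n. P (?F n)", OF _ n])
    show "definable (\<lambda>e. P (?F (e 0)))" by (rule def_app1[OF definable cF])
    show "P (?F empty)" using P0 F0 by simp
    show "P (?F (suc n))" if "Nat n" "P (?F n)" for n using Fsuc[OF that] step that(2) by simp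
  qed
  let ?a = "?F omega"
  have OF: "Ord (?F n)" if "Nat n" for n using step PF[OF that] by blast
  have Fa: "?F n \<sqsubseteq> ?a" if n: "Nat n" for n
    using trec_mono[OF cG Ord_omega _ Nat_Ord[OF n]] Nat_mem[OF n] by (simp add: sub_def)
  have Fa2: "?F n eps ?a" if n: "Nat n" for n
    using subD[OF Fa[OF Nat_suc[OF n]]] Fsuc[OF n PF[OF n]] step PF[OF n] by simp
  have aF: "\<exists>n. Nat n \<and> z eps ?F n" if z: "z eps ?a" for z
  proof -
    from z mem_trec[OF cG Ord_omega, of z x0] consider "z eps x0" | n where "Nat n" "z eps G (?F n)"
      by auto
    then show ?thesis
    proof cases
      case 1
      then show ?thesis using F0 Nat_empty by metis
    next
      case 2
      then show ?thesis using Fsuc[OF 2(1) PF[OF 2(1)]] Nat_suc by metis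
    qed
  qed
  have Oa: "Ord ?a"
  proof (rule Ord_if_transitive)
    fix y assume "y eps ?a"
    then obtain n where n: "Nat n" "y eps ?F n" using aF by blast
    show "Ord y" by (rule Ord_mem[OF OF[OF n(1)] n(2)])
    show "z eps ?a" if "z eps y" for z
      using subD[OF Fa[OF n(1)]] Ord_trans[OF OF[OF n(1)] that n(2)] by blast
  qed
  have "\<exists>n. n eps omega \<and> ?F n eps ?a \<and> v eps ?F n" if "v eps ?a" for v
    using aF[OF that] Fa2 by auto
  from cofinal_graph[OF cF this] have cofa: "cof_omega UNIV ?a" unfolding cof_omega_iff by blast
  have x0a: "x0 eps ?a" using Fa2[OF Nat_empty] F0 by simp
  show ?thesis
    by (rule exI[of _ ?F], rule exI[of _ ?a]) (use cF PF Fsuc[OF _ PF] Oa cofa x0a Fa2 aF in simp)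
qed

text \<open>\<open>G x\<close> lies above \<open>x\<close> and above the values of \<open>g\<close>
  up to \<open>x\<close>. The orbit of \<open>x0\<close> is bounded in \<open>d\<close> because
  \<open>d\<close> is regular and above omega, and its supremum is the closure point.\<close>

lemma ex_closure_point:
  assumes d: "regular d" "omega eps d" and g: "class_graph g" "\<And>x. x eps d \<Longrightarrow> g x eps d" and x0: "x0 eps d"
  shows "\<exists>a. a eps d \<and> x0 eps a \<and> cof_omega UNIV a \<and> (\<forall>b. b eps a \<longrightarrow> g b eps a)"
proof -
  have Od: "Ord d" and ld: "limit d" using d(1) by (auto simp: regular_def)
  define G where "G x = least (\<lambda>u. u eps d \<and> x eps u \<and> (\<forall>y. y eps suc x \<longrightarrow> g y eps u))" for x
  have cG: "class_graph G" unfolding G_def by (intro def_rules def_term_app1[OF g(1)])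
  have G: "G x eps d" "x eps G x" "\<And>y. y eps suc x \<Longrightarrow> g y eps G x" if x: "x eps d" for x
  proof -
    obtain u where u: "u eps d" "\<And>y. y eps suc x \<Longrightarrow> g y eps d \<Longrightarrow> g y eps u"
      using regular_bound[OF d(1) g(1) limit_suc[OF Od ld x]] by blast
    obtain v where v: "v eps d" "u \<sqsubseteq> v" "x eps v"
    proof (cases "x eps u")
      case True
      with that u(1) show ?thesis using sub_refl by blast
    next
      case False
      then have "u \<sqsubseteq> x" using Ord_not_mem_iff Ord_mem[OF Od] x u(1) by blast
      then show ?thesis using that[of "suc x"] limit_suc[OF Od ld x] by (auto simp: sub_def)
    qed
    have "y eps d" if "y eps suc x" for y using that x Ord_trans[OF Od] by auto
    then have v2: "\<forall>y. y eps suc x \<longrightarrow> g y eps v" using u(2) g(2) subD[OF v(2)] by blast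
    have D: "definable (\<lambda>e. e 0 eps d \<and> x eps e 0 \<and> (\<forall>y. y eps suc x \<longrightarrow> g y eps e 0))"
      by (intro def_rules def_term_app1[OF g(1)])
    have "v eps d \<and> x eps v \<and> (\<forall>y. y eps suc x \<longrightarrow> g y eps v)" using v v2 by blast
    from least(2)[of "\<lambda>u. u eps d \<and> x eps u \<and> (\<forall>y. y eps suc x \<longrightarrow> g y eps u)", OF D Ord_mem[OF Od v(1)] this]
    show "G x eps d" "x eps G x" "\<And>y. y eps suc x \<Longrightarrow> g y eps G x" unfolding G_def by blast+
  qed
  have D: "definable (\<lambda>e. e 0 eps d)" by (intro def_rules)
  have "Ord x \<and> x eps G x \<and> G x eps d" if "x eps d" for x
    using G[OF that] Ord_mem[OF Od that] by blast
  from iterate_omega[of G "\<lambda>x. x eps d", OF cG D x0 this] obtain F a where cF: "class_graph F"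
    and F: "\<forall>n. Nat n \<longrightarrow> F n eps d \<and> F (suc n) = G (F n) \<and> F n eps a"
    and Oa: "Ord a" and a: "cof_omega UNIV a" "x0 eps a" and aF: "\<forall>z. z eps a \<longrightarrow> (\<exists>n. Nat n \<and> z eps F n)"
    by blast
  have Fd: "F n eps d" and Fsuc: "F (suc n) = G (F n)" and Fa: "F n eps a" if "Nat n" for n
    using F that by blast+
  obtain u where u: "u eps d" "\<And>n. n eps omega \<Longrightarrow> F n eps d \<Longrightarrow> F n eps u"
    using regular_bound[OF d(1) cF d(2)] by blast
  have Ou: "Ord u" using Ord_mem[OF Od u(1)] .
  have "a \<sqsubseteq> u" unfolding sub_def
  proof (intro allI impI)
    fix z assume "z eps a"
    then obtain n where n: "Nat n" "z eps F n" using aF by blast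
    then show "z eps u" using u(2)[of n] Fd Ord_trans[OF Ou] by auto
  qed
  then have "a eps d" using Ord_sub_iff[OF Oa Ou] u(1) Ord_trans[OF Od] by blast
  moreover have "g b eps a" if b: "b eps a" for b
  proof -
    obtain n where n: "Nat n" "b eps F n" using aF b by blast
    then have "g b eps F (suc n)" using G(3)[OF Fd[OF n(1)], of b] Fsuc[OF n(1)] by simp
    then show ?thesis using Ord_trans[OF Oa _ Fa[OF Nat_suc[OF n(1)]]] by blast
  qed
  ultimately show ?thesis using a by blast
qed

text \<open>A ladder \<open>c a\<close> of type omega is chosen for each \<open>a\<close> of
  cofinality omega. For some fixed \<open>n\<close>, unboundedly many \<open>y\<close> are the
  \<open>n\<close>-th rung for stationarily many \<open>a\<close>; these \<open>y\<close>,
  enumerated increasingly by \<open>en\<close>, label the pieces.\<close>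

lemma ex_splits:
  assumes d: "regular d" "omega eps d"
  shows "\<exists>h. splits UNIV h d"
proof -
  have Od: "Ord d" and ld: "limit d" using d(1) by (auto simp: regular_def)
  have Odm: "Ord x" if "x eps d" for x using Ord_mem[OF Od that] .
  define c where "c a = choice (set_of {f. f \<sqsubseteq> cart omega a \<and> cofinal f omega a})" for a
  have Dc: "def_term (\<lambda>e. c (t e))" if "def_term t" for t
    by (rule def_term_app1[OF _ that]) (unfold c_def, intro def_rules)
  have c: "cofinal (c a) omega a" if "cof_omega UNIV a" for a
  proof -
    obtain f where f: "cofinal f omega a" using \<open>cof_omega UNIV a\<close> unfolding cof_omega_iff by blast
    have R: "definable (\<lambda>e. rel f (e 0) (e 1))" by (intro def_rules)
    let ?f = "subrel omega a (\<lambda>x y. rel f x y)"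
    have "cofinal ?f omega a" using f unfolding cofinal_def rel_subrel[OF R] by blast
    moreover have "?f \<sqsubseteq> cart omega a" by (rule subrel_sub[OF R])
    moreover have "definable (\<lambda>e. e 0 \<sqsubseteq> cart omega a \<and> cofinal (e 0) omega a)" by (intro def_rules)
    ultimately show ?thesis unfolding c_def
      using choice_in[of "\<lambda>f. f \<sqsubseteq> cart omega a \<and> cofinal f omega a" "cart omega a" ?f] by blast
  qed
  define avoids where
    "avoids D n y \<longleftrightarrow> club UNIV D d \<and> (\<forall>a. a eps D \<longrightarrow> cof_omega UNIV a \<longrightarrow> y eps a \<longrightarrow> \<not> rel (c a) n y)" for D n y
  have DPa: "definable (\<lambda>e. avoids (t e) (s e) (r e))" if "def_term t" "def_term s" "def_term r" for t s r
    by (rule def_app3[OF _ that]) (unfold avoids_def, intro def_rules Dc)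
  \<comment> \<open>\<open>T n y\<close> says that the points whose \<open>n\<close>-th rung is
    \<open>y\<close> meet every club.\<close>
  define T where "T n y \<longleftrightarrow> y eps d \<and> \<not> (\<exists>D. avoids D n y)" for n y
  have DT2: "definable (\<lambda>e. T (t e) (s e))" if "def_term t" "def_term s" for t s
    by (rule def_app2[OF _ that]) (unfold T_def, intro def_rules DPa)
  have "\<exists>n. Nat n \<and> (\<forall>x. x eps d \<longrightarrow> (\<exists>y. x eps y \<and> T n y))"
  proof (rule ccontr)
    assume no: "\<not> ?thesis"
    define \<eta>0 where "\<eta>0 n = least (\<lambda>x. x eps d \<and> (\<forall>y. x eps y \<longrightarrow> \<not> T n y))" for n
    have c0: "class_graph \<eta>0" unfolding \<eta>0_def by (intro def_rules DT2)
    have \<eta>0: "\<eta>0 n eps d \<and> (\<forall>y. \<eta>0 n eps y \<longrightarrow> \<not> T n y)" if n: "Nat n" for n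
    proof -
      obtain x where x: "x eps d \<and> (\<forall>y. x eps y \<longrightarrow> \<not> T n y)" using no n by blast
      have D: "definable (\<lambda>e. e 0 eps d \<and> (\<forall>y. e 0 eps y \<longrightarrow> \<not> T n y))" by (intro def_rules DT2)
      from least(2)[of "\<lambda>x. x eps d \<and> (\<forall>y. x eps y \<longrightarrow> \<not> T n y)", OF D Odm x] x
      show ?thesis unfolding \<eta>0_def by blast
    qed
    \<comment> \<open>Regularity of \<open>d\<close> gives one bound for the countably many
      \<open>\<eta>0 n\<close>.\<close>
    obtain \<eta> where \<eta>: "\<eta> eps d" "\<And>n. n eps omega \<Longrightarrow> \<eta>0 n eps d \<Longrightarrow> \<eta>0 n eps \<eta>"
      using regular_bound[OF d(1) c0 d(2)] by blast
    have ex_av: "\<exists>D. avoids D n y" if n: "Nat n" and y: "y eps d" "\<eta> eps y" for n y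
    proof -
      have "\<eta>0 n eps y" using \<eta>(2)[of n] \<eta>0[OF n] n Ord_trans[OF Odm[OF y(1)] _ y(2)] by simp
      with \<eta>0[OF n] y(1) show ?thesis unfolding T_def by blast
    qed
    define D where "D n y = choice (set_of {D. avoids D n y})" for n y
    have DD: "def_term (\<lambda>e. D (t e) (s e))" if "def_term t" "def_term s" for t s
      by (rule def_term_app2[OF _ that]) (unfold D_def, intro def_rules DPa)
    have D: "avoids (D n y) n y" if n: "Nat n" and y: "y eps d" "\<eta> eps y" for n y
    proof -
      have "definable (\<lambda>e. avoids (e 0) n y)" by (intro def_rules DPa)
      moreover have "B \<sqsubseteq> d" if "avoids B n y" for B using that by (simp add: avoids_def club_def)
      ultimately show ?thesis unfolding D_def
        using choice_in[of "\<lambda>B. avoids B n y" d] ex_av[OF n y] by blast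
    qed
    define nx where "nx n y x = least (\<lambda>z. z eps D n y \<and> x eps z)" for n y x
    have nx: "nx n y x eps D n y \<and> x eps nx n y x \<and> nx n y x eps d"
      if n: "Nat n" and y: "y eps d" "\<eta> eps y" and x: "x eps d" for n y x
    proof -
      have cl: "club UNIV (D n y) d" using D[OF n y] by (simp add: avoids_def)
      then obtain z where z: "z eps D n y \<and> x eps z" using x unfolding club_def by blast
      have zd: "u eps d" if "u eps D n y" for u using cl that subD unfolding club_def by blast
      have P: "definable (\<lambda>e. e 0 eps D n y \<and> x eps e 0)" by (intro def_rules)
      from least(2)[of "\<lambda>z. z eps D n y \<and> x eps z", OF P Odm z] zd z show ?thesis
        unfolding nx_def by blast
    qed
    \<comment> \<open>\<open>U\<close> and \<open>g\<close> make up a diagonal intersection: a point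
      above \<open>\<eta>\<close> closed under \<open>g\<close> is a limit of \<open>D n y\<close>
      for every natural number \<open>n\<close> and every \<open>y\<close> between
      \<open>\<eta>\<close> and that point.\<close>
    define U where "U x n = least (\<lambda>u. u eps d \<and> (\<forall>y. y eps x \<longrightarrow> nx n y x eps d \<longrightarrow> nx n y x eps u))" for x n
    define g where "g x = least (\<lambda>u. u eps d \<and> (\<forall>n. n eps omega \<longrightarrow> U x n eps d \<longrightarrow> U x n eps u))" for x
    have cn: "class_graph (\<lambda>y. nx n y x)" for n x unfolding nx_def by (intro def_rules DD)
    have cU: "class_graph (U x)" for x unfolding U_def nx_def by (intro def_rules DD)
    have cg: "class_graph g" unfolding g_def U_def nx_def by (intro def_rules DD)
    have U: "U x n eps d \<and> (\<forall>y. y eps x \<longrightarrow> nx n y x eps d \<longrightarrow> nx n y x eps U x n)" if x: "x eps d" for x n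
    proof -
      obtain u where u: "u eps d \<and> (\<forall>y. y eps x \<longrightarrow> nx n y x eps d \<longrightarrow> nx n y x eps u)"
        using regular_bound[OF d(1) cn x] by blast
      have P: "definable (\<lambda>e. e 0 eps d \<and> (\<forall>y. y eps x \<longrightarrow> nx n y x eps d \<longrightarrow> nx n y x eps e 0))"
        unfolding nx_def by (intro def_rules DD)
      from least(2)[of "\<lambda>u. u eps d \<and> (\<forall>y. y eps x \<longrightarrow> nx n y x eps d \<longrightarrow> nx n y x eps u)", OF P Odm u] u
      show ?thesis unfolding U_def by blast
    qed
    have g: "g x eps d \<and> (\<forall>n. n eps omega \<longrightarrow> U x n eps d \<longrightarrow> U x n eps g x)" for x
    proof -
      obtain u where u: "u eps d \<and> (\<forall>n. n eps omega \<longrightarrow> U x n eps d \<longrightarrow> U x n eps u)"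
        using regular_bound[OF d(1) cU d(2)] by blast
      have P: "definable (\<lambda>e. e 0 eps d \<and> (\<forall>n. n eps omega \<longrightarrow> U x n eps d \<longrightarrow> U x n eps e 0))"
        unfolding U_def nx_def by (intro def_rules DD)
      from least(2)[of "\<lambda>u. u eps d \<and> (\<forall>n. n eps omega \<longrightarrow> U x n eps d \<longrightarrow> U x n eps u)", OF P Odm u] u
      show ?thesis unfolding g_def by blast
    qed
    obtain a where a: "a eps d" "\<eta> eps a" "cof_omega UNIV a" and ga: "\<And>b. b eps a \<Longrightarrow> g b eps a"
      using ex_closure_point[OF d cg _ \<eta>(1)] g by blast
    have Oa: "Ord a" using Odm[OF a(1)] .
    have la: "limit a" using cofinal_limit[OF c[OF a(3)]] .
    obtain n y where ny: "n eps omega" "y eps a" "rel (c a) n y" "\<eta> eps y"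
      using c[OF a(3)] a(2) unfolding cofinal_def by blast
    have n: "Nat n" and y: "y eps d" using ny(1,2) Ord_trans[OF Od _ a(1)] by auto
    have av: "avoids (D n y) n y" by (rule D[OF n y ny(4)])
    have "\<exists>z. z eps D n y \<and> z eps a \<and> x eps z" if x: "x eps a" for x
    proof -
      \<comment> \<open>\<open>U x' n\<close> bounds the next elements only of those clubs with
        \<open>y eps x'\<close>, so \<open>x'\<close> is taken above \<open>y\<close> as well as
        above \<open>x\<close>.\<close>
      obtain x' where x': "x' eps a" "x eps x'" "y eps x'"
      proof (cases "x eps y")
        case True
        show ?thesis by (rule that[of "suc y"]) (use limit_suc[OF Oa la ny(2)] True in auto)
      next
        case False
        then have "y eps suc x"
          using Ord_linear[OF Ord_mem[OF Oa x] Ord_mem[OF Oa ny(2)]] by auto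
        then show ?thesis by (intro that[of "suc x"]) (use limit_suc[OF Oa la x] in auto)
      qed
      have xd: "x' eps d" using Ord_trans[OF Od x'(1) a(1)] .
      let ?z = "nx n y x'"
      have z: "?z eps D n y" "x' eps ?z" "?z eps d" using nx[OF n y ny(4) xd] by blast+
      have "?z eps U x' n" using U[OF xd] x'(3) z(3) by blast
      moreover have "U x' n eps g x'" using g ny(1) U[OF xd] by blast
      ultimately have "?z eps a" using Ord_trans[OF Oa] ga[OF x'(1)] by blast
      moreover have "x eps ?z" using Ord_trans[OF Odm[OF z(3)] x'(2) z(2)] .
      ultimately show ?thesis using z(1) by blast
    qed
    then have "a eps D n y" using av a(1,3) unfolding avoids_def club_def by blast
    with av a(3) ny show False unfolding avoids_def by blast
  qed
  then obtain n where n: "Nat n" and unb: "\<And>x. x eps d \<Longrightarrow> \<exists>y. x eps y \<and> T n y" by blast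
  define tn where "tn x = least (\<lambda>y. T n y \<and> x eps y)" for x
  have ctn: "class_graph tn" unfolding tn_def by (intro def_rules DT2)
  have tn: "T n (tn x) \<and> x eps tn x" if x: "x eps d" for x
  proof -
    obtain y where y: "T n y \<and> x eps y" using unb[OF x] by blast
    then have Oy: "Ord y" using Odm by (auto simp: T_def)
    have P: "definable (\<lambda>e. T n (e 0) \<and> x eps e 0)" by (intro def_rules DT2)
    from least(2)[of "\<lambda>y. T n y \<and> x eps y", OF P Oy y] show ?thesis unfolding tn_def .
  qed
  have Td: "y eps d" if "T n y" for y using that by (simp add: T_def)
  \<comment> \<open>\<open>?F x\<close> is the supremum of the successors of the values enumerated
    before \<open>x\<close>, so the next value \<open>tn (?F x)\<close> exceeds all of them.\<close>
  define H where "H x = suc (tn x)" for x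
  have cH: "class_graph H" unfolding H_def by (intro def_rules ctn)
  let ?F = "trec H empty"
  have DF: "def_term (\<lambda>e. ?F (t e))" if "def_term t" for t by (intro def_term_trec cH def_rules that)
  have F: "z eps ?F x \<longleftrightarrow> (\<exists>b. b eps x \<and> z eps H (?F b))" if "Ord x" for x z
    using mem_trec[OF cH that] by simp
  have Fd: "x eps d \<longrightarrow> ?F x eps d" for x
  proof (rule eps_induct[of "\<lambda>x. x eps d \<longrightarrow> ?F x eps d"], intro def_rules DF, rule impI)
    fix x assume IH: "\<And>b. b eps x \<Longrightarrow> b eps d \<longrightarrow> ?F b eps d" and x: "x eps d"
    have Hd: "H (?F b) eps d" if "b eps x" for b
    proof -
      have "?F b eps d" using IH[OF that] Ord_trans[OF Od that x] by blast
      with tn Td show ?thesis unfolding H_def using limit_suc[OF Od ld] by blast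
    qed
    have "class_graph (\<lambda>b. H (?F b))" by (intro def_term_app1[OF cH] DF def_rules)
    from regular_bound[OF d(1) this x] Hd obtain u where u: "u eps d" "\<And>b. b eps x \<Longrightarrow> H (?F b) eps u" by blast
    have Ou: "Ord u" using Odm[OF u(1)] .
    have sub: "?F x \<sqsubseteq> u" unfolding sub_def F[OF Odm[OF x]] using u(2) Ord_trans[OF Ou] by blast
    have "Ord (?F x)"
    proof (rule Ord_if_transitive)
      fix y z assume yz: "y eps ?F x" "z eps y"
      then obtain b where b: "b eps x" "y eps H (?F b)" using F[OF Odm[OF x]] by blast
      from Ord_trans[OF Odm[OF Hd[OF b(1)]] yz(2) b(2)] b(1) show "z eps ?F x"
        using F[OF Odm[OF x]] by blast
    next
      fix y assume "y eps ?F x"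
      then show "Ord y" using Ord_mem[OF Ou] subD[OF sub] by blast
    qed
    then show "?F x eps d" using Ord_sub_iff[OF _ Ou] sub u(1) Ord_trans[OF Od] by blast
  qed
  define en where "en x = tn (?F x)" for x
  have De: "def_term (\<lambda>e. en (t e))" if "def_term t" for t
    unfolding en_def by (intro def_term_app1[OF ctn] DF that)
  have e: "T n (en x)" if "x eps d" for x unfolding en_def using tn Fd that by blast
  have less: "en b eps en x" if b: "b eps x" and x: "x eps d" for b x
  proof -
    have "en b eps H (?F b)" by (simp add: H_def en_def)
    then have 1: "en b eps ?F x" using F[OF Odm[OF x]] b by blast
    have 2: "?F x eps en x" unfolding en_def using tn Fd x by blast
    have "Ord (en x)" using Odm Td e x by blast
    from Ord_trans[OF this 1 2] show ?thesis .
  qed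
  have inj: "x = y" if "x eps d" "y eps d" "en x = en y" for x y
    using Ord_linear[OF Odm Odm, OF that(1,2)] less[of x y] less[of y x] that by auto
  let ?R = "\<lambda>a x. cof_omega UNIV a \<and> en x eps a \<and> rel (c a) n (en x)"
  have R: "definable (\<lambda>e. ?R (e 0) (e 1))" by (intro def_rules De Dc)
  have "splits UNIV (subrel d d ?R) d"
    unfolding splits_def rel_subrel[OF R]
  proof (intro conjI ballI allI impI)
    fix a x y assume 1: "a eps d \<and> x eps d \<and> ?R a x" and 2: "a eps d \<and> y eps d \<and> ?R a y"
    have no: "n eps omega" using n by simp
    have "cofinal (c a) omega a" using c 1 by blast
    with 1 2 no have "en x = en y" unfolding cofinal_def by blast
    with inj 1 2 show "x = y" by blast
  next
    fix x D assume x: "x eps d" and D: "club UNIV D d"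
    have "\<not> avoids D n (en x)" using e[OF x] by (auto simp: T_def)
    with D obtain a where a: "a eps D" "cof_omega UNIV a" "en x eps a" "rel (c a) n (en x)"
      unfolding avoids_def by blast
    moreover have "a eps d" using D a(1) subD unfolding club_def by blast
    ultimately show "\<exists>a. a eps D \<and> a eps d \<and> x eps d \<and> ?R a x" using x by blast
  qed
  then show ?thesis by blast
qed

end

context embedding
begin

section \<open>The inconsistency\<close>

lemma elem_zero_or_suc [elem_rules]: "absolute (\<lambda>e. zero_or_suc (e i))"
proof -
  have "zero_or_suc m \<longleftrightarrow> (\<forall>z. z eps m \<longrightarrow> False) \<or>
      (\<exists>k. k eps m \<and> (\<forall>z. z eps m \<longrightarrow> z eps k \<or> z = k) \<and> (\<forall>z. z eps k \<longrightarrow> z eps m))" for m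
    by (simp add: zero_or_suc_def)
  then show ?thesis by (simp only:) (intro elem_rules)
qed

lemma elem_cofinal [elem_rules]: "absolute (\<lambda>e. cofinal (e i) (e k) (e l))"
  unfolding cofinal_def by (intro elem_rules)

lemma elem_limit [elem_rules]: "absolute (\<lambda>e. limit (e i))"
  unfolding limit_def by (intro elem_rules)

lemma elem_is_omega [elem_rules]: "absolute (\<lambda>e. is_omega (e i))"
  unfolding is_omega_def by (intro elem_rules)

lemma elem_singular [elem_rules]: "elem (\<lambda>e. singular M (e i)) (\<lambda>e. singular UNIV (e i))"
  unfolding singular_def by (intro elem_rules)

lemma elem_cof_omega [elem_rules]: "elem (\<lambda>e. cof_omega M (e i)) (\<lambda>e. cof_omega UNIV (e i))"
  unfolding cof_omega_def by (intro elem_rules)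

lemma elem_club [elem_rules]: "elem (\<lambda>e. club M (e i) (e k)) (\<lambda>e. club UNIV (e i) (e k))"
  unfolding club_def by (intro elem_rules)

lemma elem_splits [elem_rules]: "elem (\<lambda>e. splits M (e i) (e k)) (\<lambda>e. splits UNIV (e i) (e k))"
  unfolding splits_def by (intro elem_rules)

section \<open>Continuity of the embedding at points of cofinality omega\<close>

lemma J_omega: "J omega = omega"
  using transfer1[OF elem_is_omega[of 0] Ord_in_M[OF Ord_omega]] by (simp add: is_omega_iff)

lemma J_empty: "J empty = empty"
proof -
  have "absolute (\<lambda>e. \<forall>z. z eps e 0 \<longrightarrow> False)" by (intro elem_rules)
  from transfer1[OF this Ord_in_M[OF Ord_empty]] show ?thesis by (intro set_eq) simp
qed

lemma J_suc:
  assumes "Ord k"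
  shows "J (suc k) = suc (J k)"
proof -
  let ?P = "\<lambda>m k. (\<forall>z. z eps m \<longrightarrow> z eps k \<or> z = k) \<and> (\<forall>z. z eps k \<longrightarrow> z eps m) \<and> k eps m"
  have "absolute (\<lambda>e. ?P (e 0) (e 1))" by (intro elem_rules)
  from transfer2[OF this Ord_in_M Ord_in_M, of "suc k" k] assms
  have "?P (J (suc k)) (J k)" by simp
  then show ?thesis by (intro set_eq) auto
qed

lemma J_Nat:
  assumes n: "Nat n"
  shows "J n = n"
proof (rule Nat_induct[of "\<lambda>n. J n = n", OF _ n])
  show "definable (\<lambda>e. J (e 0) = e 0)" by (intro def_rules)
  show "J (suc n) = suc n" if "Nat n" "J n = n" for n using J_suc[OF Nat_Ord[OF that(1)]] that(2) by simp
qed (rule J_empty)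

text \<open>For \<open>f \<in> M\<close> cofinal from omega to \<open>a\<close>, the map
  \<open>J f\<close> is cofinal from the same omega to \<open>J a\<close>. Since \<open>J\<close>
  fixes each natural number, the values of \<open>J f\<close> are images under \<open>J\<close> of
  values of \<open>f\<close>.\<close>

lemma J_continuous:
  assumes a: "Ord a" "cof_omega M a" and x: "x eps J a"
  shows "\<exists>y. y eps a \<and> x eps J y"
proof -
  obtain f where f: "f \<in> M" "cofinal f omega a" using a(2) unfolding cof_omega_def is_omega_iff by blast
  have aM: "a \<in> M" using Ord_in_M[OF a(1)] .
  have C: "cofinal (J f) omega (J a)"
    using transfer3[OF elem_cofinal[of 0 1 2] f(1) Ord_in_M[OF Ord_omega] aM] f(2) J_omega by simp
  then obtain n y where n: "n eps omega" "y eps J a" "rel (J f) n y" "x eps y"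
    using x unfolding cofinal_def by blast
  have nM: "n \<in> M" "J n = n" using n(1) J_Nat Ord_in_M[OF Nat_Ord] by auto
  have "absolute (\<lambda>e. \<exists>y. y eps e 0 \<and> rel (e 1) (e 2) y)"
    by (intro elem_rules)
  from transfer3[OF this aM f(1) nM(1)] n(2,3) nM(2) obtain z where z: "z eps a" "rel f n z" by auto
  have zM: "z \<in> M" using M_trans[OF aM z(1)] .
  have "rel (J f) n (J z)" using transfer3[OF elem_rel[of 0 1 2] f(1) nM(1) zM] z(2) nM(2) by simp
  moreover have "J z eps J a" using J_mem_iff[OF zM aM] z(1) by simp
  ultimately have "y = J z" using C n unfolding cofinal_def by blast
  with z(1) n(4) show ?thesis by blast
qed

end

context definable_embedding
begin

lemma cof_omega_agree: "Ord g \<Longrightarrow> cof_omega M g \<longleftrightarrow> cof_omega UNIV g"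
proof -
  have "absolute (\<lambda>e. is_omega (e 0) \<and> cofinal (e 1) (e 0) (e 2))"
    by (intro elem_rules)
  from witness_in_M[of "\<lambda>a f g. is_omega a \<and> cofinal f a g", OF this] show "Ord g \<Longrightarrow> ?thesis"
    unfolding cof_omega_def by blast
qed

lemma singular_agree: "Ord g \<Longrightarrow> singular M g \<longleftrightarrow> singular UNIV g"
proof -
  have "absolute (\<lambda>e. e 0 eps e 2 \<and> cofinal (e 1) (e 0) (e 2))"
    by (intro elem_rules)
  from witness_in_M[of "\<lambda>a f g. a eps g \<and> cofinal f a g", OF this] show "Ord g \<Longrightarrow> ?thesis"
    unfolding singular_def by blast
qed

lemma ex_fixed_above:
  assumes k: "Ord k" "J k \<noteq> k"
  shows "\<exists>l. Ord l \<and> k eps l \<and> J l = l"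
proof -
  have "class_graph J" "definable (\<lambda>e. Ord (e 0) \<and> e 0 eps J (e 0))" by (intro def_rules)+
  moreover have "Ord k \<and> k eps J k"
    using k Ord_sub_iff[OF k(1) Ord_J[OF k(1)]] Ord_sub_J[OF k(1)] by auto
  moreover have "Ord x \<and> x eps J x \<and> Ord (J x) \<and> J x eps J (J x)" if "Ord x \<and> x eps J x" for x
    using that Ord_J J_mem by blast
  ultimately obtain F l
    where F: "\<forall>n. Nat n \<longrightarrow> (Ord (F n) \<and> F n eps J (F n)) \<and> F (suc n) = J (F n) \<and> F n eps l"
    and Ol: "Ord l" and l: "cof_omega UNIV l" "k eps l" and lF: "\<forall>z. z eps l \<longrightarrow> (\<exists>n. Nat n \<and> z eps F n)"
    using iterate_omega[of J "\<lambda>x. Ord x \<and> x eps J x" k] by blast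
  \<comment> \<open>The orbit is a sequence in \<open>V\<close>; agreement on cofinality provides
    one in \<open>M\<close>, as continuity of \<open>J\<close> at \<open>l\<close> requires.\<close>
  have cl: "cof_omega M l" using cof_omega_agree[OF Ol] l(1) by blast
  have Jl: "J y eps l" if y: "y eps l" for y
  proof -
    obtain n where n: "Nat n" "y eps F n" using lF y by blast
    have "Ord (F n)" "F (suc n) = J (F n)" "F (suc n) eps l" using F n(1) Nat_suc by blast+
    moreover from this have "J y eps F (suc n)" using n J_mem Ord_mem by simp
    ultimately show ?thesis using Ord_trans[OF Ol] by blast
  qed
  have "J l \<sqsubseteq> l" unfolding sub_def
    using J_continuous[OF Ol cl] Jl Ord_trans[OF Ol] by blast
  then have "J l = l" using Ord_sub_J[OF Ol] sub_antisym by blast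
  with Ol l(2) show ?thesis by blast
qed

text \<open>Because \<open>M\<close> agrees about singularity, no regular ordinal in the sense of
  \<open>M\<close> lies between \<open>l\<close> and the least regular \<open>d\<close> of
  \<open>V\<close> above it. By transfer none of \<open>V\<close> lies between
  \<open>J l = l\<close> and \<open>J d\<close>, so \<open>J d\<close> cannot exceed
  \<open>d\<close>.\<close>

lemma ex_fixed_regular:
  assumes l: "Ord l" "omega \<sqsubseteq> l" "J l = l"
  shows "\<exists>d. regular d \<and> l eps d \<and> J d = d"
proof -
  define R where "R N d l \<longleftrightarrow> Ord d \<and> limit d \<and> \<not> singular N d \<and> l eps d" for N d l
  have ER: "elem (\<lambda>e. R M (e i) (e k)) (\<lambda>e. R UNIV (e i) (e k))" for i k
    unfolding R_def by (intro elem_rules)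
  have agree: "R M d l \<longleftrightarrow> R UNIV d l" for d
    using singular_agree by (auto simp: R_def)
  have R: "R UNIV d l \<longleftrightarrow> regular d \<and> l eps d" for d by (auto simp: R_def regular_def)
  obtain d0 where d0: "R UNIV d0 l" using ex_regular[OF l(1,2)] R by blast
  then have "Ord d0" by (simp add: R_def)
  moreover have "definable (\<lambda>e. R UNIV (e 0) l)"
    unfolding R_def singular_def limit_def by (intro def_rules)
  ultimately obtain d where d: "Ord d" "R UNIV d l" "\<forall>c. c eps d \<longrightarrow> \<not> R UNIV c l"
    using Ord_least[of "\<lambda>d. R UNIV d l" d0] d0 by blast
  have dM: "d \<in> M" "l \<in> M" using d(1) l(1) Ord_in_M by auto
  have "elem (\<lambda>e. \<forall>c. c eps e 0 \<longrightarrow> \<not> R M c (e 1)) (\<lambda>e. \<forall>c. c eps e 0 \<longrightarrow> \<not> R UNIV c (e 1))"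
    by (intro elem_rules ER)
  from transfer2[OF this dM] d(3) agree l(3) have least: "\<forall>c. c eps J d \<longrightarrow> \<not> R UNIV c l" by simp
  then have "\<not> d eps J d" using d(2) by blast
  then have "J d \<sqsubseteq> d" using Ord_not_mem_iff[OF d(1) Ord_J[OF d(1)]] by blast
  then have "J d = d" using Ord_sub_J[OF d(1)] sub_antisym by blast
  with d(2) R show ?thesis by blast
qed

text \<open>To close off at \<open>a\<close>, let \<open>b\<close> collect the \<open>x\<close> with
  \<open>J x\<close> below \<open>a\<close>. A cofinal sequence in \<open>a\<close> yields one in
  \<open>b\<close>, agreement puts cofinality omega of \<open>b\<close> into \<open>M\<close>, and
  continuity at \<open>b\<close> gives \<open>J b = a\<close>.\<close>

lemma club_image:
  assumes d: "regular d" "J d = d" and D: "\<And>z. z eps D \<longleftrightarrow> (\<exists>x. x eps d \<and> z = J x)"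
  shows "club UNIV D d"
proof -
  have Od: "Ord d" and ld: "limit d" using d(1) by (auto simp: regular_def)
  have Odm: "Ord x" if "x eps d" for x using Ord_mem[OF Od that] .
  have Jd: "J x eps d" if "x eps d" for x using J_mem[OF Odm[OF that] Od] that d(2) by simp
  have up: "x eps J (suc x)" if "x eps d" for x
    using subD[OF Ord_sub_J[OF Ord_suc[OF Odm[OF that]]]] by simp
  show ?thesis unfolding club_def
  proof (intro conjI allI impI)
    show "D \<sqsubseteq> d" unfolding sub_def D using Jd by blast
    show "\<exists>y. y eps D \<and> x eps y" if x: "x eps d" for x
      using up[OF x] limit_suc[OF Od ld x] D by blast
    fix a assume a: "a eps d" and cof: "cof_omega UNIV a"
      and unb: "\<forall>x. x eps a \<longrightarrow> (\<exists>y. y eps D \<and> y eps a \<and> x eps y)"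
    have Oa: "Ord a" using Odm[OF a] .
    have "definable (\<lambda>e. e 0 eps d \<and> J (e 0) eps a)" by (intro def_rules)
    from small_subset[of "\<lambda>x. x eps d \<and> J x eps a", OF this, of d]
    obtain b where b: "\<And>x. x eps b \<longleftrightarrow> x eps d \<and> J x eps a" by (auto simp: small_def)
    have Ob: "Ord b"
    proof (rule Ord_if_transitive)
      fix y z assume y: "y eps b" and z: "z eps y"
      have yd: "y eps d" "J y eps a" using y b by blast+
      have "J z eps J y" using J_mem[OF Ord_mem[OF Odm[OF yd(1)] z] Odm[OF yd(1)]] z by simp
      then show "z eps b" using b Ord_trans[OF Od z yd(1)] Ord_trans[OF Oa _ yd(2)] by blast
    next
      show "Ord y" if "y eps b" for y using that b Odm by blast
    qed
    have "b \<sqsubseteq> a" unfolding sub_def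
    proof (intro allI impI)
      fix x assume "x eps b"
      then have x: "x eps d" "J x eps a" using b by blast+
      have "x eps J x \<or> x = J x" using Ord_sub_J Ord_sub_iff Odm[OF x(1)] Ord_J by blast
      then show "x eps a" using x(2) Ord_trans[OF Oa] by auto
    qed
    then have bd: "b eps d" using Ord_sub_iff[OF Ob Oa] a Ord_trans[OF Od] by blast
    have above: "\<exists>x. x eps b \<and> v eps J x" if v: "v eps a" for v
    proof -
      obtain y where y: "y eps D" "y eps a" "v eps y" using unb v by blast
      then obtain x where "x eps d" "y = J x" using D by blast
      with y b have "x eps b \<and> v eps J x" by simp
      then show ?thesis by blast
    qed
    obtain f where f: "cofinal f omega a" using cof unfolding cof_omega_iff by blast
    \<comment> \<open>\<open>G n\<close> is the least element of \<open>b\<close> whose image passes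
      the value of \<open>f\<close> at \<open>n\<close>, which turns a map cofinal in
      \<open>a\<close> into one cofinal in \<open>b\<close>.\<close>
    define G where "G n = least (\<lambda>x. x eps b \<and> (\<exists>y. y eps a \<and> rel f n y \<and> y eps J x))" for n
    have cG: "class_graph G" unfolding G_def by (intro def_rules)
    have "\<exists>n. n eps omega \<and> G n eps b \<and> u eps G n" if u: "u eps b" for u
    proof -
      have "J u eps a" using u b by blast
      then obtain n y where n: "n eps omega" "y eps a" "rel f n y" "J u eps y" using f unfolding cofinal_def by blast
      obtain x where x: "x eps b" "y eps J x" using above[OF n(2)] by blast
      then have x': "x eps b \<and> (\<exists>y. y eps a \<and> rel f n y \<and> y eps J x)" using n by blast
      have P: "definable (\<lambda>e. e 0 eps b \<and> (\<exists>y. y eps a \<and> rel f n y \<and> y eps J (e 0)))" by (intro def_rules)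
      from least(2)[of "\<lambda>x. x eps b \<and> (\<exists>y. y eps a \<and> rel f n y \<and> y eps J x)", OF P Ord_mem[OF Ob x(1)] x']
      obtain y' where G: "G n eps b" "y' eps a" "rel f n y'" "y' eps J (G n)" unfolding G_def by blast
      then have "y' = y" using f n unfolding cofinal_def by blast
      have OG: "Ord (G n)" using Ord_mem[OF Ob G(1)] .
      have "J u eps J (G n)" using Ord_trans[OF Ord_J[OF OG] n(4)] G(4) \<open>y' = y\<close> by simp
      then have "u eps G n" using J_mem[OF Ord_mem[OF Ob u] OG] by simp
      with n(1) G(1) show ?thesis by blast
    qed
    from cofinal_graph[OF cG this] have "cof_omega UNIV b" unfolding cof_omega_iff by blast
    then have cb: "cof_omega M b" using cof_omega_agree[OF Ob] by blast
    have "J b = a"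
    proof (rule set_eq)
      fix x
      show "x eps J b \<longleftrightarrow> x eps a"
      proof
        assume "x eps J b"
        then show "x eps a" using J_continuous[OF Ob cb] b Ord_trans[OF Oa] by blast
      next
        assume "x eps a"
        then obtain y where y: "y eps b" "x eps J y" using above by blast
        have "J y eps J b" using J_mem[OF Ord_mem[OF Ob y(1)] Ob] y(1) by simp
        then show "x eps J b" using Ord_trans[OF Ord_J[OF Ob] y(2)] by blast
      qed
    qed
    then show "a eps D" using D bd by blast
  qed
qed

theorem embedding_trivial: "\<not> nontrivial E j M UNIV"
proof
  assume "nontrivial E j M UNIV"
  then obtain k0 where "Ord k0" "J k0 \<noteq> k0" using ex_moved by blast
  moreover have "definable (\<lambda>e. J (e 0) \<noteq> e 0)" by (intro def_rules)
  ultimately obtain k where k: "Ord k" "J k \<noteq> k" and below: "\<forall>c. c eps k \<longrightarrow> \<not> J c \<noteq> c"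
    using Ord_least[of "\<lambda>x. J x \<noteq> x" k0] by blast
  \<comment> \<open>\<open>J y = k\<close> lies below \<open>J k\<close>, so \<open>y\<close> lies
    below \<open>k\<close> and would be fixed.\<close>
  have notJ: "J y \<noteq> k" if y: "Ord y" for y
  proof
    assume Jy: "J y = k"
    have "k eps J k" using k Ord_sub_iff[OF k(1) Ord_J[OF k(1)]] Ord_sub_J[OF k(1)] by auto
    then have "y eps k" using Jy J_mem[OF y k(1)] by simp
    with below Jy show False by auto
  qed
  have "\<not> k eps omega" using k(2) J_Nat by auto
  then have omk: "omega \<sqsubseteq> k" using Ord_not_mem_iff[OF k(1) Ord_omega] by blast
  obtain l where l: "Ord l" "k eps l" "J l = l" using ex_fixed_above[OF k] by blast
  have oml: "omega \<sqsubseteq> l" using subD[OF omk] Ord_trans[OF l(1) _ l(2)] by (simp add: sub_def)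
  obtain d where d: "regular d" "l eps d" "J d = d" using ex_fixed_regular[OF l(1) oml l(3)] by blast
  have Od: "Ord d" using d(1) by (simp add: regular_def)
  have kd: "k eps d" using Ord_trans[OF Od l(2) d(2)] .
  have omd: "omega eps d" using Ord_sub_iff[OF Ord_omega l(1)] oml d(2) Ord_trans[OF Od] by blast
  have dM: "d \<in> M" using Ord_in_M[OF Od] .
  \<comment> \<open>The splitting is needed inside \<open>M\<close> for \<open>J\<close> to apply.
    The map \<open>h\<close> copes only with clubs in \<open>M\<close>, but \<open>J h\<close> copes
    with all clubs in \<open>V\<close>, among them the image of \<open>d\<close>.\<close>
  have "elem (\<lambda>e. \<exists>h\<in>M. splits M h (e 0)) (\<lambda>e. \<exists>h\<in>UNIV. splits UNIV h (e 0))" by (intro elem_rules)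
  from transfer1[OF this dM] ex_splits[OF d(1) omd] d(3) obtain h
    where h: "h \<in> M" "splits M h d" by auto
  have Jh: "splits UNIV (J h) d" using transfer2[OF elem_splits[of 0 1] h(1) dM] h(2) d(3) by simp
  have "class_graph J" by (intro def_rules)
  from small_image[OF this, of d] obtain D where D: "\<And>z. z eps D \<longleftrightarrow> (\<exists>x. x eps d \<and> z = J x)"
    by (auto simp: small_def)
  have "club UNIV D d" by (rule club_image[OF d(1,3) D])
  with Jh kd obtain a where a: "a eps D" "rel (J h) a k" unfolding splits_def by blast
  then obtain b where b: "b eps d" "a = J b" using D by blast
  have bM: "b \<in> M" using M_trans[OF dM b(1)] .
  have "elem (\<lambda>e. \<exists>y\<in>M. rel (e 0) (e 1) y) (\<lambda>e. \<exists>y\<in>UNIV. rel (e 0) (e 1) y)" by (intro elem_rules)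
  from transfer2[OF this h(1) bM] a(2) b(2) obtain y where y: "y \<in> M" "rel h b y" by auto
  have "rel (J h) a (J y)" using transfer3[OF elem_rel[of 0 1 2] h(1) bM y(1)] y(2) b(2) by simp
  with a(2) Jh have "J y = k" unfolding splits_def by blast
  moreover from this have "Ord y" using transfer1[OF elem_Ord[of 0] y(1)] k(1) by simp
  ultimately show False using notJ by blast
qed

end

theorem theorem28:
  fixes E :: "'s \<Rightarrow> 's \<Rightarrow> bool" and \<C> :: "'s set set" and M :: "'s set"
  assumes "NGBC E \<C>"
    and "transitive_class E M"
    and "definable_without_params E M"
  shows "\<not> (\<exists>j\<in>\<C>. elementary_embedding E j M UNIV \<and> nontrivial E j M UNIV)"
proof
  assume "\<exists>j\<in>\<C>. elementary_embedding E j M UNIV \<and> nontrivial E j M UNIV"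
  then obtain j where j: "j \<in> \<C>" "elementary_embedding E j M UNIV" "nontrivial E j M UNIV"
    by blast
  obtain \<phi> where "M = {x. sat E UNIV (\<lambda>_. {}) (\<lambda>_. x) \<phi>}"
    using assms(3) unfolding definable_without_params_def by blast
  then interpret definable_embedding E \<C> M j \<phi>
    using assms(1,2) j(1,2)
    by (intro definable_embedding.intro embedding.intro embedding_axioms.intro
        definable_embedding_axioms.intro)
  from embedding_trivial j(3) show False by blast
qed

end
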